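(* Let $E$ be a complex separable Hilbert space carrying a unitary representation of the dihedral group $D_n$ with generators $\mathcal R,\mathcal S$, and let $E=F_0\oplus\dots\oplus F_{\bar n}$ be the associated orthogonal decomposition into $D_n$-stable subspaces. Let $\mathcal A:[0,1]\to\mathcal F^{\mathrm{sa}}(E)$ be a continuous path of bounded selfadjoint Fredholm operators such that $\mathcal A(\lambda)\mathcal R=\mathcal R\mathcal A(\lambda)$ and $\mathcal A(\lambda)\mathcal S=\mathcal S\mathcal A(\lambda)$ for all $\lambda\in[0,1]$, and for $k=0,\dots,\bar n$ let $\mathcal A_k=\mathcal A|_{F_k}:[0,1]\to\mathcal F^{\mathrm{sa}}(F_k)$. Then $$\operatorname{sf}(\mathcal A;[0,1])=\operatorname{sf}(\mathcal A_0;[0,1])+\dots+\operatorname{sf}(\mathcal A_{\bar n};[0,1]).$$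
   Context: $n\ge 1$ is an integer. The unitary representation of $D_n$ in $E$ is given by unitary operators $\mathcal R,\mathcal S$ on $E$ with $\mathcal R^n=\mathcal S^2=(\mathcal S\mathcal R)^2=\mathrm{Id}_E$. Let $\zeta_n=e^{2\pi i/n}$ and $E_k=\ker(\mathcal R-\zeta_n^k\mathrm{Id}_E)$ for $k\in\mathbb Z$ (so $E_k$ depends only on $k$ mod $n$). Let $\bar n=\lfloor n/2\rfloor$. Define $F_0=E_0$; $F_k=E_k\oplus E_{-k}$ for $1\le k\le\lfloor (n-1)/2\rfloor$; and, if $n$ is even, $F_{n/2}=E_{n/2}$. These are mutually orthogonal $D_n$-stable closed subspaces with sum $E$. $\mathcal F^{\mathrm{sa}}(E)$ is the space of bounded selfadjoint Fredholm operators on $E$ with the norm topology. Spectral flow: for a continuous path $\mathcal A:[a,b]\to\mathcal F^{\mathrm{sa}}(E)$ there are a partition $a=t_0<\dots<t_N=b$ and numbers $a_i>0$ such that, for $t\in[t_{i-1},t_i]$, $\pm a_i\notin\sigma(\mathcal A_t)$ and the spectral subspace $E_{[-a_i,a_i]}(\mathcal A_t)$ has finite dimension independent of $t$. Then $\operatorname{sf}(\mathcal A;[a,b])=\sum_{i=1}^N\big(\dim E_{[0,a_i]}(\mathcal A_{t_i})-\dim E_{[0,a_i]}(\mathcal A_{t_{i-1}})\big)$, where $E_{[c,d]}(T)$ is the spectral subspace of $T$ for $[c,d]$; this is independent of the choices. *)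

theory Defs
  imports "HOL-Analysis.Analysis"
begin

(* The norm and topology come from the underlying real inner product, which is the real part
   of the complex one.  The complex inner product is linear in its first argument. *)

class scaleC =
  fixes scaleC :: "complex \<Rightarrow> 'a \<Rightarrow> 'a"  (infixr "*\<^sub>C" 75)

class complex_inner = real_inner + scaleC +
  fixes cinner :: "'a \<Rightarrow> 'a \<Rightarrow> complex"
  assumes scaleC_add_right: "c *\<^sub>C (x + y) = c *\<^sub>C x + c *\<^sub>C y"
    and scaleC_add_left: "(c + d) *\<^sub>C x = c *\<^sub>C x + d *\<^sub>C x"
    and scaleC_scaleC: "c *\<^sub>C d *\<^sub>C x = (c * d) *\<^sub>C x"
    and scaleC_of_real: "of_real r *\<^sub>C x = r *\<^sub>R x"
    and cinner_commute: "cinner x y = cnj (cinner y x)"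
    and cinner_add_left: "cinner (x + y) z = cinner x z + cinner y z"
    and cinner_scaleC_left: "cinner (c *\<^sub>C x) y = c * cinner x y"
    and Re_cinner: "Re (cinner x y) = inner x y"

class complex_hilbert = complex_inner + complete_space

global_interpretation complex_vector: vector_space "scaleC :: complex \<Rightarrow> 'a \<Rightarrow> 'a::complex_inner"
proof
  fix x :: 'a
  show "1 *\<^sub>C x = x"
    using scaleC_of_real[of 1 x] by simp
qed (simp_all add: scaleC_add_right scaleC_add_left scaleC_scaleC)

instantiation complex :: complex_hilbert
begin

definition scaleC_complex :: "complex \<Rightarrow> complex \<Rightarrow> complex"
  where "scaleC_complex c x = c * x"

definition cinner_complex :: "complex \<Rightarrow> complex \<Rightarrow> complex"
  where "cinner_complex x y = x * cnj y"

instance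
  by standard
    (auto simp: scaleC_complex_def cinner_complex_def inner_complex_def scaleR_conv_of_real
       algebra_simps)

end


(* Below, V is a closed complex subspace, regarded as a Hilbert space in its own right, and an
   operator on V is a function of which only the values on V matter.  The case V = UNIV is the
   whole Hilbert space. *)

definition finite_dim :: "'a::complex_inner set \<Rightarrow> bool"
  where "finite_dim W \<longleftrightarrow> (\<exists>B. finite B \<and> W = complex_vector.span B)"

definition bounded_op_on :: "'a::complex_inner set \<Rightarrow> ('a \<Rightarrow> 'a) \<Rightarrow> bool"
  where "bounded_op_on V T \<longleftrightarrow>
    (\<forall>x\<in>V. T x \<in> V) \<and>
    (\<forall>x\<in>V. \<forall>y\<in>V. T (x + y) = T x + T y) \<and>
    (\<forall>c. \<forall>x\<in>V. T (c *\<^sub>C x) = c *\<^sub>C T x) \<and>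
    (\<exists>K. \<forall>x\<in>V. norm (T x) \<le> K * norm x)"

definition selfadjoint_on :: "'a::complex_inner set \<Rightarrow> ('a \<Rightarrow> 'a) \<Rightarrow> bool"
  where "selfadjoint_on V T \<longleftrightarrow>
    bounded_op_on V T \<and> (\<forall>x\<in>V. \<forall>y\<in>V. cinner (T x) y = cinner x (T y))"

(* The last conjunct says that the cokernel V / T V has finite dimension. *)
definition fredholm_on :: "'a::complex_inner set \<Rightarrow> ('a \<Rightarrow> 'a) \<Rightarrow> bool"
  where "fredholm_on V T \<longleftrightarrow>
    bounded_op_on V T \<and> finite_dim {x\<in>V. T x = 0} \<and> closed (T ` V) \<and>
    (\<exists>B. finite B \<and> B \<subseteq> V \<and> complex_vector.span (T ` V \<union> B) = V)"

definition Fredholm_sa :: "'a::complex_inner set \<Rightarrow> ('a \<Rightarrow> 'a) set"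
  where "Fredholm_sa V = {T. selfadjoint_on V T \<and> fredholm_on V T}"

definition spectrum_on :: "'a::complex_inner set \<Rightarrow> ('a \<Rightarrow> 'a) \<Rightarrow> complex set"
  where "spectrum_on V T =
    {z. \<not> (\<exists>S. bounded_op_on V S \<and> (\<forall>x\<in>V. S (T x - z *\<^sub>C x) = x \<and> T (S x) - z *\<^sub>C S x = x))}"


definition orthogonal_projection_on :: "'a::complex_inner set \<Rightarrow> ('a \<Rightarrow> 'a) \<Rightarrow> bool"
  where "orthogonal_projection_on V P \<longleftrightarrow> selfadjoint_on V P \<and> (\<forall>x\<in>V. P (P x) = P x)"

(* P is the spectral family (resolution of the identity) of the selfadjoint operator T, that is
   T is the integral of l dP(l).  As <P(l) x, x> = (norm (P l x))^2, the last conjunct says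
   <T x, x> is the Stieltjes integral of l d<P(l) x, x>. *)
definition spectral_family_on ::
  "'a::complex_inner set \<Rightarrow> ('a \<Rightarrow> 'a) \<Rightarrow> (real \<Rightarrow> 'a \<Rightarrow> 'a) \<Rightarrow> bool"
  where "spectral_family_on V T P \<longleftrightarrow>
    (\<forall>l. orthogonal_projection_on V (P l)) \<and>
    (\<forall>l m. \<forall>x\<in>V. P l (P m x) = P (min l m) x) \<and>
    (\<forall>x\<in>V. (\<forall>l. continuous (at_right l) (\<lambda>m. P m x)) \<and>
           ((\<lambda>m. P m x) \<longlongrightarrow> 0) at_bot \<and> ((\<lambda>m. P m x) \<longlongrightarrow> x) at_top) \<and>
    (\<forall>x\<in>V. has_bochner_integral (interval_measure (\<lambda>l. (norm (P l x))\<^sup>2)) (\<lambda>l. l)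
              (Re (cinner (T x) x)))"

(* By the spectral theorem a bounded selfadjoint operator has exactly one spectral family (as far
   as values on V are concerned).  The spectral projection for [c,d] is P(d) - P(c-0), where
   P(c-0) is the strong limit from the left. *)
definition spectral_projection ::
  "'a::complex_inner set \<Rightarrow> ('a \<Rightarrow> 'a) \<Rightarrow> real \<Rightarrow> real \<Rightarrow> 'a \<Rightarrow> 'a"
  where "spectral_projection V T c d x =
    (let P = (SOME P. spectral_family_on V T P)
     in P d x - Lim (at_left c) (\<lambda>l. P l x))"

definition spectral_subspace ::
  "'a::complex_inner set \<Rightarrow> ('a \<Rightarrow> 'a) \<Rightarrow> real \<Rightarrow> real \<Rightarrow> 'a set"
  where "spectral_subspace V T c d = spectral_projection V T c d ` V"


definition sf_partition ::
  "'a::complex_inner set \<Rightarrow> (real \<Rightarrow> 'a \<Rightarrow> 'a) \<Rightarrow> real \<Rightarrow> real \<Rightarrow> nat \<Rightarrow> (nat \<Rightarrow> real) \<Rightarrow> (nat \<Rightarrow> real) \<Rightarrow> bool"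
  where "sf_partition V A a b N t \<alpha> \<longleftrightarrow>
    t 0 = a \<and> t N = b \<and> (\<forall>i\<in>{1..N}. t (i - 1) < t i) \<and>
    (\<forall>i\<in>{1..N}. \<alpha> i > 0 \<and>
      (\<forall>s\<in>{t (i - 1)..t i}.
        of_real (\<alpha> i) \<notin> spectrum_on V (A s) \<and> of_real (- \<alpha> i) \<notin> spectrum_on V (A s) \<and>
        finite_dim (spectral_subspace V (A s) (- \<alpha> i) (\<alpha> i))) \<and>
      (\<exists>m. \<forall>s\<in>{t (i - 1)..t i}.
        complex_vector.dim (spectral_subspace V (A s) (- \<alpha> i) (\<alpha> i)) = m))"

definition spectral_flow ::
  "'a::complex_inner set \<Rightarrow> (real \<Rightarrow> 'a \<Rightarrow> 'a) \<Rightarrow> real \<Rightarrow> real \<Rightarrow> int"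
  where "spectral_flow V A a b =
    (THE s. \<exists>N t \<alpha>. sf_partition V A a b N t \<alpha> \<and>
       s = (\<Sum>i=1..N. int (complex_vector.dim (spectral_subspace V (A (t i)) 0 (\<alpha> i)))
                     - int (complex_vector.dim (spectral_subspace V (A (t (i - 1))) 0 (\<alpha> i)))))"


definition unitary_op :: "('a::complex_inner \<Rightarrow> 'a) \<Rightarrow> bool"
  where "unitary_op U \<longleftrightarrow>
    bounded_op_on UNIV U \<and> surj U \<and> (\<forall>x y. cinner (U x) (U y) = cinner x y)"

definition dihedral_unitary_rep :: "nat \<Rightarrow> ('a::complex_inner \<Rightarrow> 'a) \<Rightarrow> ('a \<Rightarrow> 'a) \<Rightarrow> bool"
  where "dihedral_unitary_rep n R S \<longleftrightarrow>
    unitary_op R \<and> unitary_op S \<and> R ^^ n = id \<and> S ^^ 2 = id \<and> (S \<circ> R) ^^ 2 = id"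

definition dihedral_E :: "nat \<Rightarrow> ('a::complex_inner \<Rightarrow> 'a) \<Rightarrow> int \<Rightarrow> 'a set"
  where "dihedral_E n R k = {x. R x = (exp (2 * of_real pi * \<i> / of_nat n) powi k) *\<^sub>C x}"

definition dihedral_F :: "nat \<Rightarrow> ('a::complex_inner \<Rightarrow> 'a) \<Rightarrow> nat \<Rightarrow> 'a set"
  where "dihedral_F n R k =
    (if k = 0 \<or> 2 * k = n then dihedral_E n R (int k)
     else {x + y | x y. x \<in> dihedral_E n R (int k) \<and> y \<in> dihedral_E n R (- int k)})"

end

theory Submission
  imports Defs "HOL-Probability.Distribution_Functions"
begin

text \<open>
The spectral flow is additive because everything it is made of is additive over subspaces that
reduce the path.  A partition that is admissible for \<open>A\<close> on the whole space is admissible on every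
\<open>F k\<close>, and then the spectral flow of \<open>A\<close> and of its restrictions are sums, over the same partition,
of differences of dimensions of spectral subspaces for \<open>[0, \<alpha>]\<close>.  The spectral projections of \<open>A\<close> commute with the
rotation, so each spectral subspace is the orthogonal direct sum of its intersections with the
\<open>F k\<close> (\<open>dim_range_eq_sum\<close>), and these intersections are the spectral subspaces of the restrictions.

For this argument to apply, three things behind the definition of the spectral flow must be
established.

\<^item> The spectral subspaces are the expected ones.  They are defined by a choice of a spectral family,
  so existence and uniqueness of that family are needed on a closed reducing subspace \<open>V\<close>.  For
  existence, the projection \<open>below T l\<close> for \<open>(-\<infinity>, l]\<close> is read off from the absolute value of
  \<open>T - l\<close>, which comes from an operator square root (\<open>operator_square_root\<close>,
  \<open>sign_decomposition\<close>), and the Stieltjes integral is identified by an increment argument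
  (\<open>spectral_integral\<close>).  As \<open>below T l\<close> commutes with everything that commutes with \<open>T\<close>, it restricts
  to \<open>V\<close>.  For uniqueness, any other family commutes with \<open>T\<close>, hence with \<open>below T l\<close>, and then
  the values of the quadratic form of \<open>T\<close> leave no room for a difference
  (\<open>spectral_family_unique\<close>).  Consequently the
  spectral subspace of \<open>T\<close> on \<open>V\<close> for \<open>[c, d]\<close> is the image of \<open>V\<close> under one operator
  \<open>window T c d\<close>, defined on the whole space.

\<^item> The sum that defines the spectral flow does not depend on the partition.  A number \<open>c\<close> is outside
  the spectrum precisely when \<open>T - c\<close> is bounded below on \<open>V\<close>.  If this holds at \<open>c\<close> and at \<open>d\<close>, then
  \<open>T\<close> minus the midpoint of \<open>[c, d]\<close> is definitely smaller than half the length on the window and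
  definitely larger off it, so that the dimension of the window survives small perturbations
  (\<open>window_dim_stable\<close>).  Two partitions then have partial flows with locally constant difference
  (\<open>partition_flow_unique\<close>).

\<^item> Partitions exist.  A selfadjoint Fredholm operator is bounded below off its kernel, by uniform
  boundedness, so small windows around \<open>0\<close> are equal to the kernel (\<open>Fredholm_window\<close>);
  stability and compactness of the interval give the partition.

Selfadjointness is treated as symmetry for the underlying real inner product, and complex linearity as
commutation with multiplication by \<open>\<i>\<close>; the spectral theory is done for real Hilbert spaces, and its
projections inherit complex linearity from the commutation property.
\<close>



section \<open>Orthogonal projections in a real Hilbert space\<close>

definition symmetric_op :: "('a::real_inner \<Rightarrow>\<^sub>L 'a) \<Rightarrow> bool"
  where "symmetric_op T \<longleftrightarrow> (\<forall>x y. T x \<bullet> y = x \<bullet> T y)"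

definition projection_op :: "('a::real_inner \<Rightarrow>\<^sub>L 'a) \<Rightarrow> bool"
  where "projection_op P \<longleftrightarrow> symmetric_op P \<and> (\<forall>x. P (P x) = P x)"

definition commutes :: "('a::real_normed_vector \<Rightarrow>\<^sub>L 'a) \<Rightarrow> ('a \<Rightarrow>\<^sub>L 'a) \<Rightarrow> bool"
  where "commutes S T \<longleftrightarrow> (\<forall>x. S (T x) = T (S x))"

lemma symmetric_opD: "symmetric_op T \<Longrightarrow> T x \<bullet> y = x \<bullet> T y"
  by (simp add: symmetric_op_def)

lemma projection_opD:
  assumes "projection_op P"
  shows "P x \<bullet> y = x \<bullet> P y" "P (P x) = P x"
  using assms by (auto simp: projection_op_def symmetric_op_def)

lemma commutesD: "commutes S T \<Longrightarrow> S (T x) = T (S x)"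
  by (simp add: commutes_def)

lemma commutes_sym: "commutes S T \<Longrightarrow> commutes T S"
  by (simp add: commutes_def)

lemma symmetric_op_diff_id: "symmetric_op T \<Longrightarrow> symmetric_op (T - c *\<^sub>R id_blinfun)"
  by (simp add: symmetric_op_def blinfun.diff_left blinfun.scaleR_left inner_diff)

lemma commutes_diff_id: "commutes C T \<Longrightarrow> commutes C (T - c *\<^sub>R id_blinfun)"
  by (simp add: commutes_def blinfun.diff_left blinfun.diff_right blinfun.scaleR_left
      blinfun.scaleR_right)

lemma projection_op_Pythagoras:
  assumes "projection_op P"
  shows "(norm x)\<^sup>2 = (norm (P x))\<^sup>2 + (norm (x - P x))\<^sup>2"
proof -
  have "P x \<bullet> (x - P x) = 0"
    using projection_opD[OF assms] by (simp add: inner_diff_right)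
  then show ?thesis
    by (metis add.commute diff_add_cancel inner_commute norm_add_Pythagorean orthogonal_def)
qed

lemma projection_op_norm_le: "projection_op P \<Longrightarrow> norm (P x) \<le> norm x"
  using projection_op_Pythagoras[of P x] by (intro power2_le_imp_le[OF _ norm_ge_zero]) simp

lemma projection_op_complement:
  "projection_op P \<Longrightarrow> projection_op (id_blinfun - P)"
  by (simp add: projection_op_def symmetric_op_def blinfun.diff_left blinfun.diff_right inner_diff)

text \<open>Points of \<open>M\<close> that are nearly closest to \<open>x\<close> are close to each other by the parallelogram
  law, so the nested sets of such points shrink to a nearest point; the residual at a nearest point
  is orthogonal to \<open>M\<close>.\<close>

lemma closed_subspace_orthogonal_decomposition:
  fixes M :: "'a::{real_inner,banach} set"
  assumes "closed M" "subspace M"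
  shows "\<exists>y\<in>M. \<forall>z\<in>M. (x - y) \<bullet> z = 0"
proof -
  define d where "d = infdist x M"
  define h where "h n = 1 / real (Suc n)" for n
  define s where "s n = {y \<in> M. dist x y \<le> d + h n}" for n
  have ne: "M \<noteq> {}" using assms(2) subspace_0 by blast
  have d0: "0 \<le> d" by (simp add: d_def infdist_nonneg)
  have dle: "d \<le> dist x y" if "y \<in> M" for y using that by (simp add: d_def infdist_le)
  have h0: "0 < h n" for n by (simp add: h_def)
  obtain a where a: "\<And>n. a \<in> s n"
  proof (rule decreasing_closed_nest[of s])
    show "closed (s n)" for n
    proof -
      have "s n = M \<inter> cball x (d + h n)" by (auto simp: s_def)
      then show ?thesis using assms by auto
    qed
    show "s n \<noteq> {}" for n
    proof -
      have "infdist x M < d + h n" using h0 d_def by simp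
      then obtain y where "y \<in> M" "dist x y < d + h n"
        using ne by (auto simp: infdist_def cINF_less_iff)
      then show ?thesis by (auto simp: s_def)
    qed
    show "s n \<subseteq> s m" if "m \<le> n" for m n
    proof -
      have "h n \<le> h m" using that by (simp add: h_def field_simps)
      then show ?thesis by (auto simp: s_def)
    qed
    show "\<exists>n. \<forall>y\<in>s n. \<forall>z\<in>s n. dist y z < e" if "0 < e" for e
    proof -
      have h_lim: "h \<longlonglongrightarrow> 0" unfolding h_def by (rule LIMSEQ_Suc) (rule lim_1_over_n)
      have "(\<lambda>n. 4 * (d + h n)\<^sup>2 - 4 * d\<^sup>2) \<longlonglongrightarrow> 4 * (d + 0)\<^sup>2 - 4 * d\<^sup>2"
        by (intro tendsto_intros h_lim)
      then have "\<forall>\<^sub>F n in sequentially. 4 * (d + h n)\<^sup>2 - 4 * d\<^sup>2 < e\<^sup>2"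
        by (rule order_tendstoD) (use that in simp)
      then obtain n where n: "4 * (d + h n)\<^sup>2 - 4 * d\<^sup>2 < e\<^sup>2"
        by (auto simp: eventually_sequentially)
      have "dist y z < e" if yz: "y \<in> s n" "z \<in> s n" for y z
      proof -
        have yzM: "y \<in> M" "z \<in> M" using yz by (auto simp: s_def)
        have "(1/2) *\<^sub>R (y + z) \<in> M" using yzM assms(2) by (simp add: subspace_add subspace_scale)
        then have "d \<le> norm (x - (1/2) *\<^sub>R (y + z))" using dle by (simp add: dist_norm)
        then have mid: "d\<^sup>2 \<le> (norm (x - (1/2) *\<^sub>R (y + z)))\<^sup>2" using d0 by (simp add: power_mono)
        have par: "(norm (y - z))\<^sup>2 = 2 * (norm (x - y))\<^sup>2 + 2 * (norm (x - z))\<^sup>2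
            - 4 * (norm (x - (1/2) *\<^sub>R (y + z)))\<^sup>2"
          by (simp add: power2_norm_eq_inner inner_diff inner_add inner_commute algebra_simps)
        have "(norm (x - y))\<^sup>2 \<le> (d + h n)\<^sup>2" "(norm (x - z))\<^sup>2 \<le> (d + h n)\<^sup>2"
          using yz by (auto simp: s_def dist_norm intro!: power_mono)
        then have "(norm (y - z))\<^sup>2 < e\<^sup>2" using par mid n by linarith
        then show ?thesis using \<open>0 < e\<close> by (simp add: dist_norm power2_less_imp_less)
      qed
      then show ?thesis by blast
    qed
  qed (rule that)
  then have aM: "a \<in> M" by (auto simp: s_def)
  have "dist x a \<le> d + e" if "0 < e" for e
  proof -
    obtain n where "inverse (real (Suc n)) < e" using reals_Archimedean[OF \<open>0 < e\<close>] by blast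
    then have "h n < e" by (simp add: h_def inverse_eq_divide)
    then show ?thesis using a[of n] by (simp add: s_def)
  qed
  then have da: "norm (x - a) \<le> d" by (metis dist_norm field_le_epsilon)
  have "(x - a) \<bullet> z = 0" if z: "z \<in> M" for z
  proof (cases "z = 0")
    case False
    \<comment> \<open>The best multiple of \<open>z\<close> to add to \<open>a\<close>; it must be \<open>0\<close>.\<close>
    define t where "t = ((x - a) \<bullet> z) / (z \<bullet> z)"
    have "a + t *\<^sub>R z \<in> M" using aM z assms(2) by (simp add: subspace_add subspace_scale)
    then have "norm (x - a) \<le> norm ((x - a) - t *\<^sub>R z)"
      using dle[of "a + t *\<^sub>R z"] da by (simp add: dist_norm algebra_simps)
    then have "(norm (x - a))\<^sup>2 \<le> (norm ((x - a) - t *\<^sub>R z))\<^sup>2" by (simp add: power_mono)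
    also have "\<dots> = (norm (x - a))\<^sup>2 - 2 * t * ((x - a) \<bullet> z) + t\<^sup>2 * (z \<bullet> z)"
      unfolding power2_norm_eq_inner
      by (simp add: inner_diff_left inner_diff_right inner_commute power2_eq_square algebra_simps)
    also have "\<dots> = (norm (x - a))\<^sup>2 - ((x - a) \<bullet> z)\<^sup>2 / (z \<bullet> z)"
      using False by (simp add: t_def power2_eq_square field_simps)
    finally have "((x - a) \<bullet> z)\<^sup>2 / (z \<bullet> z) \<le> 0" by simp
    then show ?thesis using False
      by (metis divide_le_0_iff inner_gt_zero_iff not_le power2_less_eq_zero_iff)
  qed simp
  then show ?thesis using aM by blast
qed

definition proj_onto :: "'a::{real_inner,banach} set \<Rightarrow> 'a \<Rightarrow>\<^sub>L 'a"
  where "proj_onto M = (SOME p :: 'a \<Rightarrow>\<^sub>L 'a. \<forall>x. p x \<in> M \<and> (\<forall>z\<in>M. (x - p x) \<bullet> z = 0))"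

lemma proj_onto:
  fixes M :: "'a::{real_inner,banach} set"
  assumes M: "closed M" "subspace M"
  shows proj_onto_in: "proj_onto M x \<in> M"
    and proj_onto_orthogonal: "z \<in> M \<Longrightarrow> (x - proj_onto M x) \<bullet> z = 0"
proof -
  obtain f where f: "\<And>x. f x \<in> M" "\<And>x z. z \<in> M \<Longrightarrow> (x - f x) \<bullet> z = 0"
    using closed_subspace_orthogonal_decomposition[OF M] by metis
  have unique: "y = f x" if y: "y \<in> M" "\<And>z. z \<in> M \<Longrightarrow> (x - y) \<bullet> z = 0" for x y
  proof -
    have m: "y - f x \<in> M" using y f M(2) by (simp add: subspace_diff)
    have "(y - f x) \<bullet> (y - f x) = (x - f x) \<bullet> (y - f x) - (x - y) \<bullet> (y - f x)"
      by (simp add: inner_diff_left)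
    also have "\<dots> = 0" using f(2) y(2) m by simp
    finally show ?thesis by simp
  qed
  have "bounded_linear f"
  proof (rule bounded_linear_intro[of f 1])
    show "f (x + y) = f x + f y" for x y
    proof (rule unique[symmetric])
      show "f x + f y \<in> M" using f M(2) by (simp add: subspace_add)
      show "(x + y - (f x + f y)) \<bullet> z = 0" if "z \<in> M" for z
        using f(2)[OF that, of x] f(2)[OF that, of y] by (simp add: inner_diff_left inner_add_left)
    qed
    show "f (r *\<^sub>R x) = r *\<^sub>R f x" for r x
    proof (rule unique[symmetric])
      show "r *\<^sub>R f x \<in> M" using f M(2) by (simp add: subspace_scale)
      show "(r *\<^sub>R x - r *\<^sub>R f x) \<bullet> z = 0" if "z \<in> M" for z
        using f(2)[OF that, of x] by (simp add: inner_diff_left)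
    qed
    show "norm (f x) \<le> norm x * 1" for x
    proof -
      have "(x - f x) \<bullet> f x = 0" using f by simp
      then have "(norm (f x))\<^sup>2 + (norm (x - f x))\<^sup>2 = (norm x)\<^sup>2"
        unfolding power2_norm_eq_inner by (simp add: inner_diff inner_commute algebra_simps)
      then show ?thesis by (metis le_add_same_cancel1 mult.right_neutral norm_ge_zero power2_le_imp_le zero_le_power2)
    qed
  qed
  then have "\<forall>x. Blinfun f x \<in> M \<and> (\<forall>z\<in>M. (x - Blinfun f x) \<bullet> z = 0)"
    using f by (simp add: bounded_linear_Blinfun_apply)
  then have "\<forall>x. proj_onto M x \<in> M \<and> (\<forall>z\<in>M. (x - proj_onto M x) \<bullet> z = 0)"
    unfolding proj_onto_def by (rule someI)
  then show "proj_onto M x \<in> M" "z \<in> M \<Longrightarrow> (x - proj_onto M x) \<bullet> z = 0" by auto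
qed

lemma proj_onto_eqI:
  fixes M :: "'a::{real_inner,banach} set"
  assumes M: "closed M" "subspace M" and y: "y \<in> M" "\<And>z. z \<in> M \<Longrightarrow> (x - y) \<bullet> z = 0"
  shows "proj_onto M x = y"
proof -
  let ?p = "proj_onto M x"
  have m: "y - ?p \<in> M" using y M by (simp add: subspace_diff proj_onto_in)
  have "(y - ?p) \<bullet> (y - ?p) = (x - ?p) \<bullet> (y - ?p) - (x - y) \<bullet> (y - ?p)"
    by (simp add: inner_diff_left)
  also have "\<dots> = 0" using proj_onto_orthogonal[OF M m] y(2) m by simp
  finally show ?thesis by simp
qed

lemma proj_onto_ident:
  assumes "closed M" "subspace M" "x \<in> M"
  shows "proj_onto M x = x"
  using assms by (intro proj_onto_eqI) auto

lemma projection_op_proj_onto: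
  assumes M: "closed M" "subspace M"
  shows "projection_op (proj_onto M)"
proof -
  have "proj_onto M x \<bullet> y = x \<bullet> proj_onto M y" for x y
  proof -
    have "(x - proj_onto M x) \<bullet> proj_onto M y = 0" "(y - proj_onto M y) \<bullet> proj_onto M x = 0"
      using M by (auto intro: proj_onto_orthogonal proj_onto_in)
    then show ?thesis by (simp add: inner_diff inner_commute)
  qed
  then show ?thesis
    using M by (simp add: projection_op_def symmetric_op_def proj_onto_ident proj_onto_in)
qed

text \<open>An operator that preserves a closed subspace and its orthogonal complement commutes with the
  projection.\<close>

lemma commutes_proj_onto:
  fixes C :: "'a::{real_inner,banach} \<Rightarrow>\<^sub>L 'a"
  assumes M: "closed M" "subspace M"
    and inv: "\<And>x. x \<in> M \<Longrightarrow> C x \<in> M"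
    and inv_perp: "\<And>x z. (\<And>z. z \<in> M \<Longrightarrow> x \<bullet> z = 0) \<Longrightarrow> z \<in> M \<Longrightarrow> C x \<bullet> z = 0"
  shows "commutes C (proj_onto M)"
proof -
  have "proj_onto M (C x) = C (proj_onto M x)" for x
  proof (rule proj_onto_eqI[OF M])
    show "C (proj_onto M x) \<in> M" using inv proj_onto_in[OF M] by blast
    show "(C x - C (proj_onto M x)) \<bullet> z = 0" if "z \<in> M" for z
      using inv_perp[of "x - proj_onto M x" z] that proj_onto_orthogonal[OF M]
      by (simp add: blinfun.diff_right)
  qed
  then show ?thesis by (simp add: commutes_def)
qed

lemma symmetric_commutes_proj_onto:
  fixes T :: "'a::{real_inner,banach} \<Rightarrow>\<^sub>L 'a"
  assumes M: "closed M" "subspace M"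
    and "symmetric_op T" and inv: "\<And>x. x \<in> M \<Longrightarrow> T x \<in> M"
  shows "commutes T (proj_onto M)"
  using assms by (intro commutes_proj_onto) (auto simp: symmetric_opD)


section \<open>The sign decomposition of a symmetric operator\<close>

lemma norm_blinfun_compose_diff_le:
  fixes Y Z :: "'a::real_normed_vector \<Rightarrow>\<^sub>L 'a"
  shows "norm ((Y o\<^sub>L Y) - (Z o\<^sub>L Z)) \<le> (norm Y + norm Z) * norm (Y - Z)"
proof -
  have "(Y o\<^sub>L Y) - (Z o\<^sub>L Z) = (Y o\<^sub>L (Y - Z)) + ((Y - Z) o\<^sub>L Z)"
    by (rule blinfun_eqI) (simp add: blinfun.diff_left blinfun.add_left blinfun.diff_right)
  also have "norm \<dots> \<le> norm Y * norm (Y - Z) + norm (Y - Z) * norm Z"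
    by (intro norm_triangle_le add_mono norm_blinfun_compose)
  finally show ?thesis by (simp add: algebra_simps)
qed

text \<open>Write \<open>A = 1 - X\<close> with \<open>\<parallel>X\<parallel> \<le> 1\<close>.  A root \<open>1 - Y\<close> of \<open>A\<close> is a fixed point of
  \<open>Y \<mapsto> (X + Y\<^sup>2) / 2\<close>.  The iterates \<open>Y\<^sub>n\<close> from \<open>0\<close> converge in norm because they are dominated by the
  scalar iterates \<open>a\<^sub>n\<close> for \<open>X = 1\<close>, which increase and are bounded by \<open>1\<close>.\<close>

lemma operator_square_root:
  fixes A :: "'a::{real_inner,banach} \<Rightarrow>\<^sub>L 'a"
  assumes A: "symmetric_op A" and X_le: "norm (id_blinfun - A) \<le> 1"
  obtains B where "symmetric_op B" "\<And>x. 0 \<le> B x \<bullet> x" "\<And>x. B (B x) = A x"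
    "\<And>C. commutes C A \<Longrightarrow> commutes C B"
proof -
  define X where "X = id_blinfun - A"
  define g :: "('a \<Rightarrow>\<^sub>L 'a) \<Rightarrow> ('a \<Rightarrow>\<^sub>L 'a)" where "g Z = (1/2) *\<^sub>R (X + (Z o\<^sub>L Z))" for Z
  define Y where "Y n = (g ^^ n) 0" for n
  define a where "a n = ((\<lambda>z::real. (1 + z\<^sup>2) / 2) ^^ n) 0" for n
  have Y_0: "Y 0 = 0" and Y_Suc: "Y (Suc n) = (1/2) *\<^sub>R (X + (Y n o\<^sub>L Y n))" for n
    by (simp_all add: Y_def g_def)
  have a_0: "a 0 = 0" and a_Suc: "a (Suc n) = (1 + (a n)\<^sup>2) / 2" for n
    by (simp_all add: a_def)
  have a_bounds: "0 \<le> a n \<and> a n \<le> 1" for n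
  proof (induction n)
    case (Suc n)
    then have "(a n)\<^sup>2 \<le> 1" by (simp add: power_le_one)
    then show ?case by (simp add: a_Suc)
  qed (simp add: a_0)
  have Y_le: "norm (Y n) \<le> a n" for n
  proof (induction n)
    case (Suc n)
    have "norm (X + (Y n o\<^sub>L Y n)) \<le> 1 + norm (Y n) * norm (Y n)"
      using X_le by (intro norm_triangle_le add_mono norm_blinfun_compose) (simp_all add: X_def)
    also have "\<dots> \<le> 1 + (a n)\<^sup>2"
      using Suc by (simp add: power2_eq_square mult_mono')
    finally show ?case by (simp add: Y_Suc a_Suc)
  qed (simp add: Y_0 a_0)
  have step: "norm (Y (Suc n) - Y n) \<le> a (Suc n) - a n" for n
  proof (induction n)
    case 0
    then show ?case using X_le by (simp add: Y_Suc Y_0 a_Suc a_0 X_def)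
  next
    case (Suc n)
    have "Y (Suc (Suc n)) - Y (Suc n) = (1/2) *\<^sub>R ((Y (Suc n) o\<^sub>L Y (Suc n)) - (Y n o\<^sub>L Y n))"
      by (simp add: Y_Suc[of "Suc n"] Y_Suc[of n] scaleR_right_distrib scaleR_right_diff_distrib)
    then have "norm (Y (Suc (Suc n)) - Y (Suc n))
        \<le> ((norm (Y (Suc n)) + norm (Y n)) * norm (Y (Suc n) - Y n)) / 2"
      using norm_blinfun_compose_diff_le[of "Y (Suc n)" "Y n"] by simp
    also have "\<dots> \<le> ((a (Suc n) + a n) * (a (Suc n) - a n)) / 2"
      using Y_le[of n] Y_le[of "Suc n"] Suc a_bounds
      by (intro divide_right_mono mult_mono add_mono add_nonneg_nonneg) auto
    also have "\<dots> = a (Suc (Suc n)) - a (Suc n)"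
      by (simp add: a_Suc[of "Suc n"] a_Suc[of n] power2_eq_square field_simps)
    finally show ?case .
  qed
  have dist_Y: "norm (Y (n + k) - Y n) \<le> a (n + k) - a n" for n k
  proof (induction k)
    case (Suc k)
    have "norm (Y (Suc (n + k)) - Y n) \<le> norm (Y (Suc (n + k)) - Y (n + k)) + norm (Y (n + k) - Y n)"
      using norm_triangle_ineq[of "Y (Suc (n + k)) - Y (n + k)" "Y (n + k) - Y n"] by simp
    then show ?case using Suc step[of "n + k"] by simp
  qed simp
  have "incseq a"
    by (rule incseq_SucI) (use step in \<open>metis diff_ge_0_iff_ge norm_ge_zero order_trans\<close>)
  then have "Cauchy a"
    using a_bounds by (intro convergent_Cauchy Bseq_mono_convergent BseqI'[of _ 1])
      (auto simp: incseq_def)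
  have "Cauchy Y"
  proof (rule metric_CauchyI)
    fix e :: real assume "0 < e"
    with \<open>Cauchy a\<close> obtain N where N: "\<And>m n. m \<ge> N \<Longrightarrow> n \<ge> N \<Longrightarrow> dist (a m) (a n) < e"
      unfolding Cauchy_def by blast
    have *: "dist (Y m) (Y n) < e" if "n \<ge> N" "m \<ge> n" for m n
    proof -
      obtain k where "m = n + k" using \<open>n \<le> m\<close> unfolding le_iff_add ..
      then show ?thesis
        using dist_Y[of n k] N[of m n] that by (auto simp: dist_norm)
    qed
    show "\<exists>M. \<forall>m\<ge>M. \<forall>n\<ge>M. dist (Y m) (Y n) < e"
      by (intro exI[of _ N] allI impI) (metis * dist_commute nle_le)
  qed
  then obtain L where L: "Y \<longlonglongrightarrow> L"
    using Cauchy_convergent_iff convergent_def by blast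
  have LX: "L = (1/2) *\<^sub>R (X + (L o\<^sub>L L))"
  proof (rule LIMSEQ_unique)
    show "(\<lambda>n. Y (Suc n)) \<longlonglongrightarrow> L" using L by (rule LIMSEQ_Suc)
    show "(\<lambda>n. Y (Suc n)) \<longlonglongrightarrow> (1/2) *\<^sub>R (X + (L o\<^sub>L L))"
      unfolding Y_Suc
      by (intro tendsto_intros bounded_bilinear.tendsto[OF bounded_bilinear_blinfun_compose] L)
  qed
  have "norm L \<le> 1"
    using L Y_le a_bounds by (intro LIMSEQ_le_const2[OF tendsto_norm[OF L]]) (meson order_trans)
  have lim: "(\<lambda>n. Y n x) \<longlonglongrightarrow> L x" for x
    by (intro tendsto_intros L)
  have sym_Y: "symmetric_op (Y n)" for n
  proof (induction n)
    case (Suc n)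
    then show ?case using A
      by (simp add: Y_Suc symmetric_op_def X_def blinfun.add_left blinfun.scaleR_left
          blinfun.diff_left inner_add inner_diff)
  qed (simp add: Y_0 symmetric_op_def)
  have sym_L: "L x \<bullet> y = x \<bullet> L y" for x y
  proof (rule LIMSEQ_unique)
    show "(\<lambda>n. Y n x \<bullet> y) \<longlonglongrightarrow> L x \<bullet> y" by (intro tendsto_intros lim)
    show "(\<lambda>n. Y n x \<bullet> y) \<longlonglongrightarrow> x \<bullet> L y"
      unfolding symmetric_opD[OF sym_Y] by (intro tendsto_intros lim)
  qed
  show ?thesis
  proof
    show "symmetric_op (id_blinfun - L)"
      by (simp add: symmetric_op_def blinfun.diff_left inner_diff sym_L)
    show "0 \<le> (id_blinfun - L) x \<bullet> x" for x
    proof -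
      have "L x \<bullet> x \<le> norm (L x) * norm x" by (rule norm_cauchy_schwarz)
      also have "\<dots> \<le> norm x * norm x"
        using order_trans[OF norm_blinfun[of L x] mult_right_mono[OF \<open>norm L \<le> 1\<close> norm_ge_zero]]
        by (intro mult_right_mono) auto
      finally show ?thesis
        by (simp add: blinfun.diff_left inner_diff_left power2_norm_eq_inner[symmetric] power2_eq_square)
    qed
    show "(id_blinfun - L) ((id_blinfun - L) x) = A x" for x
    proof -
      have "2 *\<^sub>R L x = X x + L (L x)"
        by (subst LX) (simp add: blinfun.add_left blinfun.scaleR_left)
      then show ?thesis
        by (simp add: blinfun.diff_left blinfun.diff_right X_def scaleR_2 algebra_simps)
    qed
    show "commutes C (id_blinfun - L)" if C: "commutes C A" for C
    proof -
      have CY: "commutes C (Y n)" for n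
      proof (induction n)
        case (Suc n)
        then show ?case using C
          by (simp add: Y_Suc commutes_def X_def blinfun.add_left blinfun.scaleR_left
              blinfun.diff_left blinfun.add_right blinfun.scaleR_right blinfun.diff_right)
      qed (simp add: Y_0 commutes_def blinfun.zero_right)
      have "C (L x) = L (C x)" for x
      proof (rule LIMSEQ_unique)
        show "(\<lambda>n. C (Y n x)) \<longlonglongrightarrow> C (L x)" by (intro tendsto_intros lim)
        show "(\<lambda>n. C (Y n x)) \<longlonglongrightarrow> L (C x)"
          unfolding commutesD[OF CY] by (rule lim)
      qed
      then show ?thesis by (simp add: commutes_def blinfun.diff_left blinfun.diff_right)
    qed
  qed
qed

text \<open>Cauchy-Schwarz for the degenerate form given by a positive operator.\<close>

lemma positive_op_null:
  fixes D :: "'a::real_inner \<Rightarrow>\<^sub>L 'a"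
  assumes D: "symmetric_op D" and pos: "\<And>x. 0 \<le> D x \<bullet> x" and "D x \<bullet> x = 0"
  shows "D x = 0"
proof (rule ccontr)
  assume "D x \<noteq> 0"
  define p where "p = D x \<bullet> D x"
  define q where "q = D (D x) \<bullet> D x"
  have p: "0 < p" using \<open>D x \<noteq> 0\<close> by (simp add: p_def)
  have q: "0 \<le> q" using pos by (simp add: q_def)
  have "0 \<le> 2 * t * p + t\<^sup>2 * q" for t
  proof -
    have "D (D x) \<bullet> x = p" by (simp add: p_def symmetric_opD[OF D])
    then show ?thesis
      using pos[of "x + t *\<^sub>R D x"] assms(3)
      by (simp add: blinfun.add_right blinfun.scaleR_right inner_add power2_eq_square
          p_def q_def algebra_simps)
  qed
  \<comment> \<open>The quadratic in \<open>t\<close> has nonzero slope at its root \<open>t = 0\<close>, so it is negative for a small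
    negative \<open>t\<close>.\<close>
  from this[of "- p / (q + 1)"] have "0 \<le> - 2 * p * p / (q + 1) + (p / (q + 1))\<^sup>2 * q"
    by simp
  also have "\<dots> = (p\<^sup>2 / (q + 1)\<^sup>2) * (- 2 * (q + 1) + q)"
    using q by (simp add: divide_simps) (simp add: power2_eq_square algebra_simps)
  also have "\<dots> < 0" using p q by (intro mult_pos_neg) auto
  finally show False by simp
qed

lemma subspace_closure:
  fixes M :: "'a::real_normed_vector set"
  assumes "subspace M"
  shows "subspace (closure M)"
proof (rule subspaceI)
  show "0 \<in> closure M" using assms closure_subset subspace_0 by blast
  show "x + y \<in> closure M" if xy: "x \<in> closure M" "y \<in> closure M" for x y
  proof -
    obtain f g where "\<forall>n. f n \<in> M" "f \<longlonglongrightarrow> x" "\<forall>n. g n \<in> M" "g \<longlonglongrightarrow> y"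
      using xy unfolding closure_sequential by metis
    then show ?thesis
      unfolding closure_sequential using assms
      by (intro exI[of _ "\<lambda>n. f n + g n"]) (auto intro: subspace_add tendsto_add)
  qed
  show "c *\<^sub>R x \<in> closure M" if x: "x \<in> closure M" for c x
  proof -
    obtain f where "\<forall>n. f n \<in> M" "f \<longlonglongrightarrow> x"
      using x unfolding closure_sequential by metis
    then show ?thesis
      unfolding closure_sequential using assms
      by (intro exI[of _ "\<lambda>n. c *\<^sub>R f n"]) (auto intro: subspace_scale tendsto_scaleR)
  qed
qed

text \<open>With \<open>|S|\<close> the positive root of \<open>S\<^sup>2\<close>, the kernel of \<open>|S| + S\<close> is the part where \<open>S\<close> is
  nonpositive: \<open>S = - |S|\<close> there, and since \<open>(|S| - S) (|S| + S) = 0\<close>, \<open>S = |S|\<close> on the closure of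
  the range of \<open>|S| + S\<close>, the orthogonal complement.\<close>

lemma sign_decomposition:
  fixes S :: "'a::{real_inner,banach} \<Rightarrow>\<^sub>L 'a"
  assumes S: "symmetric_op S"
  shows "\<exists>P. projection_op P \<and> (\<forall>C. commutes C S \<longrightarrow> commutes C P) \<and>
    (\<forall>x. P x = x \<longrightarrow> S x \<bullet> x \<le> 0) \<and> (\<forall>x. P x = 0 \<longrightarrow> x \<noteq> 0 \<longrightarrow> S x \<bullet> x > 0)"
proof -
  \<comment> \<open>Scaled by \<open>K \<ge> \<parallel>S\<parallel>\<close>, the square satisfies \<open>0 \<le> S\<^sup>2 / K\<^sup>2 \<le> 1\<close>, so the square root applies; adding
    \<open>1\<close> keeps \<open>K\<close> positive.\<close>
  define K where "K = norm S + 1"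
  have K: "0 < K" by (simp add: K_def add_nonneg_pos)
  define A where "A = (1 / K\<^sup>2) *\<^sub>R (S o\<^sub>L S)"
  have A_apply: "A x = (1 / K\<^sup>2) *\<^sub>R S (S x)" for x by (simp add: A_def blinfun.scaleR_left)
  have symA: "symmetric_op A" using S by (simp add: symmetric_op_def A_apply)
  have normA: "norm (id_blinfun - A) \<le> 1"
  proof (rule norm_blinfun_bound)
    fix x
    have SS: "norm (S (S x)) \<le> K * norm (S x)"
      using norm_blinfun[of S "S x"] by (simp add: K_def distrib_right add_increasing2)
    have "(norm ((id_blinfun - A) x))\<^sup>2 = (norm x)\<^sup>2 - 2 * (A x \<bullet> x) + (norm (A x))\<^sup>2"
      unfolding power2_norm_eq_inner
      by (simp add: blinfun.diff_left inner_diff inner_commute algebra_simps)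
    moreover have "A x \<bullet> x = (norm (S x))\<^sup>2 / K\<^sup>2"
      by (simp add: A_apply symmetric_opD[OF S] power2_norm_eq_inner)
    moreover have "(norm (A x))\<^sup>2 \<le> (norm (S x))\<^sup>2 / K\<^sup>2"
    proof -
      have "norm (A x) = norm (S (S x)) / K\<^sup>2" using K by (simp add: A_apply)
      also have "\<dots> \<le> K * norm (S x) / K\<^sup>2" using SS by (simp add: divide_right_mono)
      also have "\<dots> = norm (S x) / K" using K by (simp add: power2_eq_square)
      finally have "(norm (A x))\<^sup>2 \<le> (norm (S x) / K)\<^sup>2" by (simp add: power_mono)
      then show ?thesis by (simp add: power_divide)
    qed
    ultimately have "(norm ((id_blinfun - A) x))\<^sup>2 \<le> (norm x)\<^sup>2"
      using divide_nonneg_nonneg[OF zero_le_power2[of "norm (S x)"] zero_le_power2[of K]]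
      by linarith
    from power2_le_imp_le[OF this norm_ge_zero]
    show "norm ((id_blinfun - A) x) \<le> 1 * norm x" by simp
  qed simp
  obtain B where B: "symmetric_op B" "\<And>x. 0 \<le> B x \<bullet> x" "\<And>x. B (B x) = A x"
    "\<And>C. commutes C A \<Longrightarrow> commutes C B"
    using operator_square_root[OF symA normA] by blast
  define D where "D = K *\<^sub>R B"
  have D_apply: "D x = K *\<^sub>R B x" for x by (simp add: D_def blinfun.scaleR_left)
  have D: "symmetric_op D" "\<And>x. 0 \<le> D x \<bullet> x"
    using B K by (simp_all add: symmetric_op_def D_apply)
  have DD: "D (D x) = S (S x)" for x
    using K by (simp add: D_apply blinfun.scaleR_right B(3) A_apply power2_eq_square)
  have CD: "commutes C D" if "commutes C S" for C
  proof -
    have "commutes C A" using that by (simp add: commutes_def A_apply blinfun.scaleR_right)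
    then show ?thesis using B(4)[of C] by (simp add: commutes_def D_apply blinfun.scaleR_right)
  qed
  have DS: "D (S x) = S (D x)" for x
    using CD[of S] by (simp add: commutes_def)
  define Z where "Z = D + S"
  have Z_apply: "Z x = D x + S x" for x by (simp add: Z_def blinfun.add_left)
  have symZ: "symmetric_op Z"
    using S D by (simp add: symmetric_op_def Z_apply inner_add)
  define M where "M = closure (range Z)"
  have M: "closed M" "subspace M"
    using linear_subspace_image[OF bounded_linear.linear[OF blinfun.bounded_linear_right[of Z]] subspace_UNIV]
    by (auto simp: M_def intro: subspace_closure)
  have perp_iff: "(\<forall>z\<in>M. x \<bullet> z = 0) \<longleftrightarrow> Z x = 0" for x
  proof
    assume "\<forall>z\<in>M. x \<bullet> z = 0"
    moreover have "Z (Z x) \<in> M" unfolding M_def by (rule subsetD[OF closure_subset]) simp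
    ultimately have "x \<bullet> Z (Z x) = 0" by blast
    then have "Z x \<bullet> Z x = 0" by (simp add: symmetric_opD[OF symZ, symmetric])
    then show "Z x = 0" by simp
  next
    assume "Z x = 0"
    then have "range Z \<subseteq> {z. x \<bullet> z = 0}"
      by (auto simp: symmetric_opD[OF symZ, symmetric])
    moreover have "closed {z. x \<bullet> z = 0}"
      by (intro closed_Collect_eq continuous_intros)
    ultimately have "M \<subseteq> {z. x \<bullet> z = 0}"
      unfolding M_def by (rule closure_minimal)
    then show "\<forall>z\<in>M. x \<bullet> z = 0" by blast
  qed
  define P where "P = id_blinfun - proj_onto M"
  have P_apply: "P x = x - proj_onto M x" for x by (simp add: P_def blinfun.diff_left)
  have proj: "projection_op P"
    unfolding P_def by (intro projection_op_complement projection_op_proj_onto M)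
  have comm: "commutes C P" if C: "commutes C S" for C
  proof -
    have CZ: "C (Z x) = Z (C x)" for x
      using C CD[OF C] by (simp add: commutes_def Z_apply blinfun.add_right)
    have "commutes C (proj_onto M)"
    proof (rule commutes_proj_onto[OF M])
      have "C ` closure (range Z) \<subseteq> closure (C ` range Z)"
        by (rule image_closure_subset) (auto intro: continuous_intros closure_subset[THEN subsetD])
      also have "\<dots> \<subseteq> closure (range Z)"
        by (rule closure_mono) (auto simp: CZ)
      finally show "C x \<in> M" if "x \<in> M" for x using that by (auto simp: M_def)
      show "C x \<bullet> z = 0" if "\<And>z. z \<in> M \<Longrightarrow> x \<bullet> z = 0" "z \<in> M" for x z
      proof -
        have "Z x = 0" using that perp_iff by blast
        then have "Z (C x) = 0" by (simp add: CZ[symmetric])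
        then show ?thesis using perp_iff that(2) by blast
      qed
    qed
    then show ?thesis by (simp add: commutes_def P_apply blinfun.diff_right)
  qed
  have nonpos: "S x \<bullet> x \<le> 0" if "P x = x" for x
  proof -
    have "proj_onto M x = 0" using that by (simp add: P_apply)
    then have "Z x = 0" using proj_onto_orthogonal[OF M, of _ x] perp_iff[of x] by simp
    then have "S x = - D x" by (simp add: Z_apply add_eq_0_iff2 add.commute)
    then show ?thesis using D(2)[of x] by simp
  qed
  have pos: "S x \<bullet> x > 0" if x: "P x = 0" "x \<noteq> 0" for x
  proof -
    have px: "proj_onto M x = x" using x by (simp add: P_apply)
    then have xM: "x \<in> M" using proj_onto_in[OF M, of x] by simp
    have "range Z \<subseteq> {z. D z - S z = 0}"
      by (auto simp: Z_apply blinfun.add_right DD DS)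
    moreover have "closed {z. D z - S z = 0}"
      by (intro closed_Collect_eq continuous_intros)
    ultimately have "M \<subseteq> {z. D z - S z = 0}"
      unfolding M_def by (rule closure_minimal)
    then have Dx: "D x = S x" using xM by auto
    have "S x \<bullet> x \<noteq> 0"
    proof
      assume "S x \<bullet> x = 0"
      then have "D x = 0" using positive_op_null[OF D, of x] Dx by simp
      then have "Z x = 0" using Dx by (simp add: Z_apply)
      then have "x \<bullet> x = 0" using perp_iff xM by blast
      then show False using x by simp
    qed
    then show ?thesis using D(2)[of x] Dx by simp
  qed
  show ?thesis using proj comm nonpos pos by blast
qed

section \<open>Spectral projections of a symmetric operator\<close>

text \<open>These are the spectral projections of \<open>T\<close> for \<open>(-\<infinity>, l]\<close>, for \<open>(-\<infinity>, l)\<close> and for \<open>[c, d]\<close>.  The first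
  is characterised by the quadratic form on its range and on its kernel, together with the property
  that it commutes with the whole commutant of \<open>T\<close>, which is what lets it pass to reducing
  subspaces.\<close>

definition below :: "('a::{real_inner,banach} \<Rightarrow>\<^sub>L 'a) \<Rightarrow> real \<Rightarrow> 'a \<Rightarrow>\<^sub>L 'a"
  where "below T l = (SOME P. projection_op P \<and> (\<forall>C. commutes C T \<longrightarrow> commutes C P) \<and>
    (\<forall>x. P x = x \<longrightarrow> T x \<bullet> x \<le> l * (x \<bullet> x)) \<and>
    (\<forall>x. P x = 0 \<longrightarrow> x \<noteq> 0 \<longrightarrow> l * (x \<bullet> x) < T x \<bullet> x))"

definition strictly_below :: "('a::{real_inner,banach} \<Rightarrow>\<^sub>L 'a) \<Rightarrow> real \<Rightarrow> 'a \<Rightarrow>\<^sub>L 'a"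
  where "strictly_below T l = id_blinfun - below (- T) (- l)"

definition window :: "('a::{real_inner,banach} \<Rightarrow>\<^sub>L 'a) \<Rightarrow> real \<Rightarrow> real \<Rightarrow> 'a \<Rightarrow>\<^sub>L 'a"
  where "window T c d = below T d - strictly_below T c"

lemma below:
  fixes T :: "'a::{real_inner,banach} \<Rightarrow>\<^sub>L 'a"
  assumes T: "symmetric_op T"
  shows projection_below: "projection_op (below T l)"
    and commutes_below: "commutes C T \<Longrightarrow> commutes C (below T l)"
    and below_fixed: "below T l x = x \<Longrightarrow> T x \<bullet> x \<le> l * (x \<bullet> x)"
    and below_kernel: "below T l x = 0 \<Longrightarrow> x \<noteq> 0 \<Longrightarrow> l * (x \<bullet> x) < T x \<bullet> x"
proof -
  let ?S = "T - l *\<^sub>R id_blinfun"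
  have S_apply: "?S x = T x - l *\<^sub>R x" for x
    by (simp add: blinfun.diff_left blinfun.scaleR_left)
  obtain P where P: "projection_op P" "\<And>C. commutes C ?S \<Longrightarrow> commutes C P"
    "\<And>x. P x = x \<Longrightarrow> ?S x \<bullet> x \<le> 0" "\<And>x. P x = 0 \<Longrightarrow> x \<noteq> 0 \<Longrightarrow> ?S x \<bullet> x > 0"
    using sign_decomposition[OF symmetric_op_diff_id[OF T, of l]] by metis
  have "projection_op P \<and> (\<forall>C. commutes C T \<longrightarrow> commutes C P) \<and>
    (\<forall>x. P x = x \<longrightarrow> T x \<bullet> x \<le> l * (x \<bullet> x)) \<and>
    (\<forall>x. P x = 0 \<longrightarrow> x \<noteq> 0 \<longrightarrow> l * (x \<bullet> x) < T x \<bullet> x)"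
    using P(1) P(2)[OF commutes_diff_id] P(3,4)
    by (simp add: S_apply inner_diff_left)
  then have "projection_op (below T l) \<and> (\<forall>C. commutes C T \<longrightarrow> commutes C (below T l)) \<and>
    (\<forall>x. below T l x = x \<longrightarrow> T x \<bullet> x \<le> l * (x \<bullet> x)) \<and>
    (\<forall>x. below T l x = 0 \<longrightarrow> x \<noteq> 0 \<longrightarrow> l * (x \<bullet> x) < T x \<bullet> x)"
    unfolding below_def by (rule someI[of _ P])
  then show "projection_op (below T l)" "commutes C T \<Longrightarrow> commutes C (below T l)"
    "below T l x = x \<Longrightarrow> T x \<bullet> x \<le> l * (x \<bullet> x)"
    "below T l x = 0 \<Longrightarrow> x \<noteq> 0 \<Longrightarrow> l * (x \<bullet> x) < T x \<bullet> x"
    by auto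
qed

lemma strictly_below:
  fixes T :: "'a::{real_inner,banach} \<Rightarrow>\<^sub>L 'a"
  assumes T: "symmetric_op T"
  shows projection_strictly_below: "projection_op (strictly_below T l)"
    and commutes_strictly_below: "commutes C T \<Longrightarrow> commutes C (strictly_below T l)"
    and strictly_below_fixed: "strictly_below T l x = x \<Longrightarrow> x \<noteq> 0 \<Longrightarrow> T x \<bullet> x < l * (x \<bullet> x)"
    and strictly_below_kernel: "strictly_below T l x = 0 \<Longrightarrow> l * (x \<bullet> x) \<le> T x \<bullet> x"
proof -
  have N: "symmetric_op (- T)" using T by (simp add: symmetric_op_def blinfun.minus_left)
  have sb_apply: "strictly_below T l x = x - below (- T) (- l) x" for x
    by (simp add: strictly_below_def blinfun.diff_left)
  show "projection_op (strictly_below T l)"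
    unfolding strictly_below_def by (intro projection_op_complement projection_below N)
  show "commutes C (strictly_below T l)" if "commutes C T"
  proof -
    have "commutes C (- T)"
      using that by (simp add: commutes_def blinfun.minus_left blinfun.minus_right)
    then have "commutes C (below (- T) (- l))" by (rule commutes_below[OF N])
    then show ?thesis by (simp add: commutes_def sb_apply blinfun.diff_right)
  qed
  show "T x \<bullet> x < l * (x \<bullet> x)" if "strictly_below T l x = x" "x \<noteq> 0"
    using below_kernel[OF N, of "- l" x] that by (simp add: sb_apply blinfun.minus_left)
  show "l * (x \<bullet> x) \<le> T x \<bullet> x" if "strictly_below T l x = 0"
    using below_fixed[OF N, of "- l" x] that by (simp add: sb_apply blinfun.minus_left)
qed

lemma commutes_window:
  assumes "symmetric_op T" "commutes C T"
  shows "commutes C (window T c d)"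
  using commutes_below[OF assms, of d] commutes_strictly_below[OF assms, of c]
  by (simp add: commutes_def window_def blinfun.diff_left blinfun.diff_right)

lemma commutes_self: "commutes T T"
  by (simp add: commutes_def)

lemma commutes_below_self: "symmetric_op T \<Longrightarrow> commutes (below T l) T"
  by (rule commutes_sym[OF commutes_below[OF _ commutes_self]])

lemma commutes_strictly_below_self: "symmetric_op T \<Longrightarrow> commutes (strictly_below T l) T"
  by (rule commutes_sym[OF commutes_strictly_below[OF _ commutes_self]])

lemma commutes_window_self: "symmetric_op T \<Longrightarrow> commutes (window T c d) T"
  by (rule commutes_sym[OF commutes_window[OF _ commutes_self]])

text \<open>To order commuting projections it suffices to see that no nonzero vector lies in the range of
  the one and in the kernel of the other; for spectral projections the quadratic form decides this.\<close>

lemma projection_absorb: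
  assumes X: "projection_op X" and Y: "projection_op Y" and "commutes X Y"
    and disj: "\<And>y. X y = y \<Longrightarrow> Y y = 0 \<Longrightarrow> y = 0"
  shows "Y (X x) = X x"
proof -
  have XY: "X (Y u) = Y (X u)" for u using assms(3) by (rule commutesD)
  have "X x - Y (X x) = 0"
    by (rule disj) (simp_all add: blinfun.diff_right XY projection_opD(2)[OF X] projection_opD(2)[OF Y])
  then show ?thesis by simp
qed

context
  fixes T :: "'a::{real_inner,banach} \<Rightarrow>\<^sub>L 'a"
  assumes T: "symmetric_op T"
begin

lemma below_below:
  assumes "l \<le> m"
  shows "below T m (below T l x) = below T l x" "below T l (below T m x) = below T l x"
proof -
  have comm: "commutes (below T l) (below T m)"
    by (intro commutes_below commutes_below_self T)
  show 1: "below T m (below T l x) = below T l x" for x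
  proof (rule projection_absorb[OF projection_below[OF T] projection_below[OF T] comm])
    fix y assume y: "below T l y = y" "below T m y = 0"
    have "l * (y \<bullet> y) \<le> m * (y \<bullet> y)" using assms by (simp add: mult_right_mono)
    then show "y = 0" using below_fixed[OF T y(1)] below_kernel[OF T y(2)] by force
  qed
  show "below T l (below T m x) = below T l x" using 1 commutesD[OF comm] by simp
qed

lemma below_strictly_below:
  assumes "l \<le> m"
  shows "below T m (strictly_below T l x) = strictly_below T l x"
    "strictly_below T l (below T m x) = strictly_below T l x"
proof -
  have comm: "commutes (strictly_below T l) (below T m)"
    by (intro commutes_below commutes_strictly_below_self T)
  show 1: "below T m (strictly_below T l x) = strictly_below T l x" for x
  proof (rule projection_absorb[OF projection_strictly_below[OF T] projection_below[OF T] comm])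
    fix y assume y: "strictly_below T l y = y" "below T m y = 0"
    have "l * (y \<bullet> y) \<le> m * (y \<bullet> y)" using assms by (simp add: mult_right_mono)
    then show "y = 0" using strictly_below_fixed[OF T y(1)] below_kernel[OF T y(2)] by force
  qed
  show "strictly_below T l (below T m x) = strictly_below T l x" using 1 commutesD[OF comm] by simp
qed

lemma strictly_below_below:
  assumes "l < m"
  shows "strictly_below T m (below T l x) = below T l x"
    "below T l (strictly_below T m x) = below T l x"
proof -
  have comm: "commutes (below T l) (strictly_below T m)"
    by (intro commutes_strictly_below commutes_below_self T)
  show 1: "strictly_below T m (below T l x) = below T l x" for x
  proof (rule projection_absorb[OF projection_below[OF T] projection_strictly_below[OF T] comm])
    fix y assume y: "below T l y = y" "strictly_below T m y = 0"
    have "(m - l) * (y \<bullet> y) \<le> 0"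
      using below_fixed[OF T y(1)] strictly_below_kernel[OF T y(2)] by (simp add: algebra_simps)
    then have "y \<bullet> y \<le> 0" using assms by (simp add: mult_le_0_iff)
    then show "y = 0" by (metis inner_gt_zero_iff not_le)
  qed
  show "below T l (strictly_below T m x) = below T l x" using 1 commutesD[OF comm] by simp
qed

lemma below_min: "below T l (below T m x) = below T (min l m) x"
  using below_below[of l m x] below_below[of m l x] by (cases "l \<le> m") (auto simp: min_def)

lemma below_norm_mono: "l \<le> m \<Longrightarrow> norm (below T l x) \<le> norm (below T m x)"
  using projection_op_norm_le[OF projection_below[OF T, of l], of "below T m x"]
  by (simp add: below_below)

lemma abs_form_le: "\<bar>T x \<bullet> x\<bar> \<le> norm T * (x \<bullet> x)"
proof -
  have "\<bar>T x \<bullet> x\<bar> \<le> norm (T x) * norm x" by (rule Cauchy_Schwarz_ineq2)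
  also have "\<dots> \<le> (norm T * norm x) * norm x" by (intro mult_right_mono norm_blinfun norm_ge_zero)
  finally show ?thesis by (simp add: power2_norm_eq_inner[symmetric] power2_eq_square mult.assoc)
qed

lemma below_above_norm: "norm T \<le> l \<Longrightarrow> below T l x = x"
proof -
  assume l: "norm T \<le> l"
  let ?y = "x - below T l x"
  have "below T l ?y = 0"
    by (simp add: blinfun.diff_right projection_opD(2)[OF projection_below[OF T]])
  then have "?y \<noteq> 0 \<Longrightarrow> l * (?y \<bullet> ?y) < T ?y \<bullet> ?y" by (rule below_kernel[OF T])
  moreover have "T ?y \<bullet> ?y \<le> l * (?y \<bullet> ?y)"
    using abs_form_le[of ?y] mult_right_mono[OF l inner_ge_zero[of ?y]] by linarith
  ultimately show ?thesis by force
qed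

lemma below_under_norm: "l < - norm T \<Longrightarrow> below T l x = 0"
proof -
  assume l: "l < - norm T"
  let ?y = "below T l x"
  have "T ?y \<bullet> ?y \<le> l * (?y \<bullet> ?y)"
    by (rule below_fixed[OF T]) (simp add: projection_opD(2)[OF projection_below[OF T]])
  then have "(- norm T - l) * (?y \<bullet> ?y) \<le> 0"
    using abs_form_le[of ?y] by (simp add: algebra_simps)
  then have "?y \<bullet> ?y \<le> 0" using l by (simp add: mult_le_0_iff)
  then show ?thesis by (metis inner_gt_zero_iff not_le)
qed

end

text \<open>A decreasing sequence of projections converges strongly: by Pythagoras the squared norms
  \<open>\<parallel>R\<^sub>n x\<parallel>\<^sup>2\<close> decrease by the squared increments.\<close>

lemma decreasing_projections_converge:
  fixes R :: "nat \<Rightarrow> 'a::{real_inner,banach} \<Rightarrow>\<^sub>L 'a"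
  assumes R: "\<And>n. projection_op (R n)"
    and dec: "\<And>m n x. m \<le> n \<Longrightarrow> R n (R m x) = R n x" "\<And>m n x. m \<le> n \<Longrightarrow> R m (R n x) = R n x"
  obtains z where "(\<lambda>n. R n x) \<longlonglongrightarrow> z" "\<And>k. R k z = z"
proof -
  define f where "f n = (norm (R n x))\<^sup>2" for n
  have pyth: "f m = f n + (norm (R m x - R n x))\<^sup>2" if "m \<le> n" for m n
    using projection_op_Pythagoras[OF R, of "R m x" n] dec(1)[OF that] by (simp add: f_def)
  have "decseq f" unfolding decseq_def using pyth by (metis le_add_same_cancel1 zero_le_power2)
  moreover have "bdd_below (range f)" by (rule bdd_belowI[of _ 0]) (auto simp: f_def)
  ultimately have "Cauchy f"
    using LIMSEQ_decseq_INF[of f] LIMSEQ_imp_Cauchy[of f] by blast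
  have "Cauchy (\<lambda>n. R n x)"
  proof (rule metric_CauchyI)
    fix e :: real assume e: "0 < e"
    then obtain N where N: "\<And>m n. m \<ge> N \<Longrightarrow> n \<ge> N \<Longrightarrow> dist (f m) (f n) < e\<^sup>2"
      using \<open>Cauchy f\<close> unfolding Cauchy_def by (meson zero_less_power)
    have *: "dist (R m x) (R n x) < e" if "N \<le> m" "m \<le> n" for m n
    proof -
      have "(norm (R m x - R n x))\<^sup>2 < e\<^sup>2"
        using pyth[OF that(2)] N[of m n] that by (simp add: dist_real_def)
      then show ?thesis using e by (simp add: dist_norm power2_less_imp_less)
    qed
    show "\<exists>M. \<forall>m\<ge>M. \<forall>n\<ge>M. dist (R m x) (R n x) < e"
      by (intro exI[of _ N] allI impI) (metis * dist_commute nle_le)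
  qed
  then obtain z where z: "(\<lambda>n. R n x) \<longlonglongrightarrow> z"
    using Cauchy_convergent_iff convergent_def by blast
  have "R k z = z" for k
  proof (rule LIMSEQ_unique)
    show "(\<lambda>n. R k (R n x)) \<longlonglongrightarrow> R k z" by (intro tendsto_intros z)
    show "(\<lambda>n. R k (R n x)) \<longlonglongrightarrow> z"
      by (rule Lim_transform_eventually[OF z]) (auto simp: eventually_sequentially dec(2) intro!: exI[of _ k])
  qed
  then show ?thesis using that z by blast
qed

context
  fixes T :: "'a::{real_inner,banach} \<Rightarrow>\<^sub>L 'a"
  assumes T: "symmetric_op T"
begin

text \<open>For \<open>m\<close> decreasing to \<open>l\<close> the limit \<open>z\<close> exists and is in the range of every \<open>below T m\<close>, so the form
  is at most \<open>l\<close> on \<open>z - below T l x\<close>; but this vector is in the kernel of \<open>below T l\<close>.\<close>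

lemma below_right_limit: "((\<lambda>m. below T m x) \<longlongrightarrow> below T l x) (at_right l)"
proof (rule tendsto_at_right_sequentially)
  show "l < l + 1" by simp
  fix X :: "nat \<Rightarrow> real"
  assume X: "\<And>n. l < X n" "decseq X" "X \<longlonglongrightarrow> l"
  obtain z where z: "(\<lambda>n. below T (X n) x) \<longlonglongrightarrow> z" "\<And>k. below T (X k) z = z"
    by (rule decreasing_projections_converge[of "\<lambda>n. below T (X n)" x])
      (use X(2) in \<open>auto simp: decseq_def below_below[OF T] projection_below[OF T]\<close>)
  define y where "y = z - below T l x"
  have "(\<lambda>n. below T l (below T (X n) x)) \<longlonglongrightarrow> below T l z"
    by (intro tendsto_intros z)
  moreover have "below T l (below T (X n) x) = below T l x" for n
    using X(1)[of n] by (simp add: below_below[OF T])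
  ultimately have "below T l z = below T l x"
    by (simp add: LIMSEQ_const_iff)
  then have y0: "below T l y = 0"
    by (simp add: y_def blinfun.diff_right projection_opD(2)[OF projection_below[OF T]])
  have "T y \<bullet> y \<le> X n * (y \<bullet> y)" for n
  proof (rule below_fixed[OF T])
    show "below T (X n) y = y"
      using X(1)[of n] z(2)[of n] by (simp add: y_def blinfun.diff_right below_below[OF T])
  qed
  then have "T y \<bullet> y \<le> l * (y \<bullet> y)"
    by (intro LIMSEQ_le_const[OF tendsto_mult_right[OF X(3)]]) auto
  then have "y = 0" using below_kernel[OF T y0] by force
  then show "(\<lambda>n. below T (X n) x) \<longlonglongrightarrow> below T l x" using z(1) by (simp add: y_def)
qed

text \<open>The same argument for the complementary projections, which decrease as \<open>m\<close> increases to \<open>l\<close>; the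
  limit is the projection for the open half-line.\<close>

lemma below_left_limit: "((\<lambda>m. below T m x) \<longlongrightarrow> strictly_below T l x) (at_left l)"
proof (rule tendsto_at_left_sequentially)
  show "l - 1 < l" by simp
  fix X :: "nat \<Rightarrow> real"
  assume X: "\<And>n. X n < l" "incseq X" "X \<longlonglongrightarrow> l"
  let ?R = "\<lambda>n. id_blinfun - below T (X n)"
  have le: "X m \<le> X n" if "m \<le> n" for m n using X(2) that by (simp add: incseq_def)
  obtain z where z: "(\<lambda>n. ?R n x) \<longlonglongrightarrow> z" "\<And>k. ?R k z = z"
    by (rule decreasing_projections_converge[of ?R x])
      (simp_all add: projection_op_complement projection_below[OF T] blinfun.diff_left
        blinfun.diff_right le below_below[OF T])
  have z0: "below T (X k) z = 0" for k using z(2)[of k] by (simp add: blinfun.diff_left)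
  have lim: "(\<lambda>n. below T (X n) x) \<longlonglongrightarrow> x - z"
    using tendsto_diff[OF tendsto_const[of x] z(1)] by (simp add: blinfun.diff_left)
  define y where "y = strictly_below T l z"
  have fixed: "strictly_below T l y = y"
    by (simp add: y_def projection_opD(2)[OF projection_strictly_below[OF T]])
  have "X n * (y \<bullet> y) \<le> T y \<bullet> y" for n
  proof -
    have "below T (X n) y = 0"
      using X(1)[of n] z0[of n] by (simp add: y_def strictly_below_below[OF T])
    from below_kernel[OF T this] show ?thesis by force
  qed
  then have "l * (y \<bullet> y) \<le> T y \<bullet> y"
    by (intro LIMSEQ_le_const2[OF tendsto_mult_right[OF X(3)]]) auto
  then have y: "strictly_below T l z = 0"
    using strictly_below_fixed[OF T fixed] by (force simp: y_def)
  have "(\<lambda>n. strictly_below T l (below T (X n) x)) \<longlonglongrightarrow> strictly_below T l (x - z)"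
    by (intro tendsto_intros lim)
  moreover have "strictly_below T l (below T (X n) x) = below T (X n) x" for n
    using X(1)[of n] by (simp add: strictly_below_below[OF T])
  ultimately have "(\<lambda>n. below T (X n) x) \<longlonglongrightarrow> strictly_below T l x"
    by (simp add: blinfun.diff_right y)
  then show "(\<lambda>n. below T (X n) x) \<longlonglongrightarrow> strictly_below T l x" .
qed

lemma window_apply: "window T c d x = below T d x - strictly_below T c x"
  by (simp add: window_def blinfun.diff_left)

lemma window_fixed_iff:
  assumes "c \<le> d"
  shows "window T c d x = x \<longleftrightarrow> below T d x = x \<and> strictly_below T c x = 0"
proof
  assume w: "window T c d x = x"
  have "below T d (window T c d x) = window T c d x"
    "strictly_below T c (window T c d x) = 0"
    using assms by (simp_all add: window_apply blinfun.diff_right below_strictly_below[OF T]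
        projection_opD(2)[OF projection_below[OF T]]
        projection_opD(2)[OF projection_strictly_below[OF T]])
  then show "below T d x = x \<and> strictly_below T c x = 0" by (simp only: w)
qed (simp add: window_apply)

lemma projection_window:
  assumes "c \<le> d"
  shows "projection_op (window T c d)"
proof -
  note B = projection_opD[OF projection_below[OF T]] and S = projection_opD[OF projection_strictly_below[OF T]]
  show ?thesis
    using assms by (simp add: projection_op_def symmetric_op_def window_apply inner_diff
        blinfun.diff_right below_strictly_below[OF T] B S)
qed

lemma window_idem: "c \<le> d \<Longrightarrow> window T c d (window T c d x) = window T c d x"
  using projection_window by (simp add: projection_op_def)

lemma window_form_bounds:
  assumes "c \<le> d" "window T c d x = x"
  shows "c * (x \<bullet> x) \<le> T x \<bullet> x" "T x \<bullet> x \<le> d * (x \<bullet> x)"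
  using assms below_fixed[OF T, of d x] strictly_below_kernel[OF T, of c x]
  by (simp_all add: window_fixed_iff)

end

text \<open>On a reducing subspace, a bound for the quadratic form of a symmetric operator is a bound for
  its norm, by polarization.\<close>

lemma norm_le_of_form_bound:
  fixes N W :: "'a::real_inner \<Rightarrow>\<^sub>L 'a"
  assumes N: "symmetric_op N" and comm: "commutes W N" and "0 \<le> r"
    and form: "\<And>x. W x = x \<Longrightarrow> \<bar>N x \<bullet> x\<bar> \<le> r * (x \<bullet> x)" and x: "W x = x"
  shows "norm (N x) \<le> r * norm x"
proof (cases "N x = 0 \<or> x = 0")
  case True
  then show ?thesis using \<open>0 \<le> r\<close> by (auto simp: blinfun.zero_right)
next
  case False
  \<comment> \<open>The vector of the same norm as \<open>x\<close> on which \<open>\<langle>N x, y\<rangle> = \<parallel>N x\<parallel> \<parallel>x\<parallel>\<close>.\<close>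
  define y where "y = (norm x / norm (N x)) *\<^sub>R N x"
  have y: "W y = y" using x commutesD[OF comm, of x] by (simp add: y_def blinfun.scaleR_right)
  have ny: "norm y = norm x" using False by (simp add: y_def)
  have Nxy: "N x \<bullet> y = norm x * norm (N x)"
    using False by (simp add: y_def power2_norm_eq_inner[symmetric] power2_eq_square)
  have "4 * (N x \<bullet> y) = N (x + y) \<bullet> (x + y) - N (x - y) \<bullet> (x - y)"
    using symmetric_opD[OF N, of y x]
    by (simp add: blinfun.add_right blinfun.diff_right inner_add inner_diff inner_commute)
  also have "\<dots> \<le> r * ((x + y) \<bullet> (x + y)) + r * ((x - y) \<bullet> (x - y))"
    using form[of "x + y"] form[of "x - y"] x y
    by (simp add: blinfun.add_right blinfun.diff_right abs_le_iff)
  also have "\<dots> = 2 * r * (x \<bullet> x + y \<bullet> y)"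
    by (simp add: inner_add inner_diff inner_commute algebra_simps)
  also have "\<dots> = 4 * r * (norm x * norm x)"
    by (simp add: power2_norm_eq_inner[symmetric] ny power2_eq_square)
  finally have "norm (N x) * norm x \<le> (r * norm x) * norm x"
    by (simp add: Nxy mult_ac)
  then show ?thesis using False by simp
qed

context
  fixes T :: "'a::{real_inner,banach} \<Rightarrow>\<^sub>L 'a"
  assumes T: "symmetric_op T"
begin

lemma norm_shift_le_on_window:
  assumes "c \<le> d" "window T c d x = x"
  shows "norm (T x - ((c + d) / 2) *\<^sub>R x) \<le> (d - c) / 2 * norm x"
proof -
  let ?m = "(c + d) / 2"
  let ?N = "T - ?m *\<^sub>R id_blinfun"
  have ap: "?N x = T x - ?m *\<^sub>R x" for x by (simp add: blinfun.diff_left blinfun.scaleR_left)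
  have "norm (?N x) \<le> (d - c) / 2 * norm x"
  proof (rule norm_le_of_form_bound[where W = "window T c d"])
    show "symmetric_op ?N" by (rule symmetric_op_diff_id[OF T])
    show "commutes (window T c d) ?N" by (intro commutes_diff_id commutes_window_self T)
    fix x assume x: "window T c d x = x"
    show "\<bar>?N x \<bullet> x\<bar> \<le> (d - c) / 2 * (x \<bullet> x)"
      using window_form_bounds[OF T \<open>c \<le> d\<close> x] by (auto simp: ap inner_diff_left abs_le_iff field_simps)
  qed (use assms in auto)
  then show ?thesis by (simp add: ap)
qed

text \<open>Off the window a vector splits into the parts below \<open>c\<close> and above \<open>d\<close>.  Their images under \<open>T\<close> minus
  the midpoint are orthogonal, and on each part the form is at least half the length in absolute
  value.\<close>

lemma norm_shift_ge_off_window: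
  assumes "c \<le> d" "window T c d x = 0"
  shows "(d - c) / 2 * norm x \<le> norm (T x - ((c + d) / 2) *\<^sub>R x)"
proof -
  define m r where "m = (c + d) / 2" and "r = (d - c) / 2"
  have cd: "c = m - r" "d = m + r" by (simp_all add: m_def r_def field_simps)
  have r: "0 \<le> r" using assms by (simp add: r_def)
  let ?N = "\<lambda>x. T x - m *\<^sub>R x"
  define u v where "u = strictly_below T c x" and "v = x - below T d x"
  have x: "x = u + v" using assms by (simp add: u_def v_def window_apply[OF T])
  have u: "strictly_below T c u = u"
    by (simp add: u_def projection_opD(2)[OF projection_strictly_below[OF T]])
  have v0: "below T d v = 0"
    by (simp add: v_def blinfun.diff_right projection_opD(2)[OF projection_below[OF T]])
  have v: "strictly_below T c v = 0"
    using below_strictly_below(2)[OF T \<open>c \<le> d\<close>, of v] v0 by (simp add: blinfun.zero_right)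
  have ortho: "p \<bullet> q = 0" if "strictly_below T c p = p" "strictly_below T c q = 0" for p q
    using projection_opD(1)[OF projection_strictly_below[OF T], of c p q] that by simp
  have comm: "strictly_below T c (?N w) = ?N (strictly_below T c w)" for w
    using commutesD[OF commutes_strictly_below_self[OF T], of c w]
    by (simp add: blinfun.diff_right blinfun.scaleR_right)
  have bound: "r * norm w \<le> norm (?N w)" if "r * (w \<bullet> w) \<le> \<bar>?N w \<bullet> w\<bar>" for w
  proof (cases "w = 0")
    case False
    have "(r * norm w) * norm w \<le> norm (?N w) * norm w"
      using that Cauchy_Schwarz_ineq2[of "?N w" w]
      by (simp add: power2_norm_eq_inner[symmetric] power2_eq_square mult.assoc)
    then show ?thesis using False by simp
  qed simp
  have "r * norm u \<le> norm (?N u)"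
  proof (rule bound)
    have "T u \<bullet> u \<le> c * (u \<bullet> u)"
      using strictly_below_fixed[OF T u] by (cases "u = 0") auto
    then show "r * (u \<bullet> u) \<le> \<bar>?N u \<bullet> u\<bar>"
      by (simp add: cd inner_diff_left algebra_simps)
  qed
  moreover have "r * norm v \<le> norm (?N v)"
  proof (rule bound)
    have "d * (v \<bullet> v) \<le> T v \<bullet> v"
      using below_kernel[OF T v0] by (cases "v = 0") auto
    then show "r * (v \<bullet> v) \<le> \<bar>?N v \<bullet> v\<bar>"
      by (simp add: cd inner_diff_left algebra_simps)
  qed
  ultimately have "(r * norm u)\<^sup>2 + (r * norm v)\<^sup>2 \<le> (norm (?N u))\<^sup>2 + (norm (?N v))\<^sup>2"
    using r by (intro add_mono power_mono) auto
  moreover have "(norm x)\<^sup>2 = (norm u)\<^sup>2 + (norm v)\<^sup>2"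
    unfolding x using ortho[OF u v] by (intro norm_add_Pythagorean) (simp add: orthogonal_def)
  moreover have "(norm (?N x))\<^sup>2 = (norm (?N u))\<^sup>2 + (norm (?N v))\<^sup>2"
  proof -
    have "?N x = ?N u + ?N v" by (simp add: x blinfun.add_right scaleR_right_distrib)
    moreover have "?N u \<bullet> ?N v = 0"
      by (rule ortho) (simp_all add: comm u v blinfun.zero_right)
    ultimately show ?thesis by (simp add: norm_add_Pythagorean orthogonal_def)
  qed
  ultimately have "(r * norm x)\<^sup>2 \<le> (norm (?N x))\<^sup>2" by (simp add: power_mult_distrib algebra_simps)
  then show ?thesis unfolding m_def[symmetric] r_def[symmetric] by (rule power2_le_imp_le) simp
qed

text \<open>A gap of \<open>T\<close> at \<open>c\<close>, on a subspace preserved by the spectral projections, makes the resolution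
  of the identity constant around \<open>c\<close> there.\<close>

lemma gap_window_zero:
  assumes gap: "\<And>x. x \<in> V \<Longrightarrow> e * norm x \<le> norm (T x - c *\<^sub>R x)"
    and inv: "\<And>x a b. x \<in> V \<Longrightarrow> window T a b x \<in> V"
    and "x \<in> V" "0 \<le> h" "h < e"
  shows "window T (c - h) (c + h) x = 0"
proof -
  let ?w = "window T (c - h) (c + h) x"
  have "e * norm ?w \<le> norm (T ?w - c *\<^sub>R ?w)" using gap inv assms(3) by blast
  also have "\<dots> \<le> h * norm ?w"
    using norm_shift_le_on_window[of "c - h" "c + h" ?w] \<open>0 \<le> h\<close>
    by (simp add: window_idem[OF T])
  finally have "(e - h) * norm ?w \<le> 0" by (simp add: algebra_simps)
  then have "norm ?w \<le> 0" using \<open>h < e\<close> by (simp add: mult_le_0_iff)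
  then show ?thesis by simp
qed

lemma gap_below_const:
  assumes gap: "\<And>x. x \<in> V \<Longrightarrow> e * norm x \<le> norm (T x - c *\<^sub>R x)"
    and inv: "\<And>x a b. x \<in> V \<Longrightarrow> window T a b x \<in> V"
    and x: "x \<in> V" and h: "0 \<le> h" "h < e" and l: "c - h \<le> l" "l \<le> c + h"
  shows "below T l x = below T c x" "strictly_below T l x = below T c x"
proof -
  let ?s = "strictly_below T (c - h) x"
  have eq: "below T (c + h) x = ?s"
    using gap_window_zero[OF gap inv x h] by (simp add: window_apply[OF T])
  have const: "below T k x = ?s" "strictly_below T k x = ?s" if k: "c - h \<le> k" "k \<le> c + h" for k
  proof -
    have "below T k x = below T k (below T (c + h) x)" using k below_below[OF T] by simp
    also have "\<dots> = ?s" unfolding eq using k below_strictly_below[OF T] by simp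
    finally show *: "below T k x = ?s" .
    show "strictly_below T k x = ?s"
    proof (cases "k = c - h")
      case False
      then have k': "c - h < k" using k by simp
      have "strictly_below T k x = strictly_below T k (below T k x)"
        using below_strictly_below[OF T] by simp
      also have "\<dots> = strictly_below T k (below T (c - h) ?s)"
        using * below_strictly_below[OF T] by simp
      also have "\<dots> = below T (c - h) ?s" by (rule strictly_below_below[OF T k'])
      finally show ?thesis using below_strictly_below[OF T] by simp
    qed simp
  qed
  show "below T l x = below T c x" "strictly_below T l x = below T c x"
    using const[OF l] const[of c] h by simp_all
qed

end

section \<open>Stieltjes integrals of the identity\<close>

context
  fixes F :: "real \<Rightarrow> real" and N :: real
  assumes F_mono: "\<And>u v. u \<le> v \<Longrightarrow> F u \<le> F v"
    and F_right: "\<And>u. continuous (at_right u) F"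
    and F_bot: "(F \<longlongrightarrow> 0) at_bot"
    and F_top: "(F \<longlongrightarrow> N) at_top"
begin

lemma distribution_bounds: "0 \<le> F u" "F u \<le> N"
proof -
  show "0 \<le> F u"
    using F_bot by (rule tendsto_upperbound) (auto simp: eventually_at_bot_linorder F_mono intro!: exI[of _ u])
  show "F u \<le> N"
    using F_top by (rule tendsto_lowerbound) (auto simp: eventually_at_top_linorder F_mono intro!: exI[of _ u])
qed

lemma total_mass_nonneg: "0 \<le> N"
  using distribution_bounds[of 0] by linarith

lemma finite_interval_measure: "finite_measure (interval_measure F)"
  using finite_borel_measure_interval_measure[OF F_mono F_right F_bot F_top total_mass_nonneg]
  by (simp add: finite_borel_measure_def)

lemma measure_Iic: "measure (interval_measure F) {..u} = F u"
  using measure_interval_measure_Iic[OF F_mono F_right F_bot] by simp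

lemma measure_UNIV: "measure (interval_measure F) UNIV = N"
  using interval_measure_UNIV[OF F_mono F_right F_bot F_top total_mass_nonneg] total_mass_nonneg
  by (simp add: measure_def)

lemma AE_le_of_full_mass:
  assumes "F d = N"
  shows "AE l in interval_measure F. l \<le> d"
proof -
  interpret finite_measure "interval_measure F" by (rule finite_interval_measure)
  have "measure (interval_measure F) (UNIV - {..d}) = 0"
    using finite_measure_compl[of "{..d}"] assms by (simp add: measure_Iic measure_UNIV)
  then show ?thesis
    by (intro AE_I[where N="UNIV - {..d}"]) (auto simp: emeasure_eq_measure)
qed

lemma AE_gt_of_no_mass:
  assumes "F d = 0"
  shows "AE l in interval_measure F. d < l"
proof -
  interpret finite_measure "interval_measure F" by (rule finite_interval_measure)
  have "measure (interval_measure F) {..d} = 0" using assms by (simp add: measure_Iic)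
  then show ?thesis
    by (intro AE_I[where N="{..d}"]) (auto simp: emeasure_eq_measure)
qed

text \<open>Mass only on \<open>(-\<infinity>, d]\<close>, or only on \<open>(d, \<infinity>)\<close>, bounds the mean; these two cases are what vectors in
  the range and in the kernel of a spectral projection give.\<close>

lemma stieltjes_mean_le:
  assumes I: "has_bochner_integral (interval_measure F) (\<lambda>l. l) I" and "F d = N"
  shows "I \<le> d * N"
proof -
  interpret finite_measure "interval_measure F" by (rule finite_interval_measure)
  have "integral\<^sup>L (interval_measure F) (\<lambda>l. l) \<le> integral\<^sup>L (interval_measure F) (\<lambda>l. d)"
    using I AE_le_of_full_mass[OF assms(2)]
    by (intro integral_mono_AE) (auto simp: has_bochner_integral_iff)
  then show ?thesis
    using I by (simp add: has_bochner_integral_iff measure_UNIV mult.commute)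
qed

lemma stieltjes_mean_gt:
  assumes I: "has_bochner_integral (interval_measure F) (\<lambda>l. l) I" and "F d = 0" and "0 < N"
  shows "d * N < I"
proof -
  interpret finite_measure "interval_measure F" by (rule finite_interval_measure)
  have int: "integrable (interval_measure F) (\<lambda>l. l - d)"
    using I by (intro Bochner_Integration.integrable_diff) (auto simp: has_bochner_integral_iff)
  have val: "integral\<^sup>L (interval_measure F) (\<lambda>l. l - d) = I - d * N"
    using I by (subst Bochner_Integration.integral_diff)
      (auto simp: has_bochner_integral_iff measure_UNIV)
  have pos: "AE l in interval_measure F. 0 < l - d"
    using AE_gt_of_no_mass[OF assms(2)] by auto
  have nonneg: "AE l in interval_measure F. 0 \<le> l - d"
    using pos by eventually_elim simp
  have "0 \<le> I - d * N" using integral_nonneg_AE[OF nonneg] val by simp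
  moreover have "I - d * N \<noteq> 0"
  proof
    assume "I - d * N = 0"
    then have "AE l in interval_measure F. l - d = 0"
      using integral_nonneg_eq_0_iff_AE[OF int nonneg] val by simp
    with pos have "AE l in interval_measure F. False" by eventually_elim simp
    then have "measure (interval_measure F) UNIV = 0"
      by (simp add: eventually_False ae_filter_eq_bot_iff measure_def)
    then show False using \<open>0 < N\<close> by (simp add: measure_UNIV)
  qed
  ultimately show ?thesis by simp
qed

end

text \<open>An increment bound of second order forces a function to be constant: bisect \<open>n\<close> times.\<close>

lemma constant_of_second_order_increments:
  fixes G F :: "real \<Rightarrow> real"
  assumes inc: "\<And>u v. u \<le> v \<Longrightarrow> \<bar>G v - G u\<bar> \<le> (v - u) * (F v - F u)" and "u \<le> v"
  shows "G u = G v"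
proof -
  have *: "\<bar>G v - G u\<bar> \<le> (v - u) * (F v - F u) / 2 ^ n" if "u \<le> v" for n u v
    using that
  proof (induction n arbitrary: u v)
    case 0
    then show ?case using inc by simp
  next
    case (Suc n)
    define w where "w = (u + v) / 2"
    have w: "u \<le> w" "w \<le> v" "w - u = (v - u) / 2" "v - w = (v - u) / 2"
      using Suc.prems by (simp_all add: w_def field_simps)
    have "\<bar>G v - G u\<bar> \<le> \<bar>G v - G w\<bar> + \<bar>G w - G u\<bar>" by simp
    also have "\<dots> \<le> (v - w) * (F v - F w) / 2 ^ n + (w - u) * (F w - F u) / 2 ^ n"
      using Suc.IH[OF w(1)] Suc.IH[OF w(2)] by simp
    also have "\<dots> = (v - u) * (F v - F u) / 2 ^ Suc n"
      unfolding w(3,4) by (simp add: field_simps)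
    finally show ?case .
  qed
  have "(\<lambda>n. (v - u) * (F v - F u) * (1/2) ^ n) \<longlonglongrightarrow> (v - u) * (F v - F u) * 0"
    by (intro tendsto_intros LIMSEQ_power_zero) simp
  then have "\<bar>G v - G u\<bar> \<le> (v - u) * (F v - F u) * 0"
    using *[OF \<open>u \<le> v\<close>] by (intro LIMSEQ_le_const) (auto simp: power_one_over)
  then show ?thesis by simp
qed


section \<open>The spectral theorem in integral form\<close>

context
  fixes T :: "'a::{real_inner,banach} \<Rightarrow>\<^sub>L 'a"
  assumes T: "symmetric_op T"
begin

lemma spectral_distribution_mono: "u \<le> v \<Longrightarrow> (norm (below T u x))\<^sup>2 \<le> (norm (below T v x))\<^sup>2"
  by (intro power_mono below_norm_mono[OF T]) auto

lemma below_continuous_right: "continuous (at_right l) (\<lambda>m. below T m x)"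
  unfolding continuous_within by (rule below_right_limit[OF T])

lemma below_lim_bot: "((\<lambda>m. below T m x) \<longlongrightarrow> 0) at_bot"
  by (rule tendsto_eventually)
    (auto simp: eventually_at_bot_dense below_under_norm[OF T] intro!: exI[of _ "- norm T"])

lemma below_lim_top: "((\<lambda>m. below T m x) \<longlongrightarrow> x) at_top"
  by (rule tendsto_eventually)
    (auto simp: eventually_at_top_linorder below_above_norm[OF T] intro!: exI[of _ "norm T"])

text \<open>With \<open>P\<^sub>u\<close> for \<open>below T u\<close>, the increment \<open>P\<^sub>v x - P\<^sub>u x\<close> is in the range of \<open>P\<^sub>v\<close> and in the kernel of \<open>P\<^sub>u\<close>, so the form on it
  lies between \<open>u\<close> and \<open>v\<close>.\<close>

lemma spectral_increment_form_bounds: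
  fixes x :: 'a
  assumes "u \<le> v"
  defines "D \<equiv> T (below T v x) \<bullet> below T v x - T (below T u x) \<bullet> below T u x"
    and "m \<equiv> (norm (below T v x))\<^sup>2 - (norm (below T u x))\<^sup>2"
  shows "u * m \<le> D" "D \<le> v * m"
proof -
  note B = projection_opD[OF projection_below[OF T]]
  define y where "y = below T v x - below T u x"
  have y: "below T v y = y" "below T u y = 0"
    using assms(1) by (simp_all add: y_def blinfun.diff_right B below_below[OF T])
  have Tu: "below T u (T w) = T (below T u w)" for w
    by (rule commutesD[OF commutes_below_self[OF T]])
  have ortho: "y \<bullet> below T u w = 0" for w
    using B(1)[of u y w] y(2) by simp
  have Tortho: "T y \<bullet> below T u x = 0"
    using B(1)[of u "T y" x] Tu[of y] y(2) by (simp add: blinfun.zero_right)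
  have eq: "below T v x = y + below T u x" by (simp add: y_def)
  have "m = y \<bullet> y"
    using ortho[of x] by (simp add: m_def eq power2_norm_eq_inner inner_add inner_commute)
  moreover have "D = T y \<bullet> y"
  proof -
    have "T (below T u x) \<bullet> y = 0"
      using Tortho symmetric_opD[OF T, of y "below T u x"] by (simp add: inner_commute)
    then show ?thesis
      using Tortho by (simp add: D_def eq blinfun.add_right inner_add)
  qed
  moreover have "T y \<bullet> y \<le> v * (y \<bullet> y)" by (rule below_fixed[OF T y(1)])
  moreover have "u * (y \<bullet> y) \<le> T y \<bullet> y" using below_kernel[OF T y(2)] by (cases "y = 0") auto
  ultimately show "u * m \<le> D" "D \<le> v * m" by auto
qed

text \<open>Compare \<open>\<integral>\<^sub>{l \<le> u} l dF(l)\<close> with \<open>\<langle>T P\<^sub>u x, P\<^sub>u x\<rangle>\<close>: the increments of both over \<open>(u, v]\<close> lie between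
  \<open>u (F v - F u)\<close> and \<open>v (F v - F u)\<close>, so the difference does not depend on \<open>u\<close>.\<close>

lemma spectral_integral:
  "has_bochner_integral (interval_measure (\<lambda>l. (norm (below T l x))\<^sup>2)) (\<lambda>l. l) (T x \<bullet> x)"
proof -
  define F where "F l = (norm (below T l x))\<^sup>2" for l
  define N where "N = (norm x)\<^sup>2"
  define M where "M = interval_measure F"
  have F_mono: "\<And>u v. u \<le> v \<Longrightarrow> F u \<le> F v"
    unfolding F_def by (rule spectral_distribution_mono)
  have F_right: "\<And>u. continuous (at_right u) F"
    unfolding F_def by (intro continuous_power continuous_norm below_continuous_right)
  have F_bot: "(F \<longlongrightarrow> 0) at_bot"
    using tendsto_power[OF tendsto_norm[OF below_lim_bot[of x]], of 2] by (simp add: F_def[abs_def])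
  have F_top: "(F \<longlongrightarrow> N) at_top"
    unfolding F_def N_def by (intro tendsto_power tendsto_norm below_lim_top)
  note Fs = F_mono F_right F_bot F_top
  interpret finite_measure M unfolding M_def by (rule finite_interval_measure[OF Fs])
  \<comment> \<open>All mass is in \<open>(- K, K]\<close>.  At \<open>- \<parallel>T\<parallel>\<close> itself there may be mass, whence the \<open>+ 1\<close>.\<close>
  define K where "K = norm T + 1"
  have K: "F K = N" "F (- K) = 0" "0 \<le> K"
    by (simp_all add: K_def F_def N_def below_above_norm[OF T] below_under_norm[OF T])
  have AE_K: "AE l in M. l \<le> K" "AE l in M. - K < l"
    unfolding M_def using AE_le_of_full_mass[OF Fs K(1)] AE_gt_of_no_mass[OF Fs K(2)] by auto
  have meas [measurable]: "(\<lambda>l. l) \<in> borel_measurable M" by (simp add: M_def)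
  have int: "integrable M (\<lambda>l. l)"
  proof (rule integrable_const_bound[of _ K])
    show "AE l in M. norm l \<le> K" using AE_K by eventually_elim (simp add: abs_le_iff)
  qed (rule meas)
  have sets: "{..u} \<in> sets M" "{u<..v} \<in> sets M" for u v by (simp_all add: M_def)
  have int_ind: "integrable M (\<lambda>l. indicat_real A l * l)" if "A \<in> sets M" for A
    using integrable_mult_indicator[OF that int] by simp
  define G where "G u = integral\<^sup>L M (\<lambda>l. indicat_real {..u} l * l) - T (below T u x) \<bullet> below T u x" for u
  have "\<bar>G v - G u\<bar> \<le> (v - u) * (F v - F u)" if uv: "u \<le> v" for u v
  proof -
    define J where "J = integral\<^sup>L M (\<lambda>l. indicat_real {u<..v} l * l)"
    have meas_Ioc: "measure M {u<..v} = F v - F u"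
      unfolding M_def by (rule measure_interval_measure_Ioc[OF uv F_mono F_right])
    have "integral\<^sup>L M (\<lambda>l. indicat_real {..v} l * l) - integral\<^sup>L M (\<lambda>l. indicat_real {..u} l * l)
        = integral\<^sup>L M (\<lambda>l. indicat_real {..v} l * l - indicat_real {..u} l * l)"
      by (rule Bochner_Integration.integral_diff[symmetric]; rule int_ind; rule sets)
    also have "\<dots> = J"
      unfolding J_def using uv by (intro Bochner_Integration.integral_cong) (auto simp: indicator_def)
    finally have J: "integral\<^sup>L M (\<lambda>l. indicat_real {..v} l * l)
        - integral\<^sup>L M (\<lambda>l. indicat_real {..u} l * l) = J" .
    have int_const: "integrable M (\<lambda>l. indicat_real {u<..v} l * k)" for k
      using sets by (intro integrable_mult_left) (auto simp: emeasure_eq_measure)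
    have val_const: "integral\<^sup>L M (\<lambda>l. indicat_real {u<..v} l * k) = k * (F v - F u)" for k
      using sets by (simp add: meas_Ioc)
    have "integral\<^sup>L M (\<lambda>l. indicat_real {u<..v} l * u) \<le> J"
      unfolding J_def by (intro integral_mono int_const int_ind sets) (auto simp: indicator_def)
    moreover have "J \<le> integral\<^sup>L M (\<lambda>l. indicat_real {u<..v} l * v)"
      unfolding J_def by (intro integral_mono int_const int_ind sets) (auto simp: indicator_def)
    ultimately have "u * (F v - F u) \<le> J" "J \<le> v * (F v - F u)" by (simp_all only: val_const)
    then show ?thesis
      using J spectral_increment_form_bounds[OF uv, of x]
      by (simp add: G_def F_def algebra_simps)
  qed
  then have "G (- K) = G K" by (rule constant_of_second_order_increments) (use K in auto)
  moreover have "G (- K) = 0"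
  proof -
    have "integral\<^sup>L M (\<lambda>l. indicat_real {..- K} l * l) = integral\<^sup>L M (\<lambda>l. 0)"
    proof (intro integral_cong_AE)
      show "AE l in M. indicat_real {..- K} l * l = 0"
        using AE_K(2) by eventually_elim (simp add: indicator_def)
    qed (rule borel_measurable_integrable[OF int_ind[OF sets(1)]], simp)
    then show ?thesis
      by (simp add: G_def K_def below_under_norm[OF T] blinfun.zero_right)
  qed
  moreover have "G K = integral\<^sup>L M (\<lambda>l. l) - T x \<bullet> x"
  proof -
    have "integral\<^sup>L M (\<lambda>l. indicat_real {..K} l * l) = integral\<^sup>L M (\<lambda>l. l)"
    proof (intro integral_cong_AE)
      show "AE l in M. indicat_real {..K} l * l = l"
        using AE_K(1) by eventually_elim (simp add: indicator_def)
    qed (rule borel_measurable_integrable[OF int_ind[OF sets(1)]], rule meas)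
    then show ?thesis
      by (simp add: G_def K_def below_above_norm[OF T])
  qed
  ultimately show ?thesis
    using int by (simp add: has_bochner_integral_iff M_def F_def[abs_def])
qed

end


section \<open>Complex structure and reducing subspaces\<close>

instance complex_hilbert \<subseteq> banach ..

lemma inner_imaginary: "(\<i> *\<^sub>C x) \<bullet> y = - Im (cinner x (y::'a::complex_inner))"
  by (simp add: Re_cinner[symmetric] cinner_scaleC_left)

text \<open>The complex inner product is determined by its real part and multiplication by \<open>\<i>\<close>.\<close>

lemma cinner_eq_inner: "cinner x y = Complex (x \<bullet> y) (- ((\<i> *\<^sub>C x) \<bullet> (y::'a::complex_inner)))"
  by (simp add: complex_eq_iff inner_imaginary Re_cinner)

lemma scaleC_eq: "c *\<^sub>C x = Re c *\<^sub>R x + Im c *\<^sub>R \<i> *\<^sub>C (x::'a::complex_inner)"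
proof -
  have "c *\<^sub>C x = (of_real (Re c) + of_real (Im c) * \<i>) *\<^sub>C x"
    by (metis complex_eq mult.commute)
  then show ?thesis
    by (simp only: scaleC_add_left scaleC_scaleC[symmetric] scaleC_of_real)
qed

lemma norm_imaginary: "norm (\<i> *\<^sub>C x) = norm (x::'a::complex_inner)"
proof -
  have "cinner (\<i> *\<^sub>C x) (\<i> *\<^sub>C x) = cinner x x"
    by (simp add: cinner_scaleC_left cinner_commute[of x "\<i> *\<^sub>C x"]) (simp add: cinner_commute[of x x, symmetric])
  then have "(\<i> *\<^sub>C x) \<bullet> (\<i> *\<^sub>C x) = x \<bullet> x" by (simp add: Re_cinner[symmetric])
  then show ?thesis by (simp add: norm_eq_sqrt_inner)
qed

lemma complex_subspace_real:
  "complex_vector.subspace V \<Longrightarrow> subspace (V :: 'a::complex_inner set)"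
  unfolding subspace_def complex_vector.subspace_def by (metis scaleC_of_real)

definition imaginary_unit :: "'a::complex_inner \<Rightarrow>\<^sub>L 'a"
  where "imaginary_unit = Blinfun (\<lambda>x. \<i> *\<^sub>C x)"

lemma imaginary_unit_apply: "imaginary_unit x = \<i> *\<^sub>C x"
proof -
  have "bounded_linear (\<lambda>x::'a. \<i> *\<^sub>C x)"
  proof (rule bounded_linear_intro[of _ 1])
    fix r and x :: 'a
    show "\<i> *\<^sub>C r *\<^sub>R x = r *\<^sub>R \<i> *\<^sub>C x"
      by (simp only: scaleC_of_real[symmetric] scaleC_scaleC mult.commute)
  qed (simp_all add: scaleC_add_right norm_imaginary)
  then show ?thesis by (simp add: imaginary_unit_def bounded_linear_Blinfun_apply)
qed

definition complex_linear :: "('a::complex_inner \<Rightarrow>\<^sub>L 'a) \<Rightarrow> bool"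
  where "complex_linear T \<longleftrightarrow> (\<forall>c x. T (c *\<^sub>C x) = c *\<^sub>C T x)"

lemma complex_linear_iff: "complex_linear T \<longleftrightarrow> commutes imaginary_unit T"
proof
  assume "commutes imaginary_unit T"
  then have "T (\<i> *\<^sub>C x) = \<i> *\<^sub>C T x" for x
    using commutesD[of imaginary_unit T x] by (simp add: imaginary_unit_apply)
  then have "T (c *\<^sub>C x) = c *\<^sub>C T x" for c x
    by (simp only: scaleC_eq[of c x] scaleC_eq[of c "T x"] blinfun.add_right blinfun.scaleR_right)
  then show "complex_linear T" by (simp add: complex_linear_def)
qed (simp add: complex_linear_def commutes_def imaginary_unit_apply)

lemma symmetric_complex_cinner:
  assumes "symmetric_op T" "complex_linear T"
  shows "cinner (T x) y = cinner x (T y)"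
  using assms(2) symmetric_opD[OF assms(1)] by (simp add: cinner_eq_inner complex_linear_def) metis

text \<open>\<open>T\<close> stays an operator on the whole space and \<open>V\<close> is a part of it, so that restrictions of one
  operator to several subspaces can be compared.  By symmetry the orthogonal complement of \<open>V\<close> is
  invariant as well.\<close>

locale reduced_operator =
  fixes V :: "'a::complex_hilbert set" and T :: "'a \<Rightarrow>\<^sub>L 'a"
  assumes V_closed: "closed V" and V_subspace: "complex_vector.subspace V"
    and T_complex: "complex_linear T" and T_symmetric: "symmetric_op T"
    and T_invariant: "\<And>x. x \<in> V \<Longrightarrow> T x \<in> V"
begin

lemmas V_real_subspace = complex_subspace_real[OF V_subspace]

lemma commutes_proj_V: "commutes T (proj_onto V)"
  by (rule symmetric_commutes_proj_onto[OF V_closed V_real_subspace T_symmetric T_invariant])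

lemma invariant_if_commutes_proj_V:
  assumes "commutes (proj_onto V) C" "x \<in> V"
  shows "C x \<in> V"
  using commutesD[OF assms(1), of x] proj_onto_in[OF V_closed V_real_subspace, of "C x"]
    proj_onto_ident[OF V_closed V_real_subspace assms(2)] by simp

lemma below_in: "x \<in> V \<Longrightarrow> below T l x \<in> V"
  using commutes_below[OF T_symmetric commutes_sym[OF commutes_proj_V]]
  by (rule invariant_if_commutes_proj_V)

lemma window_in: "x \<in> V \<Longrightarrow> window T c d x \<in> V"
  using commutes_window[OF T_symmetric commutes_sym[OF commutes_proj_V]]
  by (rule invariant_if_commutes_proj_V)

lemma complex_linear_below: "complex_linear (below T l)"
  using T_complex unfolding complex_linear_iff by (rule commutes_below[OF T_symmetric])

lemma complex_linear_window: "complex_linear (window T c d)"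
  using T_complex unfolding complex_linear_iff by (rule commutes_window[OF T_symmetric])

lemma orthogonal_projection_on_below: "orthogonal_projection_on V (below T l)"
  unfolding orthogonal_projection_on_def selfadjoint_on_def bounded_op_on_def
proof (intro conjI ballI allI)
  note P = projection_below[OF T_symmetric, of l]
  show "\<exists>K. \<forall>x\<in>V. norm (below T l x) \<le> K * norm x"
    using projection_op_norm_le[OF P] by (intro exI[of _ 1]) simp
  show "cinner (below T l x) y = cinner x (below T l y)" for x y
    using P complex_linear_below by (intro symmetric_complex_cinner) (auto simp: projection_op_def)
  show "below T l (below T l x) = below T l x" for x
    by (rule projection_opD(2)[OF P])
  show "below T l (c *\<^sub>C x) = c *\<^sub>C below T l x" for c x
    using complex_linear_below by (simp add: complex_linear_def)
qed (auto simp: below_in blinfun.add_right)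

lemma spectral_family_below:
  assumes T': "\<And>x. x \<in> V \<Longrightarrow> T' x = T x"
  shows "spectral_family_on V T' (\<lambda>l. below T l)"
  unfolding spectral_family_on_def
proof (intro conjI ballI allI)
  show "has_bochner_integral (interval_measure (\<lambda>l. (norm (below T l x))\<^sup>2)) (\<lambda>l. l)
      (Re (cinner (T' x) x))" if "x \<in> V" for x
    using spectral_integral[OF T_symmetric, of x] that by (simp add: T' Re_cinner)
qed (simp_all add: orthogonal_projection_on_below below_min[OF T_symmetric]
    below_continuous_right[OF T_symmetric] below_lim_bot[OF T_symmetric] below_lim_top[OF T_symmetric])

text \<open>Uniqueness.  If \<open>x\<close> is in the range and \<open>y\<close> in the kernel of \<open>P d\<close>, the cross terms of
  \<open>\<parallel>P l (x \<plusminus> y)\<parallel>\<^sup>2\<close> vanish, so \<open>x + y\<close> and \<open>x - y\<close> have the same distribution function, hence the same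
  value of the quadratic form, that is, \<open>\<langle>T x, y\<rangle> = 0\<close>.  So \<open>P d\<close> commutes with \<open>T\<close>, hence with
  \<open>below T d\<close>, and the form separates the range of each of the two from the kernel of the other.\<close>

lemma spectral_family_unique:
  assumes T': "\<And>x. x \<in> V \<Longrightarrow> T' x = T x" and P: "spectral_family_on V T' P" and x: "x \<in> V"
  shows "P d x = below T d x"
proof -
  note V = V_closed V_real_subspace
  let ?p = "proj_onto V"
  have pV: "?p z \<in> V" for z by (rule proj_onto_in[OF V])
  have pid: "?p z = z" if "z \<in> V" for z by (rule proj_onto_ident[OF V that])
  have P_in: "P l z \<in> V" if "z \<in> V" for l z
    using P that by (auto simp: spectral_family_on_def orthogonal_projection_on_def
        selfadjoint_on_def bounded_op_on_def)
  have P_add: "P l (y + z) = P l y + P l z" if "y \<in> V" "z \<in> V" for l y z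
    using P that by (auto simp: spectral_family_on_def orthogonal_projection_on_def
        selfadjoint_on_def bounded_op_on_def)
  have P_scaleC: "P l (c *\<^sub>C z) = c *\<^sub>C P l z" if "z \<in> V" for l c z
    using P that by (auto simp: spectral_family_on_def orthogonal_projection_on_def
        selfadjoint_on_def bounded_op_on_def)
  have P_sym: "P l y \<bullet> z = y \<bullet> P l z" if "y \<in> V" "z \<in> V" for l y z
  proof -
    have "cinner (P l y) z = cinner y (P l z)"
      using P that by (auto simp: spectral_family_on_def orthogonal_projection_on_def
          selfadjoint_on_def)
    then show ?thesis by (simp add: Re_cinner[symmetric])
  qed
  have P_min: "P l (P m z) = P (min l m) z" if "z \<in> V" for l m z
    using P that by (auto simp: spectral_family_on_def)
  have P_norm: "norm (P l z) \<le> norm z" if z: "z \<in> V" for l z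
  proof -
    have "(norm (P l z))\<^sup>2 = z \<bullet> P l z"
      using P_sym[OF z P_in[OF z], of l l] P_min[OF z, of l l] by (simp add: power2_norm_eq_inner)
    also have "\<dots> \<le> norm z * norm (P l z)" by (rule norm_cauchy_schwarz)
    finally show ?thesis
      by (cases "P l z = 0") (simp_all add: power2_eq_square)
  qed
  \<comment> \<open>Extended by zero to the orthogonal complement, the family consists of operators on the whole
    space, to which the commutation property of \<open>below T d\<close> applies.\<close>
  define Q where "Q l = Blinfun (\<lambda>z. P l (?p z))" for l
  have Q_apply: "Q l z = P l (?p z)" for l z
  proof -
    have "bounded_linear (\<lambda>z. P l (?p z))"
    proof (rule bounded_linear_intro[of _ 1])
      show "P l (?p (r *\<^sub>R z)) = r *\<^sub>R P l (?p z)" for r z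
        using P_scaleC[OF pV, of l "of_real r" z] by (simp add: blinfun.scaleR_right scaleC_of_real)
      show "norm (P l (?p z)) \<le> norm z * 1" for z
        using order_trans[OF P_norm[OF pV] projection_op_norm_le[OF projection_op_proj_onto[OF V]]]
        by simp
    qed (simp add: blinfun.add_right P_add pV)
    then show ?thesis by (simp add: Q_def bounded_linear_Blinfun_apply)
  qed
  have Q_V: "Q l z \<in> V" for l z by (simp add: Q_apply P_in pV)
  have Q_P: "Q l z = P l z" if "z \<in> V" for l z using that by (simp add: Q_apply pid)
  have Q_min: "Q l (Q m z) = Q (min l m) z" for l m z
    by (simp add: Q_P[OF Q_V]) (simp add: Q_apply P_min pV)
  have Q_proj: "projection_op (Q l)" for l
  proof -
    have "Q l y \<bullet> z = y \<bullet> Q l z" for y z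
    proof -
      note ps = projection_opD(1)[OF projection_op_proj_onto[OF V]]
      have "Q l y \<bullet> z = P l (?p y) \<bullet> ?p z"
        using ps[of "P l (?p y)" z] pid[OF P_in[OF pV]] by (simp add: Q_apply)
      also have "\<dots> = ?p y \<bullet> P l (?p z)" by (rule P_sym[OF pV pV])
      also have "\<dots> = y \<bullet> Q l z"
        using ps[of y "P l (?p z)"] pid[OF P_in[OF pV]] by (simp add: Q_apply)
      finally show ?thesis .
    qed
    then show ?thesis by (simp add: projection_op_def symmetric_op_def Q_min)
  qed
  note Qs = projection_opD[OF Q_proj]
  define F where "F z l = (norm (Q l z))\<^sup>2" for z l
  have F_mono: "F z u \<le> F z v" if "u \<le> v" for z u v
    using projection_op_norm_le[OF Q_proj, of u "Q v z"] that
    by (simp add: F_def Q_min min_absorb1 power_mono)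
  have F_right: "continuous (at_right u) (F z)" for z u
  proof -
    have "continuous (at_right u) (\<lambda>m. P m (?p z))"
      using P pV[of z] by (auto simp: spectral_family_on_def)
    then show ?thesis unfolding F_def Q_apply by (intro continuous_power continuous_norm)
  qed
  have F_bot: "(F z \<longlongrightarrow> 0) at_bot" for z
  proof -
    have "((\<lambda>m. P m (?p z)) \<longlongrightarrow> 0) at_bot"
      using P pV[of z] by (auto simp: spectral_family_on_def)
    from tendsto_power[OF tendsto_norm[OF this], of 2] show ?thesis
      by (simp add: F_def[abs_def] Q_apply)
  qed
  have F_top: "(F z \<longlongrightarrow> (norm z)\<^sup>2) at_top" if z: "z \<in> V" for z
  proof -
    have "((\<lambda>m. P m z) \<longlongrightarrow> z) at_top"
      using P z by (auto simp: spectral_family_on_def)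
    from tendsto_power[OF tendsto_norm[OF this], of 2] show ?thesis
      using z by (simp add: F_def[abs_def] Q_P)
  qed
  have F_integral: "has_bochner_integral (interval_measure (F z)) (\<lambda>l. l) (T z \<bullet> z)" if z: "z \<in> V" for z
  proof -
    have "has_bochner_integral (interval_measure (\<lambda>l. (norm (P l z))\<^sup>2)) (\<lambda>l. l) (Re (cinner (T' z) z))"
      using P z by (auto simp: spectral_family_on_def)
    then show ?thesis using z by (simp add: F_def[abs_def] Q_P T' Re_cinner)
  qed
  have Q_le: "T z \<bullet> z \<le> d * (z \<bullet> z)" if "Q d z = z" for z
  proof -
    have z: "z \<in> V" using Q_V[of d z] that by simp
    have "F z d = (norm z)\<^sup>2" using that by (simp add: F_def)
    from stieltjes_mean_le[OF F_mono F_right F_bot F_top[OF z] F_integral[OF z] this]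
    show ?thesis by (simp add: power2_norm_eq_inner)
  qed
  have Q_gt: "d * (z \<bullet> z) < T z \<bullet> z" if z: "z \<in> V" "Q d z = 0" "z \<noteq> 0" for z
  proof -
    have "F z d = 0" using z by (simp add: F_def)
    from stieltjes_mean_gt[OF F_mono F_right F_bot F_top[OF z(1)] F_integral[OF z(1)] this]
    show ?thesis using z by (simp add: power2_norm_eq_inner)
  qed
  have cross: "T y \<bullet> z = 0" if y: "Q d y = y" and z: "z \<in> V" "Q d z = 0" for y z
  proof -
    have yV: "y \<in> V" using Q_V[of d y] y by simp
    have "Q l y \<bullet> Q l z = 0" for l
    proof -
      have "Q d (Q l y) = Q l y" using Q_min[of d l y] Q_min[of l d y] y by (simp add: min.commute)
      then have "Q l y \<bullet> Q l z = Q l y \<bullet> Q d (Q l z)" using Qs(1)[of d "Q l y" "Q l z"] by simp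
      also have "Q d (Q l z) = Q l (Q d z)" by (simp add: Q_min min.commute)
      finally show ?thesis by (simp add: z blinfun.zero_right)
    qed
    then have "F (y + z) = F (y - z)"
      by (intro ext) (simp add: F_def blinfun.add_right blinfun.diff_right power2_norm_eq_inner
          inner_add inner_diff inner_commute)
    moreover have "y + z \<in> V" "y - z \<in> V"
      using yV z V_real_subspace by (auto intro: subspace_add subspace_diff)
    ultimately have "T (y + z) \<bullet> (y + z) = T (y - z) \<bullet> (y - z)"
      using F_integral[of "y + z"] F_integral[of "y - z"] by (metis has_bochner_integral_eq)
    then show ?thesis
      using symmetric_opD[OF T_symmetric, of z y]
      by (simp add: blinfun.add_right blinfun.diff_right inner_add inner_diff inner_commute)
  qed
  have QT: "commutes (Q d) T"
  proof -
    have "Q d (T w) = T (Q d w)" for w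
    proof -
      have wV: "?p w \<in> V" by (rule pV)
      define y z where "y = Q d (?p w)" and "z = ?p w - Q d (?p w)"
      have y: "Q d y = y" by (simp add: y_def Qs)
      have z: "z \<in> V" "Q d z = 0"
        using wV Q_V V_real_subspace by (auto simp: z_def Qs blinfun.diff_right intro: subspace_diff)
      have "y \<in> V" using Q_V by (simp add: y_def)
      have "T y - Q d (T y) = 0"
      proof -
        let ?u = "T y - Q d (T y)"
        have u: "?u \<in> V" "Q d ?u = 0"
          using T_invariant[OF \<open>y \<in> V\<close>] Q_V V_real_subspace
          by (auto simp: Qs blinfun.diff_right intro: subspace_diff)
        have "?u \<bullet> ?u = T y \<bullet> ?u - T y \<bullet> Q d ?u" by (simp add: inner_diff_left Qs)
        also have "\<dots> = 0" using cross[OF y u] u by simp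
        finally show ?thesis by simp
      qed
      moreover have "Q d (T z) = 0"
      proof -
        have "Q d (T z) \<bullet> Q d (T z) = T z \<bullet> Q d (T z)" by (simp add: Qs)
        also have "\<dots> = T (Q d (T z)) \<bullet> z"
          by (simp add: symmetric_opD[OF T_symmetric] inner_commute)
        also have "\<dots> = 0" by (rule cross) (simp_all add: Qs z)
        finally show ?thesis by simp
      qed
      moreover have "Q d (T w) = Q d (T (?p w))"
        using commutesD[OF commutes_proj_V, of w] pid[OF pV] by (simp add: Q_apply)
      moreover have "Q d w = y" using pid[OF pV] by (simp add: y_def Q_apply)
      moreover have "?p w = y + z" by (simp add: y_def z_def)
      ultimately show ?thesis by (simp add: blinfun.add_right)
    qed
    then show ?thesis by (simp add: commutes_def)
  qed
  have comm: "commutes (Q d) (below T d)" by (rule commutes_below[OF T_symmetric QT])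
  have "below T d (Q d x) = Q d x"
  proof (rule projection_absorb[OF Q_proj projection_below[OF T_symmetric] comm])
    fix y assume "Q d y = y" "below T d y = 0"
    then show "y = 0" using Q_le[of y] below_kernel[OF T_symmetric, of d y] by force
  qed
  moreover have "Q d (below T d x) = below T d x"
  proof -
    define z where "z = below T d x - Q d (below T d x)"
    have bV: "below T d x \<in> V" by (rule below_in[OF x])
    have "z \<in> V" using bV Q_V V_real_subspace by (auto simp: z_def intro: subspace_diff)
    moreover have "Q d z = 0" by (simp add: z_def blinfun.diff_right Qs)
    moreover have "below T d z = z"
      by (simp add: z_def blinfun.diff_right commutesD[OF comm, symmetric]
          projection_opD(2)[OF projection_below[OF T_symmetric]])
    ultimately have "z = 0" using Q_gt[of z] below_fixed[OF T_symmetric, of d z] by force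
    then show ?thesis by (simp add: z_def)
  qed
  ultimately show ?thesis using commutesD[OF comm, of x] Q_P[OF x] by simp
qed

text \<open>Whatever spectral family the definition chooses, on \<open>V\<close> it is \<open>below T\<close>.\<close>

lemma spectral_projection_eq:
  assumes T': "\<And>x. x \<in> V \<Longrightarrow> T' x = T x" and x: "x \<in> V"
  shows "spectral_projection V T' c d x = window T c d x"
proof -
  define P where "P = (SOME P. spectral_family_on V T' P)"
  have "spectral_family_on V T' P"
    unfolding P_def by (rule someI[of "spectral_family_on V T'", OF spectral_family_below[OF T']])
  then have P: "P l x = below T l x" for l
    using spectral_family_unique[of T' P x l] T' x by blast
  have "Lim (at_left c) (\<lambda>l. below T l x) = strictly_below T c x"
    by (intro tendsto_Lim below_left_limit T_symmetric trivial_limit_at_left_real)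
  then show ?thesis
    by (simp add: spectral_projection_def Let_def P_def[symmetric] P window_apply[OF T_symmetric])
qed

lemma spectral_subspace_eq:
  assumes T': "\<And>x. x \<in> V \<Longrightarrow> T' x = T x"
  shows "spectral_subspace V T' c d = window T c d ` V"
  unfolding spectral_subspace_def using spectral_projection_eq[OF T'] by (intro image_cong) auto

end

section \<open>Finite-dimensional complex subspaces\<close>

lemma finite_dim_basis:
  assumes "finite_dim W"
  obtains B where "finite B" "complex_vector.independent B" "complex_vector.span B = W"
    "complex_vector.dim W = card B"
proof -
  obtain C where C: "finite C" "W = complex_vector.span C" using assms by (auto simp: finite_dim_def)
  obtain B where B: "B \<subseteq> W" "complex_vector.independent B" "W \<subseteq> complex_vector.span B"
    "card B = complex_vector.dim W"
    by (rule complex_vector.basis_exists)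
  have "finite B"
    using complex_vector.independent_span_bound[OF C(1) B(2)] B(1) C(2) by blast
  moreover have "complex_vector.span B = W"
    using complex_vector.span_subspace[OF B(1,3)] C(2) complex_vector.subspace_span by blast
  ultimately show ?thesis using that B(2) B(4)[symmetric] by blast
qed

lemma finite_dim_subspace_closed: "finite_dim W \<Longrightarrow> complex_vector.subspace W"
  by (auto simp: finite_dim_def)

text \<open>Spectral subspaces are compared by projecting the one into the other.  That the source is finite
  dimensional is part of the conclusion, because for a perturbed operator it is not known before.\<close>

lemma dim_le_of_injective:
  fixes f :: "'a::complex_inner \<Rightarrow>\<^sub>L 'a"
  assumes f: "complex_linear f" and U: "complex_vector.subspace U" and W: "finite_dim W"
    and into: "\<And>x. x \<in> U \<Longrightarrow> f x \<in> W" and inj: "\<And>x. x \<in> U \<Longrightarrow> f x = 0 \<Longrightarrow> x = 0"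
  shows "finite_dim U" "complex_vector.dim U \<le> complex_vector.dim W"
proof -
  obtain C where C: "finite C" "complex_vector.independent C" "complex_vector.span C = W"
    "complex_vector.dim W = card C"
    by (rule finite_dim_basis[OF W])
  obtain B where B: "B \<subseteq> U" "complex_vector.independent B" "U \<subseteq> complex_vector.span B"
    "card B = complex_vector.dim U"
    by (rule complex_vector.basis_exists)
  have span: "complex_vector.span B = U"
    by (rule complex_vector.span_subspace[OF B(1,3) U])
  have inj_on: "inj_on f U"
  proof (rule inj_onI)
    fix x y assume "x \<in> U" "y \<in> U" "f x = f y"
    then have "x - y = 0"
      using complex_vector.subspace_diff[OF U] by (intro inj[of "x - y"]) (simp_all add: blinfun.diff_right)
    then show "x = y" by simp
  qed
  interpret f: module_hom scaleC scaleC f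
    using f by unfold_locales (simp_all add: blinfun.add_right complex_linear_def)
  have "complex_vector.independent (f ` B)"
    using B(2) inj_on by (intro f.independent_injective_image) (simp_all add: span)
  moreover have "f ` B \<subseteq> complex_vector.span C" using B(1) into C(3) by auto
  ultimately have fin: "finite (f ` B)" "card (f ` B) \<le> card C"
    using complex_vector.independent_span_bound[OF C(1)] by blast+
  have "inj_on f B" using inj_on B(1) by (rule inj_on_subset)
  then have "finite B" "card B \<le> card C"
    using fin by (auto simp: card_image dest: finite_imageD)
  then show "finite_dim U" "complex_vector.dim U \<le> complex_vector.dim W"
    using span B(4) C(4) by (auto simp: finite_dim_def)
qed

lemma finite_dim_subset:
  assumes "finite_dim W" "complex_vector.subspace U" "U \<subseteq> W"
  shows "finite_dim U"
  using assms by (intro dim_le_of_injective(1)[of id_blinfun U W]) (auto simp: complex_linear_def)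

definition sum_space :: "'a::complex_inner set \<Rightarrow> 'a set \<Rightarrow> 'a set"
  where "sum_space U W = {x + y | x y. x \<in> U \<and> y \<in> W}"

lemma dim_direct_sum:
  assumes U: "finite_dim U" and W: "finite_dim W" and disj: "\<And>x. x \<in> U \<Longrightarrow> x \<in> W \<Longrightarrow> x = 0"
  shows "finite_dim (sum_space U W)"
    "complex_vector.dim (sum_space U W) = complex_vector.dim U + complex_vector.dim W"
proof -
  obtain B where B: "finite B" "complex_vector.independent B" "complex_vector.span B = U"
    "complex_vector.dim U = card B"
    by (rule finite_dim_basis[OF U])
  obtain C where C: "finite C" "complex_vector.independent C" "complex_vector.span C = W"
    "complex_vector.dim W = card C"
    by (rule finite_dim_basis[OF W])
  have "complex_vector.independent (B \<union> D) \<and> B \<inter> D = {}" if "D \<subseteq> C" for D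
  proof -
    have "finite D" using C(1) that finite_subset by blast
    then show ?thesis using that
    proof (induction D rule: finite_induct)
      case (insert a D)
      have D: "complex_vector.independent (insert a D)"
        using insert.prems C(2) complex_vector.independent_mono by blast
      then have aD: "a \<notin> complex_vector.span D"
        using insert.hyps by (simp add: complex_vector.independent_insert)
      have aW: "a \<in> W" using insert.prems C(3) complex_vector.span_base by blast
      have "a \<notin> complex_vector.span (B \<union> D)"
      proof
        assume "a \<in> complex_vector.span (B \<union> D)"
        then obtain b d where bd: "a = b + d" "b \<in> U" "d \<in> complex_vector.span D"
          unfolding complex_vector.span_Un B(3) by auto
        have "d \<in> W" using bd(3) insert.prems C(3) complex_vector.span_mono[of D C] by auto
        then have "a - d \<in> W" using aW complex_vector.subspace_diff[OF finite_dim_subspace_closed[OF W]] by blast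
        then have "b = 0" using bd by (intro disj) auto
        then show False using bd aD by simp
      qed
      moreover have "a \<notin> B"
      proof
        assume "a \<in> B"
        then have "a \<in> complex_vector.span (B \<union> D)" by (intro complex_vector.span_base) simp
        then show False using calculation by simp
      qed
      moreover have "complex_vector.independent (B \<union> D)" "B \<inter> D = {}" using insert by auto
      ultimately show ?case
        using complex_vector.independent_insertI[of a "B \<union> D"] by simp
    qed (use B(2) in simp)
  qed
  from this[of C] have ind: "complex_vector.independent (B \<union> C)" "B \<inter> C = {}" by auto
  have span: "complex_vector.span (B \<union> C) = sum_space U W"
    unfolding complex_vector.span_Un B(3) C(3) sum_space_def ..
  show "finite_dim (sum_space U W)"
    unfolding finite_dim_def using span B(1) C(1) by (intro exI[of _ "B \<union> C"]) simp
  show "complex_vector.dim (sum_space U W) = complex_vector.dim U + complex_vector.dim W"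
    using complex_vector.dim_span_eq_card_independent[OF ind(1)] B C ind(2)
    by (simp add: span card_Un_disjoint)
qed


section \<open>Spectral gaps and the stability of windows\<close>

definition gap_on :: "'a::real_normed_vector set \<Rightarrow> ('a \<Rightarrow>\<^sub>L 'a) \<Rightarrow> real \<Rightarrow> real \<Rightarrow> bool"
  where "gap_on V T c e \<longleftrightarrow> (\<forall>x\<in>V. e * norm x \<le> norm (T x - c *\<^sub>R x))"

lemma gap_on_mono: "gap_on V T c e \<Longrightarrow> e' \<le> e \<Longrightarrow> gap_on V T c e'"
  unfolding gap_on_def by (meson mult_right_mono norm_ge_zero order_trans)

lemma gap_on_perturb:
  assumes "gap_on V T c e"
  shows "gap_on V T' c (e - norm (T' - T))"
  unfolding gap_on_def
proof
  fix x assume "x \<in> V"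
  have "norm (T x - c *\<^sub>R x) = norm ((T' x - c *\<^sub>R x) - (T' - T) x)"
    by (simp add: blinfun.diff_left)
  also have "\<dots> \<le> norm (T' x - c *\<^sub>R x) + norm (T' - T) * norm x"
    by (intro norm_triangle_le_diff add_mono norm_blinfun order_refl)
  finally show "(e - norm (T' - T)) * norm x \<le> norm (T' x - c *\<^sub>R x)"
    using assms \<open>x \<in> V\<close> by (force simp: gap_on_def left_diff_distrib)
qed

context reduced_operator
begin

lemma subspace_window: "complex_vector.subspace (window T c d ` V)"
proof -
  interpret f: module_hom scaleC scaleC "window T c d"
    using complex_linear_window by unfold_locales (auto simp: blinfun.add_right complex_linear_def)
  show ?thesis using V_subspace by (rule f.subspace_image)
qed

lemma in_window_iff:
  assumes "c \<le> d"
  shows "x \<in> window T c d ` V \<longleftrightarrow> x \<in> V \<and> window T c d x = x"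
  using window_idem[OF T_symmetric assms] window_in by (metis image_iff)

lemma gap_below:
  assumes gap: "gap_on V T c e" and "x \<in> V" "0 \<le> h" "h < e" "c - h \<le> l" "l \<le> c + h"
  shows "below T l x = below T c x" "strictly_below T l x = below T c x"
proof -
  have g: "e * norm y \<le> norm (T y - c *\<^sub>R y)" if "y \<in> V" for y
    using gap that by (simp add: gap_on_def)
  show "below T l x = below T c x" "strictly_below T l x = below T c x"
    using gap_below_const[OF T_symmetric g window_in assms(2-6)] by auto
qed

lemma not_in_spectrum_gap:
  assumes T': "\<And>x. x \<in> V \<Longrightarrow> T' x = T x" and "of_real c \<notin> spectrum_on V T'"
  obtains e where "0 < e" "gap_on V T c e"
proof -
  obtain S where S: "bounded_op_on V S" "\<And>x. x \<in> V \<Longrightarrow> S (T' x - of_real c *\<^sub>C x) = x"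
    using assms(2) unfolding spectrum_on_def by auto
  obtain K where K: "\<And>x. x \<in> V \<Longrightarrow> norm (S x) \<le> K * norm x"
    using S(1) unfolding bounded_op_on_def by blast
  \<comment> \<open>The bound \<open>K\<close> may be zero or negative if \<open>V\<close> is trivial.\<close>
  define e where "e = 1 / (\<bar>K\<bar> + 1)"
  have "e * norm x \<le> norm (T x - c *\<^sub>R x)" if x: "x \<in> V" for x
  proof -
    have "T x - c *\<^sub>R x \<in> V"
      using x T_invariant V_real_subspace by (auto intro: subspace_diff subspace_scale)
    moreover have "S (T x - c *\<^sub>R x) = x" using S(2)[OF x] by (simp add: T' x scaleC_of_real)
    ultimately have "norm x \<le> K * norm (T x - c *\<^sub>R x)" using K by metis
    also have "\<dots> \<le> (\<bar>K\<bar> + 1) * norm (T x - c *\<^sub>R x)" by (intro mult_right_mono) auto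
    finally show ?thesis by (simp add: e_def divide_le_eq add_pos_nonneg mult.commute)
  qed
  then show ?thesis by (intro that[of e]) (auto simp: e_def gap_on_def)
qed

text \<open>Bounded below, \<open>T - c\<close> has complete range on \<open>V\<close>; a vector orthogonal to the range is in the
  kernel because the operator is symmetric.\<close>

lemma gap_not_in_spectrum:
  assumes T': "\<And>x. x \<in> V \<Longrightarrow> T' x = T x" and e: "0 < e" and gap: "gap_on V T c e"
  shows "of_real c \<notin> spectrum_on V T'"
proof -
  define N where "N = T - c *\<^sub>R id_blinfun"
  have N_apply: "N x = T x - c *\<^sub>R x" for x by (simp add: N_def blinfun.diff_left blinfun.scaleR_left)
  have N_le: "e * norm x \<le> norm (N x)" if "x \<in> V" for x
    using gap that by (simp add: gap_on_def N_apply)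
  have N_in: "N x \<in> V" if "x \<in> V" for x
    using that T_invariant V_real_subspace by (auto simp: N_apply intro: subspace_diff subspace_scale)
  have N_sym: "symmetric_op N" unfolding N_def by (rule symmetric_op_diff_id[OF T_symmetric])
  have N_inj: "x = y" if "x \<in> V" "y \<in> V" "N x = N y" for x y
  proof -
    have "x - y \<in> V" using that V_real_subspace by (auto intro: subspace_diff)
    from N_le[OF this] have "e * norm (x - y) \<le> 0" using that by (simp add: blinfun.diff_right)
    then have "norm (x - y) \<le> 0" using e by (simp add: mult_le_0_iff)
    then show ?thesis by simp
  qed
  have "complete V" using V_closed by (simp add: complete_eq_closed)
  then have "complete (N ` V)"
    using e V_real_subspace blinfun.bounded_linear_right N_le
    by (intro complete_isometric_image[where e = e]) auto
  then have M: "closed (N ` V)" "subspace (N ` V)"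
    using linear_subspace_image[OF bounded_linear.linear[OF blinfun.bounded_linear_right[of N]] V_real_subspace]
    by (auto intro: complete_imp_closed)
  have surj: "y \<in> N ` V" if y: "y \<in> V" for y
  proof -
    define p where "p = proj_onto (N ` V) y"
    have p: "p \<in> N ` V" unfolding p_def by (rule proj_onto_in[OF M])
    then have "p \<in> V" using N_in by auto
    then have w: "y - p \<in> V" using y V_real_subspace by (auto intro: subspace_diff)
    have "N (y - p) \<bullet> N (y - p) = (y - p) \<bullet> N (N (y - p))"
      by (rule symmetric_opD[OF N_sym])
    also have "\<dots> = 0" unfolding p_def using N_in w by (intro proj_onto_orthogonal[OF M]) (simp add: p_def)
    finally have "N (y - p) = N 0" by (simp add: blinfun.zero_right)
    then have "y - p = 0" using w V_real_subspace by - (rule N_inj, auto intro: subspace_0)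
    then show ?thesis using p by simp
  qed
  define S where "S = inv_into V N"
  have NS: "N (S y) = y" and S_in: "S y \<in> V" if "y \<in> V" for y
    using surj[OF that] by (auto simp: S_def f_inv_into_f inv_into_into)
  have SN: "S (N x) = x" if "x \<in> V" for x
    using N_inj[of "S (N x)" x] NS[OF N_in[OF that]] S_in[OF N_in[OF that]] that by simp
  have N_complex: "N (z *\<^sub>C x) = z *\<^sub>C N x" for z x
  proof -
    have "complex_linear N"
      unfolding N_def complex_linear_iff
      using T_complex[unfolded complex_linear_iff] by (rule commutes_diff_id)
    then show ?thesis by (simp add: complex_linear_def)
  qed
  have "bounded_op_on V S"
    unfolding bounded_op_on_def
  proof (intro conjI ballI allI)
    show "S (x + y) = S x + S y" if "x \<in> V" "y \<in> V" for x y
      using that V_real_subspace S_in NS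
      by - (rule N_inj, auto intro: subspace_add simp: blinfun.add_right)
    show "S (z *\<^sub>C x) = z *\<^sub>C S x" if "x \<in> V" for z x
      using that complex_vector.subspace_scale[OF V_subspace] S_in NS
      by - (rule N_inj, auto simp: N_complex)
    show "\<exists>K. \<forall>x\<in>V. norm (S x) \<le> K * norm x"
      using N_le[OF S_in] NS e by (intro exI[of _ "1 / e"]) (auto simp: field_simps)
  qed (rule S_in)
  moreover have "S (T' x - of_real c *\<^sub>C x) = x \<and> T' (S x) - of_real c *\<^sub>C S x = x" if "x \<in> V" for x
    using SN[OF that] NS[OF that] S_in[OF that] that by (simp add: T' scaleC_of_real N_apply)
  ultimately show ?thesis unfolding spectrum_on_def by blast
qed

end

text \<open>With a gap of width \<open>e\<close> at both ends, the window is the same as the slightly narrower and the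
  slightly wider one, so that \<open>T\<close> minus the midpoint is definitely smaller than half the length on
  the window and definitely larger off it.  A perturbation of norm below \<open>e\<close> cannot take a nonzero
  vector from the one side to the other.\<close>

lemma window_dim_stable:
  assumes T: "reduced_operator V T" and T': "reduced_operator V T'"
    and gap: "gap_on V T c e" "gap_on V T d e" and e: "0 < e" "e \<le> (d - c) / 2"
    and close: "norm (T' - T) < e" and fin: "finite_dim (window T c d ` V)"
  shows "finite_dim (window T' c d ` V)"
    "complex_vector.dim (window T' c d ` V) = complex_vector.dim (window T c d ` V)"
proof -
  interpret T: reduced_operator V T by fact
  interpret T': reduced_operator V T' by fact
  have cd: "c \<le> d" using e by simp
  define m r where "m = (c + d) / 2" and "r = (d - c) / 2"
  define \<delta> where "\<delta> = norm (T' - T)"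
  \<comment> \<open>Strictly between the size of the perturbation and the width of the gap.\<close>
  define h where "h = (\<delta> + e) / 2"
  have \<delta>: "0 \<le> \<delta>" by (simp add: \<delta>_def)
  have h: "\<delta> < h" "h < e" "0 \<le> h" using close \<delta> e(1) by (auto simp: h_def \<delta>_def)
  have diff: "norm (T' x - T x) \<le> \<delta> * norm x" for x
    using norm_blinfun[of "T' - T" x] by (simp add: \<delta>_def blinfun.diff_left)
  have wide: "window T (c - h) (d + h) x = window T c d x"
    and narrow: "window T (c + h) (d - h) x = window T c d x" if x: "x \<in> V" for x
  proof -
    have "strictly_below T l x = below T c x" if "l \<in> {c - h, c, c + h}" for l
      using that h(3) by (intro T.gap_below(2)[OF gap(1) x h(3,2)]) auto
    moreover have "below T l x = below T d x" if "l \<in> {d - h, d + h}" for l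
      using that h(3) by (intro T.gap_below(1)[OF gap(2) x h(3,2)]) auto
    ultimately show "window T (c - h) (d + h) x = window T c d x"
      "window T (c + h) (d - h) x = window T c d x"
      by (simp_all add: window_apply[OF T.T_symmetric])
  qed
  have off: "(r + h) * norm x \<le> norm (T x - m *\<^sub>R x)" if "x \<in> V" "window T c d x = 0" for x
    using norm_shift_ge_off_window[OF T.T_symmetric, of "c - h" "d + h" x] wide[of x] that cd h(3)
    by (simp add: m_def r_def field_simps)
  have on: "norm (T x - m *\<^sub>R x) \<le> (r - h) * norm x" if "x \<in> V" "window T c d x = x" for x
    using norm_shift_le_on_window[OF T.T_symmetric, of "c + h" "d - h" x] narrow[of x] that e h(2)
    by (simp add: m_def r_def field_simps)
  have off': "r * norm x \<le> norm (T' x - m *\<^sub>R x)" if "window T' c d x = 0" for x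
    using norm_shift_ge_off_window[OF T'.T_symmetric cd that] by (simp add: m_def r_def)
  have on': "norm (T' x - m *\<^sub>R x) \<le> r * norm x" if "window T' c d x = x" for x
    using norm_shift_le_on_window[OF T'.T_symmetric cd that] by (simp add: m_def r_def)
  have zero: "x = 0" if "(h - \<delta>) * norm x \<le> 0" for x :: 'a
  proof -
    have "norm x \<le> 0" using that h(1) by (simp add: mult_le_0_iff)
    then show ?thesis by simp
  qed
  have inj: "x = 0" if "x \<in> window T' c d ` V" "window T c d x = 0" for x
  proof (rule zero)
    have x: "x \<in> V" "window T' c d x = x" using that T'.in_window_iff[OF cd] by auto
    have "norm (T x - m *\<^sub>R x) \<le> norm (T' x - m *\<^sub>R x) + norm (T' x - T x)"
      using norm_triangle_ineq4[of "T' x - m *\<^sub>R x" "T' x - T x"] by simp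
    then show "(h - \<delta>) * norm x \<le> 0"
      using off[OF x(1) that(2)] on'[OF x(2)] diff[of x] by (simp add: algebra_simps)
  qed
  have inj': "x = 0" if "x \<in> window T c d ` V" "window T' c d x = 0" for x
  proof (rule zero)
    have x: "x \<in> V" "window T c d x = x" using that T.in_window_iff[OF cd] by auto
    have "norm (T' x - m *\<^sub>R x) \<le> norm (T x - m *\<^sub>R x) + norm (T' x - T x)"
      using norm_triangle_ineq[of "T x - m *\<^sub>R x" "T' x - T x"] by simp
    then show "(h - \<delta>) * norm x \<le> 0"
      using on[OF x] off'[OF that(2)] diff[of x] by (simp add: algebra_simps)
  qed
  have sub: "window T' c d ` V \<subseteq> V" "window T c d ` V \<subseteq> V"
    using T'.window_in T.window_in by auto
  have 1: "finite_dim (window T' c d ` V)"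
    "complex_vector.dim (window T' c d ` V) \<le> complex_vector.dim (window T c d ` V)"
    using sub inj
    by (auto intro!: dim_le_of_injective[OF T.complex_linear_window T'.subspace_window fin])
  have 2: "complex_vector.dim (window T c d ` V) \<le> complex_vector.dim (window T' c d ` V)"
    using sub inj'
    by (auto intro!: dim_le_of_injective(2)[OF T'.complex_linear_window T.subspace_window 1(1)])
  show "finite_dim (window T' c d ` V)"
    "complex_vector.dim (window T' c d ` V) = complex_vector.dim (window T c d ` V)"
    using 1 2 by auto
qed

context reduced_operator
begin

lemma window_fixed_mono:
  assumes "window T c d x = x" "c' \<le> c" "c \<le> d" "d \<le> d'"
  shows "window T c' d' x = x"
proof -
  have x: "below T d x = x" "strictly_below T c x = 0"
    using assms by (auto simp: window_fixed_iff[OF T_symmetric])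
  have "strictly_below T c' x = 0"
  proof (cases "c' = c")
    case False
    then have "below T c' x = below T c' (strictly_below T c x)"
      using assms(2) strictly_below_below(2)[OF T_symmetric, of c' c x] by simp
    then show ?thesis
      using below_strictly_below(2)[OF T_symmetric, of c' c' x] by (simp add: x blinfun.zero_right)
  qed (use x in simp)
  moreover have "below T d' x = x"
    using below_below(1)[OF T_symmetric assms(4), of x] x by simp
  ultimately show ?thesis using assms by (subst window_fixed_iff[OF T_symmetric]) auto
qed

lemma window_image_mono:
  "c' \<le> c \<Longrightarrow> c \<le> d \<Longrightarrow> d \<le> d' \<Longrightarrow> window T c d ` V \<subseteq> window T c' d' ` V"
proof
  fix x assume "c' \<le> c" "c \<le> d" "d \<le> d'" "x \<in> window T c d ` V"
  then show "x \<in> window T c' d' ` V"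
    using in_window_iff[of c d x] in_window_iff[of c' d' x] window_fixed_mono[of c d x c' d'] by simp
qed

lemma finite_dim_window_mono:
  "finite_dim (window T c' d' ` V) \<Longrightarrow> c' \<le> c \<Longrightarrow> c \<le> d \<Longrightarrow> d \<le> d' \<Longrightarrow> finite_dim (window T c d ` V)"
  by (rule finite_dim_subset[OF _ subspace_window window_image_mono])

text \<open>A window splits at a gap.\<close>

lemma dim_window_split:
  assumes ab: "c \<le> a" "a \<le> b" and e: "0 < e" and gap: "gap_on V T a e"
    and fin: "finite_dim (window T c b ` V)"
  shows "complex_vector.dim (window T c b ` V) =
    complex_vector.dim (window T c a ` V) + complex_vector.dim (window T a b ` V)"
proof -
  have sa: "strictly_below T a x = below T a x" if "x \<in> V" for x
    using gap_below(2)[OF gap that order_refl e, of a] by simp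
  have "window T c b ` V = sum_space (window T c a ` V) (window T a b ` V)"
  proof (intro equalityI subsetI)
    fix y assume "y \<in> window T c b ` V"
    then obtain x where x: "x \<in> V" "y = window T c b x" by auto
    then have "y = window T c a x + window T a b x"
      by (simp add: window_apply[OF T_symmetric] sa)
    then show "y \<in> sum_space (window T c a ` V) (window T a b ` V)"
      using x by (auto simp: sum_space_def)
  next
    fix y assume "y \<in> sum_space (window T c a ` V) (window T a b ` V)"
    then obtain u v where y: "y = u + v" "u \<in> window T c a ` V" "v \<in> window T a b ` V"
      by (auto simp: sum_space_def)
    have "u \<in> window T c b ` V" "v \<in> window T c b ` V"
      using y window_image_mono[of c c a b] window_image_mono[of c a b b] ab by auto
    then show "y \<in> window T c b ` V"
      using y complex_vector.subspace_add[OF subspace_window] by blast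
  qed
  moreover have "x = 0" if "x \<in> window T c a ` V" "x \<in> window T a b ` V" for x
  proof -
    have "x \<in> V" "below T a x = x" "strictly_below T a x = 0"
      using that ab by (auto simp: in_window_iff window_fixed_iff[OF T_symmetric])
    then show ?thesis using sa[of x] by simp
  qed
  moreover have "finite_dim (window T c a ` V)" "finite_dim (window T a b ` V)"
    using fin ab by (auto intro: finite_dim_window_mono)
  ultimately show ?thesis by (simp add: dim_direct_sum)
qed

end

section \<open>The spectral flow of a path on a reducing subspace\<close>

locale reduced_path =
  fixes V :: "'a::complex_hilbert set" and A :: "real \<Rightarrow> 'a \<Rightarrow>\<^sub>L 'a" and a b :: real
  assumes ab: "a < b" and cont: "continuous_on {a..b} A"
    and reduced: "\<And>s. s \<in> {a..b} \<Longrightarrow> reduced_operator V (A s)"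
begin

definition gapped :: "real \<Rightarrow> real \<Rightarrow> bool"
  where "gapped s c \<longleftrightarrow> (\<exists>e>0. gap_on V (A s) c e)"

abbreviation window_at :: "real \<Rightarrow> real \<Rightarrow> real \<Rightarrow> 'a set"
  where "window_at s c d \<equiv> window (A s) c d ` V"

abbreviation window_dim :: "real \<Rightarrow> real \<Rightarrow> real \<Rightarrow> nat"
  where "window_dim s c d \<equiv> complex_vector.dim (window_at s c d)"

text \<open>The condition that a partition of a path imposes on the width \<open>\<alpha>\<close> at each single time \<open>s\<close>.\<close>

definition admissible :: "real \<Rightarrow> real \<Rightarrow> bool"
  where "admissible s \<alpha> \<longleftrightarrow>
    0 < \<alpha> \<and> gapped s \<alpha> \<and> gapped s (- \<alpha>) \<and> finite_dim (window_at s (- \<alpha>) \<alpha>)"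

lemma restricted_subspace_eq:
  "s \<in> {a..b} \<Longrightarrow> spectral_subspace V (restrict (A s) V) c d = window_at s c d"
  by (rule reduced_operator.spectral_subspace_eq[OF reduced]) auto

lemma gapped_iff:
  assumes s: "s \<in> {a..b}"
  shows "gapped s c \<longleftrightarrow> of_real c \<notin> spectrum_on V (restrict (A s) V)"
proof
  assume "gapped s c"
  then obtain e where "0 < e" "gap_on V (A s) c e" by (auto simp: gapped_def)
  then show "of_real c \<notin> spectrum_on V (restrict (A s) V)"
    by (intro reduced_operator.gap_not_in_spectrum[OF reduced[OF s]]) auto
next
  assume *: "of_real c \<notin> spectrum_on V (restrict (A s) V)"
  obtain e where "0 < e" "gap_on V (A s) c e"
    by (rule reduced_operator.not_in_spectrum_gap[OF reduced[OF s] _ *]) auto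
  then show "gapped s c" by (auto simp: gapped_def)
qed

lemma window_locally_stable:
  assumes s: "s \<in> {a..b}" and "c < d" and gaps: "gapped s c" "gapped s d"
    and fin: "finite_dim (window_at s c d)"
  shows "\<exists>\<eta>>0. \<forall>u\<in>{a..b}. dist u s < \<eta> \<longrightarrow>
    gapped u c \<and> gapped u d \<and> finite_dim (window_at u c d) \<and> window_dim u c d = window_dim s c d"
proof -
  obtain e1 e2 where e12: "0 < e1" "gap_on V (A s) c e1" "0 < e2" "gap_on V (A s) d e2"
    using gaps by (auto simp: gapped_def)
  \<comment> \<open>The gaps at \<open>c\<close> and at \<open>d\<close> must not overlap.\<close>
  define e where "e = min (min e1 e2) ((d - c) / 2)"
  have e: "0 < e" "e \<le> (d - c) / 2" "gap_on V (A s) c e" "gap_on V (A s) d e"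
  proof -
    have "e \<le> e1" "e \<le> e2" by (auto simp: e_def)
    then show "gap_on V (A s) c e" "gap_on V (A s) d e"
      using gap_on_mono e12(2,4) by blast+
    show "e \<le> (d - c) / 2" unfolding e_def by (rule min.cobounded2)
  qed (use e12 \<open>c < d\<close> in \<open>simp add: e_def\<close>)
  obtain \<eta> where \<eta>: "0 < \<eta>" "\<And>u. u \<in> {a..b} \<Longrightarrow> dist u s < \<eta> \<Longrightarrow> dist (A u) (A s) < e"
    using cont s e(1) unfolding continuous_on_iff by metis
  have "gapped u c \<and> gapped u d \<and> finite_dim (window_at u c d) \<and> window_dim u c d = window_dim s c d"
    if u: "u \<in> {a..b}" "dist u s < \<eta>" for u
  proof -
    have close: "norm (A u - A s) < e" using \<eta>(2)[OF u] by (simp add: dist_norm)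
    have "gapped u c" "gapped u d"
      unfolding gapped_def using close gap_on_perturb[OF e(3)] gap_on_perturb[OF e(4)]
      by (auto intro!: exI[of _ "e - norm (A u - A s)"])
    then show ?thesis
      using window_dim_stable[OF reduced[OF s] reduced[OF u(1)] e(3,4,1,2) close fin] by simp
  qed
  then show ?thesis using \<eta>(1) by blast
qed

lemma window_dim_constant:
  assumes uv: "a \<le> u" "u \<le> v" "v \<le> b" and "c < d"
    and ok: "\<And>s. s \<in> {u..v} \<Longrightarrow> gapped s c \<and> gapped s d \<and> finite_dim (window_at s c d)"
  shows "window_dim u c d = window_dim v c d"
proof -
  have "(\<lambda>s. window_dim s c d) constant_on {u..v}"
  proof (rule locally_constant_imp_constant)
    fix s assume s: "s \<in> {u..v}"
    then have "s \<in> {a..b}" using uv by auto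
    then obtain \<eta> where \<eta>: "0 < \<eta>"
      "\<And>w. w \<in> {a..b} \<Longrightarrow> dist w s < \<eta> \<Longrightarrow> window_dim w c d = window_dim s c d"
      using window_locally_stable[of s c d] ok[OF s] \<open>c < d\<close> by blast
    show "\<exists>T. openin (top_of_set {u..v}) T \<and> s \<in> T \<and> (\<forall>x\<in>T. window_dim x c d = window_dim s c d)"
    proof (intro exI conjI ballI)
      show "openin (top_of_set {u..v}) ({u..v} \<inter> ball s \<eta>)" by blast
      show "s \<in> {u..v} \<inter> ball s \<eta>" using s \<eta>(1) by simp
      show "window_dim x c d = window_dim s c d" if "x \<in> {u..v} \<inter> ball s \<eta>" for x
        using that uv by (intro \<eta>(2)) (auto simp: dist_commute)
    qed
  qed simp
  then obtain k where "\<And>s. s \<in> {u..v} \<Longrightarrow> window_dim s c d = k" by (auto simp: constant_on_def)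
  then show ?thesis using uv by simp
qed

text \<open>Two admissible widths \<open>\<alpha> < \<beta>\<close> give the same change of dimension, because the window
  \<open>[\<alpha>, \<beta>]\<close> that separates them is bounded by gaps.\<close>

lemma increment_independent_of_width:
  assumes uv: "a \<le> u" "u \<le> v" "v \<le> b"
    and ok: "\<And>s. s \<in> {u..v} \<Longrightarrow> admissible s \<alpha> \<and> admissible s \<beta>"
  shows "int (window_dim v 0 \<alpha>) - int (window_dim u 0 \<alpha>) =
    int (window_dim v 0 \<beta>) - int (window_dim u 0 \<beta>)"
proof -
  have *: "int (window_dim v 0 \<alpha>) - int (window_dim u 0 \<alpha>) =
      int (window_dim v 0 \<beta>) - int (window_dim u 0 \<beta>)"
    if "\<alpha> < \<beta>" and ok: "\<And>s. s \<in> {u..v} \<Longrightarrow> admissible s \<alpha> \<and> admissible s \<beta>" for \<alpha> \<beta>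
  proof -
    have pos: "0 < \<alpha>" using ok[of u] uv by (simp add: admissible_def)
    have fin: "finite_dim (window_at s c d)" if "s \<in> {u..v}" "- \<beta> \<le> c" "c \<le> d" "d \<le> \<beta>" for s c d
    proof -
      have "reduced_operator V (A s)" using that(1) uv by (intro reduced) auto
      moreover have "finite_dim (window_at s (- \<beta>) \<beta>)" using ok[OF that(1)] by (simp add: admissible_def)
      ultimately show ?thesis
        using that(2-4) by (rule reduced_operator.finite_dim_window_mono)
    qed
    have split: "window_dim s 0 \<beta> = window_dim s 0 \<alpha> + window_dim s \<alpha> \<beta>" if s: "s \<in> {u..v}" for s
    proof -
      obtain e where "0 < e" "gap_on V (A s) \<alpha> e"
        using ok[OF s] by (auto simp: admissible_def gapped_def)
      moreover have "reduced_operator V (A s)" using s uv by (intro reduced) auto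
      moreover have "finite_dim (window_at s 0 \<beta>)" using pos \<open>\<alpha> < \<beta>\<close> by (intro fin s) auto
      ultimately show ?thesis
        using pos \<open>\<alpha> < \<beta>\<close> by (intro reduced_operator.dim_window_split[of V "A s" 0 \<alpha> \<beta> e]) auto
    qed
    have "window_dim u \<alpha> \<beta> = window_dim v \<alpha> \<beta>"
    proof (rule window_dim_constant[OF uv \<open>\<alpha> < \<beta>\<close>])
      fix s assume s: "s \<in> {u..v}"
      show "gapped s \<alpha> \<and> gapped s \<beta> \<and> finite_dim (window_at s \<alpha> \<beta>)"
        using ok[OF s] fin[OF s, of \<alpha> \<beta>] pos \<open>\<alpha> < \<beta>\<close> by (simp add: admissible_def)
    qed
    then show ?thesis using split[of u] split[of v] uv by simp
  qed
  show ?thesis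
    using *[of \<alpha> \<beta>] *[of \<beta> \<alpha>] ok by (cases \<alpha> \<beta> rule: linorder_cases) auto
qed

abbreviation restricted :: "real \<Rightarrow> 'a \<Rightarrow> 'a"
  where "restricted s \<equiv> restrict (A s) V"

definition admissible_partition :: "nat \<Rightarrow> (nat \<Rightarrow> real) \<Rightarrow> (nat \<Rightarrow> real) \<Rightarrow> bool"
  where "admissible_partition N t \<alpha> \<longleftrightarrow>
    t 0 = a \<and> t N = b \<and> (\<forall>i\<in>{1..N}. t (i - 1) < t i) \<and>
    (\<forall>i\<in>{1..N}. \<forall>s\<in>{t (i - 1)..t i}. admissible s (\<alpha> i))"

lemma increasing_knots_le:
  fixes t :: "nat \<Rightarrow> real"
  assumes "\<forall>i\<in>{1..N}. t (i - 1) < t i" "i \<le> j" "j \<le> N"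
  shows "t i \<le> t j"
  using assms(2,3)
proof (induction j rule: dec_induct)
  case (step j)
  then show ?case using assms(1)[rule_format, of "Suc j"] by simp
qed simp

text \<open>The constancy of the dimension on each piece is automatic, by stability.\<close>

lemma sf_partition_iff: "sf_partition V restricted a b N t \<alpha> \<longleftrightarrow> admissible_partition N t \<alpha>"
proof -
  have "(\<alpha> i > 0 \<and>
      (\<forall>s\<in>{t (i - 1)..t i}.
        of_real (\<alpha> i) \<notin> spectrum_on V (restricted s) \<and> of_real (- \<alpha> i) \<notin> spectrum_on V (restricted s) \<and>
        finite_dim (spectral_subspace V (restricted s) (- \<alpha> i) (\<alpha> i))) \<and>
      (\<exists>m. \<forall>s\<in>{t (i - 1)..t i}.
        complex_vector.dim (spectral_subspace V (restricted s) (- \<alpha> i) (\<alpha> i)) = m)) \<longleftrightarrow>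
     (\<forall>s\<in>{t (i - 1)..t i}. admissible s (\<alpha> i))" (is "?L \<longleftrightarrow> ?R")
    if t: "t 0 = a" "t N = b" "\<forall>i\<in>{1..N}. t (i - 1) < t i" and i: "i \<in> {1..N}" for i
  proof -
    have lt: "t (i - 1) < t i" using t(3) i by blast
    have ends: "a \<le> t (i - 1)" "t i \<le> b"
      using increasing_knots_le[OF t(3), of 0 "i - 1"] increasing_knots_le[OF t(3), of i N] i t(1,2)
      by auto
    have sub: "s \<in> {a..b}" if "s \<in> {t (i - 1)..t i}" for s using that ends by auto
    show ?thesis
    proof
      assume ?L
      then show ?R
        using sub by (auto simp: admissible_def gapped_iff restricted_subspace_eq)
    next
      assume R: ?R
      have pos: "0 < \<alpha> i" using R[rule_format, of "t i"] lt by (simp add: admissible_def)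
      have "window_dim s (- \<alpha> i) (\<alpha> i) = window_dim (t (i - 1)) (- \<alpha> i) (\<alpha> i)"
        if s: "s \<in> {t (i - 1)..t i}" for s
        using R ends s pos
        by (intro window_dim_constant[symmetric]) (auto simp: admissible_def)
      then have "\<exists>m. \<forall>s\<in>{t (i - 1)..t i}.
          complex_vector.dim (spectral_subspace V (restricted s) (- \<alpha> i) (\<alpha> i)) = m"
        using sub by (intro exI[of _ "window_dim (t (i - 1)) (- \<alpha> i) (\<alpha> i)"] ballI)
          (simp only: restricted_subspace_eq)
      then show ?L
        using R sub pos by (auto simp: admissible_def gapped_iff restricted_subspace_eq)
    qed
  qed
  then show ?thesis
    unfolding sf_partition_def admissible_partition_def by blast
qed

lemma admissible_partition_ends:
  assumes p: "admissible_partition N t \<alpha>" and i: "i \<le> N"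
  shows "a \<le> t i" "t i \<le> b"
proof -
  have t: "t 0 = a" "t N = b" "\<forall>i\<in>{1..N}. t (i - 1) < t i"
    using p by (auto simp: admissible_partition_def)
  show "a \<le> t i" "t i \<le> b"
    using increasing_knots_le[OF t(3), of 0 i] increasing_knots_le[OF t(3), of i N] i t(1,2) by auto
qed

lemma admissible_partition_cover:
  assumes p: "admissible_partition N t \<alpha>" and s: "s \<in> {a..b}"
  shows "\<exists>i\<in>{1..N}. s \<in> {t (i - 1)..t i}"
proof -
  have t: "t 0 = a" "t N = b" using p by (auto simp: admissible_partition_def)
  have N: "0 < N" using t ab by (cases N) auto
  show ?thesis
  proof (cases "s = a")
    case True
    then show ?thesis
      using t(1) N admissible_partition_ends(1)[OF p, of 1] by (intro bexI[of _ 1]) auto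
  next
    case False
    define i where "i = (LEAST i. s \<le> t i)"
    have "s \<le> t N" using s t by simp
    then have i: "s \<le> t i" "i \<le> N" unfolding i_def by (auto intro: LeastI Least_le)
    have "i \<noteq> 0" using i(1) t(1) s False by (cases "i = 0") auto
    then have "\<not> s \<le> t (i - 1)" unfolding i_def by (intro not_less_Least) simp
    then show ?thesis using i \<open>i \<noteq> 0\<close> by (intro bexI[of _ i]) auto
  qed
qed

text \<open>Only finitely many pieces avoid a given point, and they are closed.\<close>

lemma admissible_partition_local:
  assumes p: "admissible_partition N t \<alpha>"
  shows "\<exists>\<delta>>0. \<forall>s\<in>{a..b}. dist s x < \<delta> \<longrightarrow>
    (\<exists>i\<in>{1..N}. x \<in> {t (i - 1)..t i} \<and> s \<in> {t (i - 1)..t i})"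
proof -
  define U where "U = (\<Union>i\<in>{i\<in>{1..N}. x \<notin> {t (i - 1)..t i}}. {t (i - 1)..t i})"
  have "closed U" unfolding U_def by (intro closed_UN) auto
  moreover have "x \<notin> U" by (auto simp: U_def)
  ultimately obtain \<delta> where \<delta>: "0 < \<delta>" "ball x \<delta> \<subseteq> - U"
    using open_contains_ball_eq[of "- U"] by (auto simp: open_Compl)
  have "\<exists>i\<in>{1..N}. x \<in> {t (i - 1)..t i} \<and> s \<in> {t (i - 1)..t i}" if s: "s \<in> {a..b}" "dist s x < \<delta>" for s
  proof -
    obtain i where i: "i \<in> {1..N}" "s \<in> {t (i - 1)..t i}"
      using admissible_partition_cover[OF p s(1)] by blast
    have "s \<notin> U" using \<delta>(2) s(2) by (metis ComplD dist_commute mem_ball subsetD)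
    then have "x \<in> {t (i - 1)..t i}" using i unfolding U_def by blast
    then show ?thesis using i by blast
  qed
  then show ?thesis using \<delta>(1) by blast
qed

definition partition_flow :: "nat \<Rightarrow> (nat \<Rightarrow> real) \<Rightarrow> (nat \<Rightarrow> real) \<Rightarrow> int"
  where "partition_flow N t \<alpha> =
    (\<Sum>i=1..N. int (window_dim (t i) 0 (\<alpha> i)) - int (window_dim (t (i - 1)) 0 (\<alpha> i)))"

text \<open>The flow of the path restricted to \<open>[a, s]\<close>: in each summand the time is clamped to the piece.\<close>

definition flow_upto :: "nat \<Rightarrow> (nat \<Rightarrow> real) \<Rightarrow> (nat \<Rightarrow> real) \<Rightarrow> real \<Rightarrow> int"
  where "flow_upto N t \<alpha> s =
    (\<Sum>i=1..N. int (window_dim (max (t (i - 1)) (min s (t i))) 0 (\<alpha> i))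
             - int (window_dim (t (i - 1)) 0 (\<alpha> i)))"

lemma flow_upto_ends:
  assumes p: "admissible_partition N t \<alpha>"
  shows "flow_upto N t \<alpha> a = 0" "flow_upto N t \<alpha> b = partition_flow N t \<alpha>"
proof -
  have "max (t (i - 1)) (min a (t i)) = t (i - 1)" "max (t (i - 1)) (min b (t i)) = t i"
    if i: "i \<in> {1..N}" for i
  proof -
    have "t (i - 1) < t i" using p i by (auto simp: admissible_partition_def)
    moreover have "a \<le> t (i - 1)" "t i \<le> b"
      using i admissible_partition_ends[OF p, of "i - 1"] admissible_partition_ends[OF p, of i] by auto
    ultimately show "max (t (i - 1)) (min a (t i)) = t (i - 1)" "max (t (i - 1)) (min b (t i)) = t i"
      by auto
  qed
  then show "flow_upto N t \<alpha> a = 0" "flow_upto N t \<alpha> b = partition_flow N t \<alpha>"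
    by (simp_all add: flow_upto_def partition_flow_def)
qed

lemma flow_upto_increment:
  assumes p: "admissible_partition N t \<alpha>" and j: "j \<in> {1..N}"
    and x: "x \<in> {t (j - 1)..t j}" and s: "s \<in> {t (j - 1)..t j}"
  shows "flow_upto N t \<alpha> s - flow_upto N t \<alpha> x =
    int (window_dim s 0 (\<alpha> j)) - int (window_dim x 0 (\<alpha> j))"
proof -
  have lt: "\<forall>i\<in>{1..N}. t (i - 1) < t i" using p by (simp add: admissible_partition_def)
  let ?D = "\<lambda>i. int (window_dim (max (t (i - 1)) (min s (t i))) 0 (\<alpha> i))
    - int (window_dim (max (t (i - 1)) (min x (t i))) 0 (\<alpha> i))"
  have "flow_upto N t \<alpha> s - flow_upto N t \<alpha> x = (\<Sum>i=1..N. ?D i)"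
    by (simp add: flow_upto_def sum_subtractf[symmetric])
  also have "\<dots> = (\<Sum>i\<in>{j}. ?D i)"
  proof (rule sum.mono_neutral_right)
    show "\<forall>i\<in>{1..N} - {j}. ?D i = 0"
    proof
      fix i assume i: "i \<in> {1..N} - {j}"
      have "t (i - 1) < t i" using lt i by auto
      have "max (t (i - 1)) (min s (t i)) = max (t (i - 1)) (min x (t i))"
      proof (cases "i < j")
        case True
        then have "t i \<le> t (j - 1)" using j by (intro increasing_knots_le[OF lt]) auto
        then show ?thesis using x s by auto
      next
        case False
        then have "t j \<le> t (i - 1)" using i by (intro increasing_knots_le[OF lt]) auto
        then show ?thesis using x s \<open>t (i - 1) < t i\<close> by auto
      qed
      then show "?D i = 0" by simp
    qed
  qed (use j in auto)
  also have "\<dots> = int (window_dim s 0 (\<alpha> j)) - int (window_dim x 0 (\<alpha> j))"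
    using x s by (simp add: max_def min_def)
  finally show ?thesis .
qed

text \<open>Near every time the two partial flows have equal increments, since a common piece of both
  partitions contains the time and its neighbour.  Hence their difference is constant.\<close>

lemma partition_flow_unique:
  assumes p: "admissible_partition N t \<alpha>" and q: "admissible_partition N' t' \<alpha>'"
  shows "partition_flow N t \<alpha> = partition_flow N' t' \<alpha>'"
proof -
  let ?h = "\<lambda>s. flow_upto N t \<alpha> s - flow_upto N' t' \<alpha>' s"
  have "?h constant_on {a..b}"
  proof (rule locally_constant_imp_constant)
    fix x assume x: "x \<in> {a..b}"
    obtain \<delta> where \<delta>: "0 < \<delta>" "\<And>s. s \<in> {a..b} \<Longrightarrow> dist s x < \<delta> \<Longrightarrow>
        \<exists>i\<in>{1..N}. x \<in> {t (i - 1)..t i} \<and> s \<in> {t (i - 1)..t i}"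
      using admissible_partition_local[OF p, of x] by blast
    obtain \<delta>' where \<delta>': "0 < \<delta>'" "\<And>s. s \<in> {a..b} \<Longrightarrow> dist s x < \<delta>' \<Longrightarrow>
        \<exists>i\<in>{1..N'}. x \<in> {t' (i - 1)..t' i} \<and> s \<in> {t' (i - 1)..t' i}"
      using admissible_partition_local[OF q, of x] by blast
    have "?h s = ?h x" if s: "s \<in> {a..b}" "dist s x < min \<delta> \<delta>'" for s
    proof -
      obtain i where i: "i \<in> {1..N}" "x \<in> {t (i - 1)..t i}" "s \<in> {t (i - 1)..t i}"
        using \<delta>(2)[OF s(1)] s(2) by auto
      obtain j where j: "j \<in> {1..N'}" "x \<in> {t' (j - 1)..t' j}" "s \<in> {t' (j - 1)..t' j}"
        using \<delta>'(2)[OF s(1)] s(2) by auto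
      have ok: "admissible r (\<alpha> i) \<and> admissible r (\<alpha>' j)" if "r \<in> {min x s..max x s}" for r
        using that p q i j by (auto simp: admissible_partition_def min_def max_def split: if_splits)
      have "int (window_dim (max x s) 0 (\<alpha> i)) - int (window_dim (min x s) 0 (\<alpha> i)) =
          int (window_dim (max x s) 0 (\<alpha>' j)) - int (window_dim (min x s) 0 (\<alpha>' j))"
        using x s by (intro increment_independent_of_width ok) auto
      then have "int (window_dim s 0 (\<alpha> i)) - int (window_dim x 0 (\<alpha> i)) =
          int (window_dim s 0 (\<alpha>' j)) - int (window_dim x 0 (\<alpha>' j))"
        by (cases "x \<le> s") (simp_all add: max_def min_def)
      then show ?thesis
        using flow_upto_increment[OF p i] flow_upto_increment[OF q j] by simp
    qed
    then have near: "\<forall>s\<in>{a..b} \<inter> ball x (min \<delta> \<delta>'). ?h s = ?h x"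
      by (metis Int_iff dist_commute mem_ball)
    have "openin (top_of_set {a..b}) ({a..b} \<inter> ball x (min \<delta> \<delta>'))" by blast
    moreover have "x \<in> {a..b} \<inter> ball x (min \<delta> \<delta>')" using x \<delta>(1) \<delta>'(1) by simp
    ultimately show "\<exists>T. openin (top_of_set {a..b}) T \<and> x \<in> T \<and> (\<forall>s\<in>T. ?h s = ?h x)"
      using near by blast
  qed simp
  then have "?h a = ?h b" using ab unfolding constant_on_def by (metis atLeastAtMost_iff less_imp_le order_refl)
  then show ?thesis by (simp add: flow_upto_ends[OF p] flow_upto_ends[OF q])
qed

theorem spectral_flow_eq_partition_flow:
  assumes p: "admissible_partition N t \<alpha>"
  shows "spectral_flow V restricted a b = partition_flow N t \<alpha>"
proof -
  have val: "(\<Sum>i=1..N. int (complex_vector.dim (spectral_subspace V (restricted (t i)) 0 (\<alpha> i)))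
      - int (complex_vector.dim (spectral_subspace V (restricted (t (i - 1))) 0 (\<alpha> i)))) = partition_flow N t \<alpha>"
    if p: "admissible_partition N t \<alpha>" for N t \<alpha>
    unfolding partition_flow_def
  proof (rule sum.cong)
    fix i assume i: "i \<in> {1..N}"
    have "t i \<in> {a..b}" "t (i - 1) \<in> {a..b}"
      using i admissible_partition_ends[OF p, of i] admissible_partition_ends[OF p, of "i - 1"] by auto
    then show "int (complex_vector.dim (spectral_subspace V (restricted (t i)) 0 (\<alpha> i)))
      - int (complex_vector.dim (spectral_subspace V (restricted (t (i - 1))) 0 (\<alpha> i))) =
      int (window_dim (t i) 0 (\<alpha> i)) - int (window_dim (t (i - 1)) 0 (\<alpha> i))"
      by (simp add: restricted_subspace_eq)
  qed simp
  have iff: "(\<exists>N t \<alpha>. sf_partition V restricted a b N t \<alpha> \<and>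
      s = (\<Sum>i=1..N. int (complex_vector.dim (spectral_subspace V (restricted (t i)) 0 (\<alpha> i)))
        - int (complex_vector.dim (spectral_subspace V (restricted (t (i - 1))) 0 (\<alpha> i))))) \<longleftrightarrow>
    (\<exists>N t \<alpha>. admissible_partition N t \<alpha> \<and> s = partition_flow N t \<alpha>)" for s
    unfolding sf_partition_iff by (intro ex_cong1 conj_cong refl) (simp only: val)
  show ?thesis
    unfolding spectral_flow_def iff using p partition_flow_unique[OF _ p]
    by (intro the_equality) blast+
qed

text \<open>By stability an admissible width at \<open>s\<close> is admissible near \<open>s\<close>.  A Lebesgue number of the resulting
  cover bounds the mesh of an equidistant partition.\<close>

lemma admissible_partition_exists:
  assumes adm: "\<And>s. s \<in> {a..b} \<Longrightarrow> \<exists>\<alpha>. admissible s \<alpha>"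
  obtains N t \<alpha> where "admissible_partition N t \<alpha>"
proof -
  define good where "good G \<longleftrightarrow> open G \<and> (\<exists>\<alpha>. \<forall>u\<in>G \<inter> {a..b}. admissible u \<alpha>)" for G
  have "\<exists>G. good G \<and> s \<in> G" if s: "s \<in> {a..b}" for s
  proof -
    obtain \<alpha> where \<alpha>: "admissible s \<alpha>" using adm[OF s] by blast
    have "\<exists>\<eta>>0. \<forall>u\<in>{a..b}. dist u s < \<eta> \<longrightarrow>
        gapped u (- \<alpha>) \<and> gapped u \<alpha> \<and> finite_dim (window_at u (- \<alpha>) \<alpha>) \<and>
        window_dim u (- \<alpha>) \<alpha> = window_dim s (- \<alpha>) \<alpha>"
      using \<alpha> by (intro window_locally_stable[OF s]) (auto simp: admissible_def)
    then obtain \<eta> where \<eta>: "0 < \<eta>" "\<And>u. u \<in> {a..b} \<Longrightarrow> dist u s < \<eta> \<Longrightarrow> admissible u \<alpha>"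
      using \<alpha> unfolding admissible_def by blast
    then have "good (ball s \<eta>)"
      unfolding good_def by (auto simp: dist_commute intro!: exI[of _ \<alpha>])
    then show ?thesis using \<eta>(1) by (intro exI[of _ "ball s \<eta>"]) simp
  qed
  then have cover: "{a..b} \<subseteq> \<Union>{G. good G}" by blast
  obtain \<epsilon> where \<epsilon>: "0 < \<epsilon>" "\<And>x. x \<in> {a..b} \<Longrightarrow> \<exists>G\<in>{G. good G}. ball x \<epsilon> \<subseteq> G"
    by (rule Heine_Borel_lemma[OF compact_Icc cover]) (auto simp: good_def)
  have "\<exists>\<alpha>. \<forall>u\<in>ball x \<epsilon> \<inter> {a..b}. admissible u \<alpha>" if "x \<in> {a..b}" for x
    using \<epsilon>(2)[OF that] unfolding good_def by blast
  then obtain w where w: "\<And>x u. x \<in> {a..b} \<Longrightarrow> u \<in> ball x \<epsilon> \<Longrightarrow> u \<in> {a..b} \<Longrightarrow> admissible u (w x)"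
    by (metis IntI)
  obtain N :: nat where N: "(b - a) / \<epsilon> < real N" using reals_Archimedean2 by blast
  then have N0: "0 < N" using ab \<epsilon>(1) by (cases N) (auto simp: divide_less_0_iff)
  define \<tau> where "\<tau> = (b - a) / real N"
  have \<tau>: "0 < \<tau>" "\<tau> < \<epsilon>" "real N * \<tau> = b - a"
    using ab N0 N \<epsilon>(1) by (simp_all add: \<tau>_def field_simps)
  define t where "t i = a + real i * \<tau>" for i
  have t_Suc: "t i = t (i - 1) + \<tau>" if "i \<in> {1..N}" for i
    using that by (cases i) (auto simp: t_def algebra_simps)
  have t_in: "t i \<in> {a..b}" if "i \<le> N" for i
  proof -
    have "real i * \<tau> \<le> real N * \<tau>" using that \<tau>(1) by (intro mult_right_mono) auto
    then show ?thesis using \<tau> by (simp add: t_def)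
  qed
  have "admissible_partition N t (\<lambda>i. w (t (i - 1)))"
    unfolding admissible_partition_def
  proof (intro conjI ballI)
    show "t 0 = a" "t N = b" using \<tau>(3) by (auto simp: t_def)
    show "t (i - 1) < t i" if "i \<in> {1..N}" for i using t_Suc[OF that] \<tau>(1) by simp
    show "admissible s (w (t (i - 1)))" if i: "i \<in> {1..N}" and s: "s \<in> {t (i - 1)..t i}" for i s
    proof (rule w)
      show "t (i - 1) \<in> {a..b}" using t_in[of "i - 1"] i by auto
      show "s \<in> ball (t (i - 1)) \<epsilon>" using s t_Suc[OF i] \<tau>(2) by (simp add: dist_real_def)
      show "s \<in> {a..b}" using s t_in[OF diff_le_self[THEN order_trans], of i 1] t_in[of i] i
        by (auto intro: order_trans)
    qed
  qed
  then show ?thesis by (rule that)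
qed

end

section \<open>Fredholm operators have an isolated zero\<close>

text \<open>The uniform boundedness principle for inner products, by Baire.\<close>

lemma uniform_boundedness_inner:
  fixes Y :: "'a::{real_inner,banach} set"
  assumes pt: "\<And>z. \<exists>K. \<forall>y\<in>Y. \<bar>y \<bullet> z\<bar> \<le> K"
  obtains K where "\<And>y. y \<in> Y \<Longrightarrow> norm y \<le> K"
proof -
  define C where "C k = {z. \<forall>y\<in>Y. \<bar>y \<bullet> z\<bar> \<le> real k}" for k
  have "closed (C k)" for k
  proof -
    have "C k = (\<Inter>y\<in>Y. {z. \<bar>y \<bullet> z\<bar> \<le> real k})" by (auto simp: C_def)
    moreover have "closed {z. \<bar>y \<bullet> z\<bar> \<le> real k}" for y
      by (intro closed_Collect_le continuous_intros)
    ultimately show ?thesis by auto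
  qed
  moreover have "z \<in> \<Union>(range C)" for z
  proof -
    obtain K where K: "\<forall>y\<in>Y. \<bar>y \<bullet> z\<bar> \<le> K" using pt by blast
    obtain k :: nat where "K \<le> real k" using real_arch_simple by blast
    then have "z \<in> C k" using K by (auto simp: C_def)
    then show ?thesis by blast
  qed
  then have union: "\<Union>(range C) = UNIV" by blast
  have "\<exists>k. interior (C k) \<noteq> {}"
  proof (rule ccontr)
    assume "\<not> ?thesis"
    then have "Met_TC.mtopology interior_of \<Union>(range C) = {}"
      using \<open>\<And>k. closed (C k)\<close>
      by (intro Met_TC.metric_Baire_category_alt) (auto simp: complete_UNIV)
    then show False by (simp add: union)
  qed
  then obtain k z0 where "z0 \<in> interior (C k)" by blast
  then obtain r where r: "0 < r" "ball z0 r \<subseteq> C k" by (auto simp: mem_interior)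
  have "norm y \<le> 4 * real k / r" if y: "y \<in> Y" for y
  proof (cases "y = 0")
    case False
    define w where "w = (r / (2 * norm y)) *\<^sub>R y"
    have "norm w = r / 2" using False r(1) by (simp add: w_def)
    then have "z0 + w \<in> C k" "z0 \<in> C k" using r by (auto simp: subset_iff dist_norm)
    then have "\<bar>y \<bullet> (z0 + w)\<bar> \<le> real k" "\<bar>y \<bullet> z0\<bar> \<le> real k" using y by (auto simp: C_def)
    then have "y \<bullet> w \<le> 2 * real k" by (simp add: inner_add_right)
    moreover have "y \<bullet> w = r / 2 * norm y"
      using False by (simp add: w_def power2_norm_eq_inner[symmetric] power2_eq_square)
    ultimately show ?thesis using r(1) by (simp add: field_simps)
  qed (use r in simp)
  then show ?thesis by (rule that)
qed

text \<open>The normalised vectors \<open>x / \<parallel>T x\<parallel>\<close> with \<open>x\<close> orthogonal to the kernel are weakly bounded: the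
  kernel contributes nothing, and \<open>\<langle>x, T w\<rangle> = \<langle>T x, w\<rangle>\<close>.\<close>

lemma symmetric_closed_range_bounded_below:
  fixes T :: "'a::{real_inner,banach} \<Rightarrow>\<^sub>L 'a"
  assumes T: "symmetric_op T" and ran: "closed (range T)"
  obtains e where "0 < e"
    "\<And>x. (\<And>z. T z = 0 \<Longrightarrow> x \<bullet> z = 0) \<Longrightarrow> e * norm x \<le> norm (T x)"
proof -
  have M: "closed (range T)" "subspace (range T)"
    using ran linear_subspace_image[OF bounded_linear.linear[OF blinfun.bounded_linear_right[of T]] subspace_UNIV]
    by auto
  define perp where "perp = {x. \<forall>z. T z = 0 \<longrightarrow> x \<bullet> z = 0}"
  define Y where "Y = (\<lambda>x. (1 / norm (T x)) *\<^sub>R x) ` (perp - {0})"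
  have nz: "T x \<noteq> 0" if x: "x \<in> perp" "x \<noteq> 0" for x
  proof
    assume "T x = 0"
    then have "x \<bullet> x = 0" using x(1) unfolding perp_def by blast
    then show False using x(2) by simp
  qed
  have "\<exists>K. \<forall>y\<in>Y. \<bar>y \<bullet> z\<bar> \<le> K" for z
  proof -
    obtain w where w: "proj_onto (range T) z = T w" using proj_onto_in[OF M, of z] by blast
    define n where "n = z - T w"
    have "T n \<bullet> T n = n \<bullet> T (T n)" by (rule symmetric_opD[OF T])
    also have "\<dots> = 0" unfolding n_def w[symmetric] by (rule proj_onto_orthogonal[OF M]) simp
    finally have n: "T n = 0" by simp
    have "\<bar>y \<bullet> z\<bar> \<le> norm w" if y: "y \<in> Y" for y
    proof -
      obtain x where x: "x \<in> perp" "x \<noteq> 0" "y = (1 / norm (T x)) *\<^sub>R x"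
        using y by (auto simp: Y_def)
      have "x \<bullet> n = 0" using x(1) n unfolding perp_def by blast
      then have "x \<bullet> z = T x \<bullet> w"
        using symmetric_opD[OF T, of x w] by (simp add: n_def inner_diff_right)
      then have "\<bar>x \<bullet> z\<bar> \<le> norm (T x) * norm w" using Cauchy_Schwarz_ineq2[of "T x" w] by simp
      then show ?thesis using nz[OF x(1,2)] by (simp add: x(3) abs_mult divide_le_eq mult.commute)
    qed
    then show ?thesis by blast
  qed
  then obtain K where K: "\<And>y. y \<in> Y \<Longrightarrow> norm y \<le> K"
    using uniform_boundedness_inner[of Y] by blast
  \<comment> \<open>The bound \<open>K\<close> may be zero or negative if \<open>Y\<close> is empty.\<close>
  define e where "e = 1 / (\<bar>K\<bar> + 1)"
  have "e * norm x \<le> norm (T x)" if "\<And>z. T z = 0 \<Longrightarrow> x \<bullet> z = 0" for x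
  proof (cases "x = 0")
    case False
    have x: "x \<in> perp" using that by (simp add: perp_def)
    then have "norm ((1 / norm (T x)) *\<^sub>R x) \<le> K" using False by (intro K) (auto simp: Y_def)
    then have "norm x \<le> K * norm (T x)" using nz[OF x False] by (simp add: divide_le_eq)
    also have "\<dots> \<le> (\<bar>K\<bar> + 1) * norm (T x)" by (intro mult_right_mono) auto
    finally show ?thesis by (simp add: e_def divide_le_eq add_pos_nonneg mult.commute)
  qed simp
  then show ?thesis by (intro that[of e]) (auto simp: e_def)
qed

lemma Fredholm_sa_UNIV_D:
  fixes T :: "'a::complex_hilbert \<Rightarrow>\<^sub>L 'a"
  assumes "blinfun_apply T \<in> Fredholm_sa UNIV"
  shows "symmetric_op T" "complex_linear T" "finite_dim {x. T x = 0}" "closed (range T)"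
proof -
  have "cinner (T x) y = cinner x (T y)" for x y
    using assms by (auto simp: Fredholm_sa_def selfadjoint_on_def)
  then have "T x \<bullet> y = x \<bullet> T y" for x y by (simp add: Re_cinner[symmetric])
  then show "symmetric_op T" by (simp add: symmetric_op_def)
  show "complex_linear T"
    using assms by (auto simp: Fredholm_sa_def selfadjoint_on_def bounded_op_on_def complex_linear_def)
  show "finite_dim {x. T x = 0}" "closed (range T)"
    using assms by (auto simp: Fredholm_sa_def fredholm_on_def)
qed

text \<open>If \<open>\<parallel>T x\<parallel> \<ge> e \<parallel>x\<parallel>\<close> off the kernel, then the spectrum in \<open>(-e, e)\<close> is at most \<open>{0}\<close>, and the
  window \<open>[- e/2, e/2]\<close> is the kernel.\<close>

lemma Fredholm_window:
  fixes T :: "'a::complex_hilbert \<Rightarrow>\<^sub>L 'a"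
  assumes F: "blinfun_apply T \<in> Fredholm_sa UNIV"
  obtains \<alpha> where "0 < \<alpha>" "gap_on UNIV T \<alpha> \<alpha>" "gap_on UNIV T (- \<alpha>) \<alpha>"
    "finite_dim (range (window T (- \<alpha>) \<alpha>))"
proof -
  note T = Fredholm_sa_UNIV_D[OF F]
  interpret reduced_operator UNIV T
    by unfold_locales (use T in \<open>auto simp: complex_vector.subspace_UNIV\<close>)
  obtain e where e: "0 < e" "\<And>x. (\<And>z. T z = 0 \<Longrightarrow> x \<bullet> z = 0) \<Longrightarrow> e * norm x \<le> norm (T x)"
    by (rule symmetric_closed_range_bounded_below[OF T(1,4)]) blast
  define \<alpha> where "\<alpha> = e / 2"
  have \<alpha>: "0 < \<alpha>" "e = 2 * \<alpha>" using e by (simp_all add: \<alpha>_def)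
  define K where "K = {x. T x = 0}"
  have K: "closed K" "subspace K"
    using finite_dim_subspace_closed[OF T(3)] unfolding K_def
    by (auto intro!: complex_subspace_real closed_Collect_eq continuous_intros)
  let ?p = "proj_onto K"
  have pK: "T (?p x) = 0" for x using proj_onto_in[OF K, of x] by (simp add: K_def)
  have off: "2 * \<alpha> * norm (x - ?p x) \<le> norm (T x)" for x
  proof -
    have "(x - ?p x) \<bullet> z = 0" if "T z = 0" for z
      by (rule proj_onto_orthogonal[OF K]) (simp add: K_def that)
    from e(2)[OF this] show ?thesis by (simp add: \<alpha>(2) blinfun.diff_right pK)
  qed
  have gap: "gap_on UNIV T c \<alpha>" if c: "\<bar>c\<bar> = \<alpha>" for c
    unfolding gap_on_def
  proof
    fix x
    let ?y = "x - ?p x"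
    have Ty: "T ?y = T x" by (simp add: blinfun.diff_right pK)
    have ortho: "?y \<bullet> ?p x = 0" by (rule proj_onto_orthogonal[OF K proj_onto_in[OF K]])
    have "T ?y \<bullet> ?p x = 0" by (simp add: symmetric_opD[OF T(1)] pK)
    then have 1: "(norm (T x - c *\<^sub>R x))\<^sup>2 = (norm (T ?y - c *\<^sub>R ?y))\<^sup>2 + (norm (c *\<^sub>R ?p x))\<^sup>2"
      using ortho norm_add_Pythagorean[of "T ?y - c *\<^sub>R ?y" "- c *\<^sub>R ?p x"]
      by (simp add: orthogonal_def inner_diff_left Ty scaleR_right_diff_distrib)
    have 2: "(norm x)\<^sup>2 = (norm (?p x))\<^sup>2 + (norm ?y)\<^sup>2"
      by (rule projection_op_Pythagoras[OF projection_op_proj_onto[OF K]])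
    have "2 * \<alpha> * norm ?y \<le> norm (T ?y - c *\<^sub>R ?y) + \<alpha> * norm ?y"
      using off[of x] norm_triangle_ineq[of "T ?y - c *\<^sub>R ?y" "c *\<^sub>R ?y"] c by (simp add: Ty)
    then have "(\<alpha> * norm ?y)\<^sup>2 \<le> (norm (T ?y - c *\<^sub>R ?y))\<^sup>2"
      using \<alpha>(1) by (intro power_mono) auto
    then have "(\<alpha> * norm x)\<^sup>2 \<le> (norm (T x - c *\<^sub>R x))\<^sup>2"
      using c by (simp add: 1 2 power_mult_distrib distrib_left)
    then show "\<alpha> * norm x \<le> norm (T x - c *\<^sub>R x)" by (rule power2_le_imp_le) simp
  qed
  have "range (window T (- \<alpha>) \<alpha>) \<subseteq> K"
  proof
    fix x assume "x \<in> range (window T (- \<alpha>) \<alpha>)"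
    then have x: "window T (- \<alpha>) \<alpha> x = x" using in_window_iff[of "- \<alpha>" \<alpha> x] \<alpha>(1) by simp
    have "commutes T ?p"
      by (rule symmetric_commutes_proj_onto[OF K T(1)]) (simp add: K_def blinfun.zero_right)
    then have "commutes ?p (window T (- \<alpha>) \<alpha>)"
      by (rule commutes_window[OF T(1) commutes_sym])
    from commutesD[OF this, of x] have "window T (- \<alpha>) \<alpha> (x - ?p x) = x - ?p x"
      by (simp add: x blinfun.diff_right)
    then have "norm (T (x - ?p x)) \<le> \<alpha> * norm (x - ?p x)"
      using norm_shift_le_on_window[OF T(1), of "- \<alpha>" \<alpha> "x - ?p x"] \<alpha>(1) by simp
    then have "\<alpha> * norm (x - ?p x) \<le> 0" using off[of x] by (simp add: blinfun.diff_right pK)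
    then have "norm (x - ?p x) \<le> 0" using \<alpha>(1) by (simp add: mult_le_0_iff)
    then have "?p x = x" by simp
    then show "x \<in> K" using proj_onto_in[OF K, of x] by simp
  qed
  then have "finite_dim (range (window T (- \<alpha>) \<alpha>))"
    using T(3) subspace_window unfolding K_def by (rule finite_dim_subset[rotated 2])
  then show ?thesis using that[OF \<alpha>(1) gap gap] \<alpha>(1) by simp
qed

section \<open>Eigenspaces of the rotation\<close>

lemma continuous_scaleC: "continuous_on UNIV (\<lambda>x::'a::complex_inner. c *\<^sub>C x)"
proof -
  have "(\<lambda>x::'a. c *\<^sub>C x) = (\<lambda>x. Re c *\<^sub>R x + Im c *\<^sub>R imaginary_unit x)"
    by (simp add: fun_eq_iff scaleC_eq[of c] imaginary_unit_apply)
  then show ?thesis by (simp add: continuous_intros)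
qed

locale cyclic_unitary =
  fixes n :: nat and R :: "'a::complex_hilbert \<Rightarrow> 'a"
  assumes n: "n \<ge> 1" and unitary: "unitary_op R" and R_pow: "R ^^ n = id"
begin

definition \<omega> :: complex
  where "\<omega> = exp (2 * of_real pi * \<i> / of_nat n)"

abbreviation E :: "int \<Rightarrow> 'a set"
  where "E \<equiv> dihedral_E n R"

lemma E_iff: "x \<in> E k \<longleftrightarrow> R x = (\<omega> powi k) *\<^sub>C x"
  by (simp add: dihedral_E_def \<omega>_def)

lemma \<omega>_nonzero: "\<omega> \<noteq> 0" by (simp add: \<omega>_def)

lemma \<omega>_powi_eq_1_iff: "\<omega> powi k = 1 \<longleftrightarrow> int n dvd k"
proof -
  have "\<omega> powi k = exp (of_int k * (2 * of_real pi * \<i> / of_nat n))"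
    unfolding \<omega>_def by (rule exp_power_int)
  moreover have "exp (of_int k * (2 * of_real pi * \<i> / of_nat n)) = 1 \<longleftrightarrow> (\<exists>j::int. k = j * int n)"
  proof -
    have "exp (of_int k * (2 * of_real pi * \<i> / of_nat n)) = 1 \<longleftrightarrow>
        (\<exists>j::int. of_int k * (2 * pi / n) = of_int (2 * j) * pi)"
      by (simp add: exp_eq_1)
    also have "\<dots> \<longleftrightarrow> (\<exists>j::int. k = j * int n)"
    proof (intro ex_cong1)
      fix j :: int
      have "of_int k * (2 * pi / n) = of_int (2 * j) * pi \<longleftrightarrow> real_of_int k = real_of_int (j * int n)"
        using n by (simp add: field_simps)
      then show "of_int k * (2 * pi / n) = of_int (2 * j) * pi \<longleftrightarrow> k = j * int n"
        by (simp only: of_int_eq_iff)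
    qed
    finally show ?thesis .
  qed
  ultimately show ?thesis by (auto simp: dvd_def mult.commute)
qed

lemma \<omega>_powi_eq_iff: "\<omega> powi j = \<omega> powi k \<longleftrightarrow> int n dvd j - k"
  using \<omega>_nonzero by (simp add: \<omega>_powi_eq_1_iff[symmetric] power_int_diff)

lemma E_cong: "int n dvd j - k \<Longrightarrow> E j = E k"
  using \<omega>_powi_eq_iff[of j k] by (auto simp: E_iff)

lemma norm_\<omega>_powi: "norm (\<omega> powi k) = 1"
  by (simp add: \<omega>_def norm_power_int norm_exp_eq_Re)

lemma R_add: "R (x + y) = R x + R y" and R_scaleC: "R (c *\<^sub>C x) = c *\<^sub>C R x"
  using unitary by (auto simp: unitary_op_def bounded_op_on_def)

lemma R_bounded_linear: "bounded_linear R"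
proof -
  obtain K where "\<And>x. norm (R x) \<le> K * norm x"
    using unitary by (auto simp: unitary_op_def bounded_op_on_def)
  then show ?thesis
    using R_scaleC[of "of_real _"] by (intro bounded_linear_intro[of R K])
      (auto simp: R_add scaleC_of_real mult.commute)
qed

lemma R_pow_linear: "(R ^^ m) (x + y) = (R ^^ m) x + (R ^^ m) y"
    "(R ^^ m) (c *\<^sub>C x) = c *\<^sub>C (R ^^ m) x"
  by (induction m) (simp_all add: R_add R_scaleC)

lemma R_pow_continuous: "continuous_on UNIV (R ^^ m)"
proof (induction m)
  case (Suc m)
  then show ?case
    using bounded_linear.continuous_on[OF R_bounded_linear, of UNIV "R ^^ m"] by (simp add: o_def)
qed (simp add: id_def)

lemma subspace_E: "complex_vector.subspace (E k)"
proof (rule complex_vector.subspaceI)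
  have "R 0 = 0" using R_scaleC[of 0 0] by simp
  then show "0 \<in> E k" by (simp add: E_iff)
  show "x + y \<in> E k" if "x \<in> E k" "y \<in> E k" for x y
    using that by (simp add: E_iff R_add scaleC_add_right)
  show "c *\<^sub>C x \<in> E k" if "x \<in> E k" for c x
    using that by (simp add: E_iff R_scaleC scaleC_scaleC mult.commute)
qed

lemma E_orthogonal:
  assumes "x \<in> E j" "y \<in> E k" "\<not> int n dvd j - k"
  shows "x \<bullet> y = 0"
proof -
  have "cinner x y = cinner (R x) (R y)" using unitary by (simp add: unitary_op_def)
  also have "\<dots> = \<omega> powi j * cnj (\<omega> powi k) * cinner x y"
    using assms(1,2) cinner_commute[of x "\<omega> powi k *\<^sub>C y"]
    by (simp add: E_iff cinner_scaleC_left) (simp add: cinner_commute[of y x])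
  finally have "(\<omega> powi j * cnj (\<omega> powi k) - 1) * cinner x y = 0" by (simp add: algebra_simps)
  moreover have "\<omega> powi j * cnj (\<omega> powi k) \<noteq> 1"
  proof
    assume 1: "\<omega> powi j * cnj (\<omega> powi k) = 1"
    have "\<omega> powi k * cnj (\<omega> powi k) = 1"
      using complex_norm_square[of "\<omega> powi k"] by (simp add: norm_\<omega>_powi)
    then have "\<omega> powi j * (\<omega> powi k * cnj (\<omega> powi k)) = \<omega> powi j" by simp
    moreover have "\<omega> powi j * (\<omega> powi k * cnj (\<omega> powi k)) = \<omega> powi k"
      using 1 by (simp add: mult.left_commute)
    ultimately have "\<omega> powi j = \<omega> powi k" by (rule trans[OF sym])
    then show False using \<omega>_powi_eq_iff assms(3) by blast
  qed
  ultimately show ?thesis by (simp add: Re_cinner[symmetric])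
qed

text \<open>The average of \<open>\<omega>\<^sup>-\<^sup>k\<^sup>m R\<^sup>m\<close> over the cyclic group is the projection onto \<open>E k\<close>.\<close>

definition component :: "int \<Rightarrow> 'a \<Rightarrow> 'a"
  where "component k x = (\<Sum>m<n. (\<omega> powi (- k * int m) / of_nat n) *\<^sub>C (R ^^ m) x)"

lemma component_in_E: "component k x \<in> E k"
proof -
  define f where "f m = (\<omega> powi (- k * int m) / of_nat n) *\<^sub>C (R ^^ m) x" for m
  have f0: "f n = f 0"
    using \<omega>_powi_eq_1_iff[of "- k * int n"] by (simp add: f_def R_pow)
  have step: "R (f m) = \<omega> powi k *\<^sub>C f (Suc m)" for m
  proof -
    have "\<omega> powi (- k * int m) = \<omega> powi k * \<omega> powi (- k * int (Suc m))"
      using \<omega>_nonzero by (simp add: power_int_add[symmetric] algebra_simps)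
    then show ?thesis by (simp add: f_def R_scaleC scaleC_scaleC)
  qed
  have R_sum: "R (sum g I) = (\<Sum>i\<in>I. R (g i))" for g :: "nat \<Rightarrow> 'a" and I
    by (rule linear_sum[OF bounded_linear.linear[OF R_bounded_linear]])
  have "(\<Sum>m<n. f (Suc m)) = (\<Sum>m<n. f m)"
    using sum.lessThan_Suc_shift[of f n] sum.lessThan_Suc[of f n] f0 by simp
  moreover have "R (\<Sum>m<n. f m) = \<omega> powi k *\<^sub>C (\<Sum>m<n. f (Suc m))"
    by (simp add: R_sum step complex_vector.scale_sum_right)
  ultimately show ?thesis
    unfolding E_iff component_def f_def[symmetric] by simp
qed

lemma root_of_unity_sum:
  "(\<Sum>m<n. \<omega> powi (k * int m)) = (if int n dvd k then of_nat n else 0)"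
proof (cases "int n dvd k")
  case True
  then have "\<omega> powi (k * int m) = 1" for m by (simp add: \<omega>_powi_eq_1_iff)
  then show ?thesis using True by simp
next
  case False
  have pow: "\<omega> powi (k * int m) = (\<omega> powi k) ^ m" for m by (simp add: power_int_mult)
  have "(\<omega> powi k) ^ n = 1" using \<omega>_powi_eq_1_iff[of "k * int n"] pow[of n] by simp
  then show ?thesis
    using False geometric_sum[of "\<omega> powi k" n] by (simp add: pow \<omega>_powi_eq_1_iff)
qed

lemma component_E:
  assumes "x \<in> E j"
  shows "component k x = (if int n dvd j - k then x else 0)"
proof -
  have pow: "(R ^^ m) x = \<omega> powi (j * int m) *\<^sub>C x" for m
  proof (induction m)
    case (Suc m)
    have "R ((R ^^ m) x) = (\<omega> powi (j * int m) * \<omega> powi j) *\<^sub>C x"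
      using assms by (simp add: Suc R_scaleC E_iff scaleC_scaleC)
    then show ?case using \<omega>_nonzero by (simp add: power_int_add[symmetric] algebra_simps)
  qed simp
  have "component k x = (\<Sum>m<n. (\<omega> powi ((j - k) * int m) / of_nat n) *\<^sub>C x)"
    unfolding component_def pow
    using \<omega>_nonzero by (intro sum.cong) (simp_all add: scaleC_scaleC power_int_add[symmetric] algebra_simps)
  also have "\<dots> = ((\<Sum>m<n. \<omega> powi ((j - k) * int m)) / of_nat n) *\<^sub>C x"
    by (simp add: complex_vector.scale_sum_left sum_divide_distrib)
  finally show ?thesis using n by (simp add: root_of_unity_sum)
qed

lemma sum_components: "(\<Sum>k<n. component (int k) x) = x"
proof -
  have "(\<Sum>k<n. component (int k) x) =
      (\<Sum>m<n. ((\<Sum>k<n. \<omega> powi (- int m * int k)) / of_nat n) *\<^sub>C (R ^^ m) x)"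
    unfolding component_def
    by (subst sum.swap) (simp add: complex_vector.scale_sum_left sum_divide_distrib mult.commute)
  also have "\<dots> = (\<Sum>m<n. if m = 0 then x else 0)"
  proof (rule sum.cong)
    fix m assume m: "m \<in> {..<n}"
    have "int n dvd - int m \<longleftrightarrow> m = 0"
      using m by (auto dest: nat_dvd_not_less simp: int_dvd_int_iff)
    then show "((\<Sum>k<n. \<omega> powi (- int m * int k)) / of_nat n) *\<^sub>C (R ^^ m) x = (if m = 0 then x else 0)"
      using n unfolding root_of_unity_sum by simp
  qed simp
  also have "\<dots> = x" using n by (simp add: sum.delta')
  finally show ?thesis .
qed

lemma component_cong: "int n dvd j - k \<Longrightarrow> component j x = component k x"
proof -
  assume "int n dvd j - k"
  then have "\<omega> powi (- j * int m) = \<omega> powi (- k * int m)" for m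
    by (subst \<omega>_powi_eq_iff) (simp add: left_diff_distrib[symmetric] dvd_diff_commute)
  then show ?thesis by (simp add: component_def)
qed

lemma component_continuous: "continuous_on UNIV (component k)"
  unfolding component_def
  by (intro continuous_on_sum continuous_on_compose2[OF continuous_scaleC] R_pow_continuous subset_UNIV)

abbreviation F :: "nat \<Rightarrow> 'a set"
  where "F \<equiv> dihedral_F n R"

definition F_component :: "nat \<Rightarrow> 'a \<Rightarrow> 'a"
  where "F_component k x = (if k = 0 \<or> 2 * k = n then component (int k) x
    else component (int k) x + component (- int k) x)"

text \<open>The two exceptional cases fit the general one, because \<open>E k = E (- k)\<close> there.\<close>

lemma F_alt: "F k = sum_space (E (int k)) (E (- int k))"
proof -
  have "sum_space (E j) (E j) = E j" for j
  proof -
    have "0 \<in> E j" by (rule complex_vector.subspace_0[OF subspace_E])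
    then show ?thesis
      using complex_vector.subspace_add[OF subspace_E[of j]] unfolding sum_space_def
      by (auto intro: exI[of _ "0::'a"])
  qed
  moreover have "E (- int k) = E (int k)" if "2 * k = n"
    using that by (intro E_cong) auto
  ultimately show ?thesis
    by (auto simp: dihedral_F_def sum_space_def[symmetric])
qed

lemma F_component_in_F: "F_component k x \<in> F k"
  using component_in_E[of "int k" x] component_in_E[of "- int k" x]
  by (auto simp: F_component_def dihedral_F_def)

lemma not_dvd_double:
  assumes "k \<noteq> 0" "2 * k < n"
  shows "\<not> int n dvd 2 * int k" "\<not> int n dvd - (2 * int k)"
  using assms zdvd_imp_le[of "int n" "2 * int k"] by auto

lemma F_component_F:
  assumes "x \<in> F k" "2 * k \<le> n"
  shows "F_component k x = x"
proof -
  obtain u v where x: "x = u + v" "u \<in> E (int k)" "v \<in> E (- int k)"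
    using assms(1) by (auto simp: F_alt sum_space_def)
  have add: "component j (u + v) = component j u + component j v" for j
    by (simp add: component_def R_pow_linear scaleC_add_right sum.distrib)
  show ?thesis
  proof (cases "k = 0 \<or> 2 * k = n")
    case True
    then have "int n dvd - int k - int k" by auto
    then show ?thesis
      using True by (simp add: F_component_def x add component_E[OF x(2)] component_E[OF x(3)])
  next
    case False
    then have "k \<noteq> 0" "2 * k < n" using assms(2) by auto
    from not_dvd_double[OF this] show ?thesis
      using False by (simp add: F_component_def x add component_E[OF x(2)] component_E[OF x(3)])
  qed
qed

text \<open>\<open>F k\<close> is the set of fixed points of a continuous map.\<close>

lemma closed_F:
  assumes "2 * k \<le> n"
  shows "closed (F k)"
proof -
  have "F k = {x. F_component k x = x}"
    using F_component_F[OF _ assms] F_component_in_F by (auto) (metis)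
  moreover have "continuous_on UNIV (F_component k)"
    unfolding F_component_def[abs_def]
    using component_continuous[of "int k"] component_continuous[of "- int k"]
    by (cases "k = 0 \<or> 2 * k = n") (auto intro: continuous_on_add)
  ultimately show ?thesis by (auto intro: closed_Collect_eq continuous_on_id)
qed

lemma subspace_F: "complex_vector.subspace (F k)"
  unfolding F_alt sum_space_def by (intro complex_vector.subspace_sums subspace_E)

lemma F_orthogonal:
  assumes "x \<in> F j" "y \<in> F k" "j < k" "2 * k \<le> n"
  shows "x \<bullet> y = 0"
proof -
  obtain u v where x: "x = u + v" "u \<in> E (int j)" "v \<in> E (- int j)"
    using assms(1) by (auto simp: F_alt sum_space_def)
  obtain u' v' where y: "y = u' + v'" "u' \<in> E (int k)" "v' \<in> E (- int k)"
    using assms(2) by (auto simp: F_alt sum_space_def)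
  have nd: "\<not> int n dvd d" if "d \<noteq> 0" "\<bar>d\<bar> < int n" for d
    using that zdvd_imp_le[of "int n" "\<bar>d\<bar>"] by auto
  have jk: "0 \<le> int j" "int j < int k" "2 * int k \<le> int n" using assms(3,4) by auto
  have "u \<bullet> u' = 0" by (rule E_orthogonal[OF x(2) y(2)], rule nd; use jk in linarith)
  moreover have "u \<bullet> v' = 0" by (rule E_orthogonal[OF x(2) y(3)], rule nd; use jk in linarith)
  moreover have "v \<bullet> u' = 0" by (rule E_orthogonal[OF x(3) y(2)], rule nd; use jk in linarith)
  moreover have "v \<bullet> v' = 0" by (rule E_orthogonal[OF x(3) y(3)], rule nd; use jk in linarith)
  ultimately show ?thesis by (simp add: x y inner_add)
qed

text \<open>The components with index above \<open>n / 2\<close> are the components \<open>- k\<close> for \<open>0 < k < n / 2\<close>, by \<open>j = n - k\<close>.\<close>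

lemma sum_F_components: "(\<Sum>k=0..n div 2. F_component k x) = x"
proof -
  let ?c = "\<lambda>j. component j x"
  define J where "J = {k \<in> {0..n div 2}. k \<noteq> 0 \<and> 2 * k \<noteq> n}"
  have "(\<Sum>k=0..n div 2. F_component k x) =
      (\<Sum>k=0..n div 2. ?c (int k) + (if k \<noteq> 0 \<and> 2 * k \<noteq> n then ?c (- int k) else 0))"
    by (intro sum.cong) (auto simp: F_component_def)
  also have "\<dots> = (\<Sum>k=0..n div 2. ?c (int k)) + (\<Sum>k\<in>J. ?c (- int k))"
    by (simp add: sum.distrib J_def sum.If_cases Int_def)
  also have "(\<Sum>k\<in>J. ?c (- int k)) = (\<Sum>k\<in>{n div 2<..<n}. ?c (int k))"
  proof (rule sum.reindex_bij_witness[of _ "\<lambda>k. n - k" "\<lambda>k. n - k"])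
    fix k assume k: "k \<in> J"
    then show "n - (n - k) = k" "n - k \<in> {n div 2<..<n}" by (auto simp: J_def)
    show "?c (int (n - k)) = ?c (- int k)"
      using k by (intro component_cong) (auto simp: J_def of_nat_diff)
  next
    fix k assume "k \<in> {n div 2<..<n}"
    then show "n - (n - k) = k" "n - k \<in> J" by (auto simp: J_def)
  qed
  also have "(\<Sum>k=0..n div 2. ?c (int k)) + (\<Sum>k\<in>{n div 2<..<n}. ?c (int k)) = (\<Sum>k<n. ?c (int k))"
  proof -
    have "{0..n div 2} \<union> {n div 2<..<n} = {..<n}" using n by auto
    moreover have disj: "{0..n div 2} \<inter> {n div 2<..<n} = {}" by auto
    ultimately show ?thesis
      by (simp only: sum.union_disjoint[OF finite_atLeastAtMost finite_greaterThanLessThan disj, symmetric])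
  qed
  finally show ?thesis by (simp add: sum_components)
qed

lemma E_invariant:
  fixes C :: "'a \<Rightarrow>\<^sub>L 'a"
  assumes "complex_linear C" "\<And>x. C (R x) = R (C x)" "x \<in> E k"
  shows "C x \<in> E k"
  using assms by (metis E_iff complex_linear_def)

lemma F_invariant:
  fixes C :: "'a \<Rightarrow>\<^sub>L 'a"
  assumes "complex_linear C" "\<And>x. C (R x) = R (C x)" "x \<in> F k"
  shows "C x \<in> F k"
  using assms(3) E_invariant[OF assms(1,2)] unfolding F_alt sum_space_def
  by (auto simp: blinfun.add_right) blast

text \<open>An operator \<open>C\<close> that commutes with \<open>R\<close> preserves every \<open>F k\<close>, so its range is the sum of the images
  of the \<open>F k\<close>.  Being orthogonal, these have dimensions that add up.\<close>

lemma dim_range_eq_sum: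
  fixes C :: "'a \<Rightarrow>\<^sub>L 'a"
  assumes C: "complex_linear C" "\<And>x. C (R x) = R (C x)" and fin: "finite_dim (range C)"
  shows "complex_vector.dim (range C) = (\<Sum>k=0..n div 2. complex_vector.dim (C ` F k))"
proof -
  interpret C: module_hom scaleC scaleC C
    using C(1) by unfold_locales (simp_all add: blinfun.add_right complex_linear_def)
  have fin_k: "finite_dim (C ` F k)" for k
    by (rule finite_dim_subset[OF fin C.subspace_image[OF subspace_F]]) auto
  define U where "U m = {(\<Sum>k<m. g k) | g. \<forall>k<m. g k \<in> C ` F k}" for m
  have U_Suc: "U (Suc m) = sum_space (U m) (C ` F m)" for m
  proof (intro equalityI subsetI)
    fix y assume "y \<in> U (Suc m)"
    then obtain g where "y = (\<Sum>k<m. g k) + g m" "\<forall>k<Suc m. g k \<in> C ` F k" by (auto simp: U_def)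
    then show "y \<in> sum_space (U m) (C ` F m)" unfolding sum_space_def U_def by force
  next
    fix y assume "y \<in> sum_space (U m) (C ` F m)"
    then obtain g z where y: "y = (\<Sum>k<m. g k) + z" "\<forall>k<m. g k \<in> C ` F k" "z \<in> C ` F m"
      by (auto simp: sum_space_def U_def)
    then show "y \<in> U (Suc m)"
      unfolding U_def by (intro CollectI exI[of _ "g(m := z)"]) (auto simp: less_Suc_eq)
  qed
  have "finite_dim (U m) \<and> complex_vector.dim (U m) = (\<Sum>k<m. complex_vector.dim (C ` F k))"
    if "m \<le> Suc (n div 2)" for m
    using that
  proof (induction m)
    case 0
    have U0: "U 0 = complex_vector.span {}" by (auto simp: U_def)
    then have "finite_dim (U 0)" unfolding finite_dim_def by blast
    moreover have "complex_vector.dim (U 0) = 0"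
      unfolding U0 using complex_vector.dim_span_eq_card_independent[OF complex_vector.independent_empty] by simp
    ultimately show ?case by simp
  next
    case (Suc m)
    have "x = 0" if x: "x \<in> U m" "x \<in> C ` F m" for x
    proof -
      obtain g where g: "x = (\<Sum>k<m. g k)" "\<forall>k<m. g k \<in> C ` F k" using x(1) by (auto simp: U_def)
      have xF: "x \<in> F m" using x(2) F_invariant[OF C] by blast
      have "g k \<bullet> x = 0" if "k < m" for k
        using F_orthogonal[OF _ xF that] g(2) that Suc.prems F_invariant[OF C] by auto
      then have "x \<bullet> x = 0" by (subst g(1)) (simp add: inner_sum_left)
      then show ?thesis by simp
    qed
    then show ?case
      using Suc dim_direct_sum[of "U m" "C ` F m"] fin_k by (simp add: U_Suc)
  qed
  moreover have "U (Suc (n div 2)) = range C"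
  proof (intro equalityI subsetI)
    fix y assume "y \<in> range C"
    then obtain x where "y = C x" by blast
    then have "y = (\<Sum>k<Suc (n div 2). C (F_component k x))"
      using sum_F_components[of x] by (simp add: C.sum[symmetric] atLeast0AtMost lessThan_Suc_atMost)
    then show "y \<in> U (Suc (n div 2))" using F_component_in_F unfolding U_def by blast
  next
    fix y assume "y \<in> U (Suc (n div 2))"
    then obtain g where "y = (\<Sum>k<Suc (n div 2). g k)" and g: "\<forall>k<Suc (n div 2). g k \<in> C ` F k"
      unfolding U_def by blast
    moreover have "(\<Sum>k<Suc (n div 2). g k) \<in> range C"
      by (rule complex_vector.subspace_sum[OF C.subspace_image[OF complex_vector.subspace_UNIV]])
        (use g in blast)
    ultimately show "y \<in> range C" by simp
  qed
  ultimately show ?thesis by (metis atLeast0AtMost lessThan_Suc_atMost order_refl)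
qed

end


section \<open>Additivity of the spectral flow\<close>

theorem proposition1:
  fixes n :: nat
    and R S :: "'a::complex_hilbert \<Rightarrow> 'a"
    and A :: "real \<Rightarrow> 'a \<Rightarrow>\<^sub>L 'a"
  assumes "separable_space (euclidean :: 'a topology)"
    and "n \<ge> 1"
    and "dihedral_unitary_rep n R S"
    and "continuous_on {0..1} A"
    and "\<And>l. l \<in> {0..1} \<Longrightarrow> blinfun_apply (A l) \<in> Fredholm_sa UNIV"
    and "\<And>l. l \<in> {0..1} \<Longrightarrow> blinfun_apply (A l) \<circ> R = R \<circ> blinfun_apply (A l)"
    and "\<And>l. l \<in> {0..1} \<Longrightarrow> blinfun_apply (A l) \<circ> S = S \<circ> blinfun_apply (A l)"
  shows "spectral_flow UNIV (\<lambda>l. blinfun_apply (A l)) 0 1 =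
    (\<Sum>k=0..n div 2. spectral_flow (dihedral_F n R k)
       (\<lambda>l. restrict (blinfun_apply (A l)) (dihedral_F n R k)) 0 1)"
proof -
  interpret R: cyclic_unitary n R
    using assms(2,3) by unfold_locales (auto simp: dihedral_unitary_rep_def)
  have AR: "A l (R x) = R (A l x)" if "l \<in> {0..1}" for l x
    using fun_cong[OF assms(6)[OF that], of x] by simp
  note A = Fredholm_sa_UNIV_D[OF assms(5)]
  interpret whole: reduced_path UNIV A 0 1
    using A(1,2) assms(4) by unfold_locales (auto simp: complex_vector.subspace_UNIV)
  have part: "reduced_path (R.F k) A 0 1" if "k \<in> {0..n div 2}" for k
    using that A(1,2) assms(4) R.closed_F[of k] R.subspace_F[of k] R.F_invariant[OF A(2) AR]
    by unfold_locales auto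
  \<comment> \<open>Symmetry of the path passes to its spectral projections.\<close>
  have window_R: "window (A s) c d (R x) = R (window (A s) c d x)" if s: "s \<in> {0..1}" for s c d x
  proof -
    have Rb: "Blinfun R x = R x" for x
      by (simp add: bounded_linear_Blinfun_apply R.R_bounded_linear)
    have "commutes (Blinfun R) (A s)" using AR[OF s] by (simp add: commutes_def Rb)
    from commutesD[OF commutes_window[OF A(1)[OF s] this]] show ?thesis by (simp add: Rb)
  qed
  have "\<exists>\<alpha>. whole.admissible s \<alpha>" if s: "s \<in> {0..1}" for s
  proof -
    obtain \<alpha> where "0 < \<alpha>" "gap_on UNIV (A s) \<alpha> \<alpha>" "gap_on UNIV (A s) (- \<alpha>) \<alpha>"
      "finite_dim (range (window (A s) (- \<alpha>) \<alpha>))"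
      by (rule Fredholm_window[OF assms(5)[OF s]])
    then show ?thesis by (auto simp: whole.admissible_def whole.gapped_def)
  qed
  then obtain N t \<alpha> where p: "whole.admissible_partition N t \<alpha>"
    by (rule whole.admissible_partition_exists)
  have in_01: "s \<in> {0..1}" if "i \<in> {1..N}" "s \<in> {t (i - 1)..t i}" for i s
  proof -
    have "i - 1 \<le> N" "i \<le> N" using that(1) by auto
    from whole.admissible_partition_ends(1)[OF p this(1)] whole.admissible_partition_ends(2)[OF p this(2)]
    show ?thesis using that(2) by auto
  qed
  \<comment> \<open>Lower bounds and finite dimension are inherited by subspaces, so one partition serves all
    restrictions.\<close>
  have p_part: "reduced_path.admissible_partition (R.F k) A 0 1 N t \<alpha>" if k: "k \<in> {0..n div 2}" for k
  proof -
    interpret P: reduced_path "R.F k" A 0 1 by (rule part[OF k])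
    have "P.admissible s \<beta>" if s: "s \<in> {0..1}" and adm: "whole.admissible s \<beta>" for s \<beta>
    proof -
      have "P.gapped s c" if "whole.gapped s c" for c
        using that unfolding P.gapped_def whole.gapped_def gap_on_def by blast
      moreover have "finite_dim (window (A s) (- \<beta>) \<beta> ` R.F k)"
        by (rule finite_dim_subset[OF _ reduced_operator.subspace_window[OF P.reduced[OF s]]])
          (use adm in \<open>auto simp: whole.admissible_def\<close>)
      ultimately show ?thesis using adm by (auto simp: P.admissible_def whole.admissible_def)
    qed
    moreover note in_01
    ultimately show ?thesis
      using p unfolding P.admissible_partition_def whole.admissible_partition_def by blast
  qed
  have dim_sum: "complex_vector.dim (range (window (A s) 0 (\<alpha> i))) =
      (\<Sum>k=0..n div 2. complex_vector.dim (window (A s) 0 (\<alpha> i) ` R.F k))"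
    if i: "i \<in> {1..N}" and s: "s \<in> {t (i - 1)..t i}" for i s
  proof -
    note s01 = in_01[OF i s]
    have adm: "whole.admissible s (\<alpha> i)" using p i s by (auto simp: whole.admissible_partition_def)
    note red = whole.reduced[OF s01]
    have "finite_dim (range (window (A s) 0 (\<alpha> i)))"
      by (rule reduced_operator.finite_dim_window_mono[OF red, of "- \<alpha> i" "\<alpha> i"])
        (use adm in \<open>simp_all add: whole.admissible_def\<close>)
    then show ?thesis
      by (rule R.dim_range_eq_sum[OF reduced_operator.complex_linear_window[OF red] window_R[OF s01]])
  qed
  have "spectral_flow UNIV (\<lambda>l. A l) 0 1 = whole.partition_flow N t \<alpha>"
    using whole.spectral_flow_eq_partition_flow[OF p] by (simp add: restrict_def)
  also have "\<dots> = (\<Sum>i=1..N. \<Sum>k=0..n div 2.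
      int (complex_vector.dim (window (A (t i)) 0 (\<alpha> i) ` R.F k))
      - int (complex_vector.dim (window (A (t (i - 1))) 0 (\<alpha> i) ` R.F k)))"
    unfolding whole.partition_flow_def
  proof (rule sum.cong)
    fix i assume i: "i \<in> {1..N}"
    then have "t (i - 1) < t i" using p by (auto simp: whole.admissible_partition_def)
    then show "int (complex_vector.dim (range (window (A (t i)) 0 (\<alpha> i))))
        - int (complex_vector.dim (range (window (A (t (i - 1))) 0 (\<alpha> i)))) =
      (\<Sum>k=0..n div 2. int (complex_vector.dim (window (A (t i)) 0 (\<alpha> i) ` R.F k))
      - int (complex_vector.dim (window (A (t (i - 1))) 0 (\<alpha> i) ` R.F k)))"
      using dim_sum[OF i, of "t i"] dim_sum[OF i, of "t (i - 1)"] by (simp add: sum_subtractf)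
  qed simp
  also have "\<dots> = (\<Sum>k=0..n div 2. reduced_path.partition_flow (R.F k) A N t \<alpha>)"
    by (subst sum.swap) (intro sum.cong refl, simp add: reduced_path.partition_flow_def[OF part])
  also have "\<dots> = (\<Sum>k=0..n div 2. spectral_flow (R.F k) (\<lambda>l. restrict (A l) (R.F k)) 0 1)"
    using reduced_path.spectral_flow_eq_partition_flow[OF part p_part] by (intro sum.cong) simp_all
  finally show ?thesis .
qed

end
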